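(* Let $(V^N)_{N\in\mathbb{N}}$ be a family of unitary vertex operator algebras of CFT type together with connecting maps $f_{MN}$ that form a grading-restricted direct system and are compatible with the unitary structure. If the structure constants $C^N_{abc}$ converge as $N\to\infty$ for all basis vectors $a,b,c$, then the VA-limit $(V^\infty,Y_\infty)$ exists and is a grading-restricted unitary Möbius vertex algebra of CFT type. Moreover, if $V^\infty$ factorizes, then the limit is unique up to isomorphism: if $(V^N,f_{MN})$ and $(V^N,\tilde f_{MN})$ are two systems such that, for each of the two, the connecting maps ($f$ and $\tilde f$ respectively) form a grading-restricted direct system and are compatible with the unitary structure, and the structure constants of the system converge as $N\to\infty$ for all basis vectors $a,b,c$ of its direct limit, and whose VA-limits both factorize, then the two limits are isomorphic as grading-restricted vertex algebras.
   Context: All vector spaces are over $\mathbb{C}$. **Vertex algebra.** $(V,|0\rangle,Y)$: a vector space $V$, a non-zero vector $|0\rangle$, a linear map $a\mapsto Y(a,z)=\sum_{n\in\mathbb{Z}}a_nz^{-n-1}\in\mathrm{End}(V)[[z,z^{-1}]]$ with $a_nv=0$ for $n$ large (each $a,v$), $Y(a,z)|0\rangle=a+O(z)$, $Y(|0\rangle,z)=\mathbf 1_V$, and Borcherds' identity $$\sum_{j\ge0}\binom mj(a_{n+j}b)_{m+k-j}c=\sum_{j\ge0}(-1)^j\binom nj a_{m+n-j}(b_{k+j}c)-\sum_{j\ge0}(-1)^{j+n}\binom nj b_{n+k-j}(a_{m+j}c)$$ for all $a,b,c\in V$, $k,m,n\in\mathbb{Z}$. The translation operator is $L(-1)a:=a_{-2}|0\rangle$.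 It is **grading-restricted** if $V=\bigoplus_{n\in\mathbb{Z}}V_{(n)}$ with $V_{(n)}=0$ for $n$ sufficiently negative, $\dim V_{(n)}<\infty$, and $[L(0),Y(v,z)]=z\frac{d}{dz}Y(v,z)+Y(L(0)v,z)$, where $L(0)v=nv$ for $v\in V_{(n)}$ (then $\mathrm{wt}(v)=n$). **CFT type** means $V=\mathbb{C}|0\rangle\oplus\bigoplus_{n\ge1}V_{(n)}$. A vertex operator algebra is a grading-restricted vertex algebra with $L(0),\,L(\pm1)$ the modes of its Virasoro field. **Möbius vertex algebra** (in the sense of Kac): there is an operator $L(1)$ such that $L(-1),L(0),L(1)$ satisfy $[L(m),L(n)]=(m-n)L(m+n)$ for $m,n\in\{-1,0,1\}$, annihilate $|0\rangle$, and satisfy $[L(-1),Y(a,z)]=\partial_zY(a,z)$, $[L(0),Y(a,z)]=z\partial_zY(a,z)+Y(L(0)a,z)$, $[L(1),Y(a,z)]=z^2\partial_zY(a,z)+2zY(L(0)a,z)+Y(L(1)a,z)$. **Unitary.** A (vertex operator or Möbius vertex) algebra $V$ is unitary if it carries an anti-linear involutive automorphism $\theta$ and a positive definite Hermitian form $(\cdot,\cdot)$ with $(Y(e^{zL(1)}(-z^{-2})^{L(0)}a,z^{-1})u,v)=(u,Y(\theta(a),z)v)$ for all $a,u,v\in V$. Connecting maps are compatible with the unitary structure if $\theta_N\circ f_{MN}=f_{MN}\circ\theta_M$ and $(u,v)_M=(f_{MN}(u),f_{MN}(v))_N$ for all $M\le N$, $u,v\in V^M$. **Factorization.** A vertex algebra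 $V$ factorizes if there is a set $A\subset V$ that generates $V$ and a function $D$ such that $[a_n,b_m]=D(a,b,n,m)\mathbf 1_V$ for all $a,b\in A$, $n,m\in\mathbb{Z}$. **Grading-restricted direct system.** Grading-restricted vertex algebras $V^N$ with injective linear maps $f_{MN}:V^M\to V^N$ ($M\le N$; not required to be vertex algebra homomorphisms) such that: (1) $f_{NK}\circ f_{MN}=f_{MK}$; (2) $f_{NN}=\mathrm{id}$; (3) the $f_{MN}$ preserve the grading and the vacuum; (4) for each $n$, $\dim V^M_{(n)}=\dim V^N_{(n)}$ for all sufficiently large $M,N$; (5) there is $\bar n$ with $V^N_{(n)}=0$ for $n<\bar n$ for sufficiently large $N$. **VA-limit.** $V^\infty=\varinjlim V^N$ is the graded vector space direct limit with canonical maps $f_N:V^N\to V^\infty$; for $u=f_N(u^N)$ call $u^N$ the representative of $u$. Let $\Phi=\bigcup_n\Phi_n$ be a homogeneous basis of $V^\infty$. For $a,b,c\in\Phi$ and $N$ large, $C^N_{abc}$ is the coefficient of $a^N$ in $b^N_{\mathrm{wt}(b)+\mathrm{wt}(c)-\mathrm{wt}(a)-1}c^N$, with respect to the basis of $V^N_{(\mathrm{wt}(a))}$ consisting of the representatives of $\Phi_{\mathrm{wt}(a)}$. If $C^\infty_{abc}=\lim_{N\to\infty}C^N_{abc}$ exists for all $a,b,c\in\Phi$, the VA-limit is $(V^\infty,|0\rangle,Y_\infty)$ with $|0\rangle=f_N(|0\rangle)$ and $Y_\infty(b,z)c=\sum_{a\in\Phi}z^{\mathrm{wt}(a)-\mathrm{wt}(b)-\mathrm{wt}(c)}C^\infty_{abc}a$.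 *)

theory Defs
  imports Complex_Main "HOL-Library.Groups_Big_Fun"
begin

section \<open>Complex vector spaces\<close>

class scaleC =
  fixes scaleC :: "complex \<Rightarrow> 'a \<Rightarrow> 'a" (infixr \<open>*\<^sub>C\<close> 75)

class complex_vector = scaleC + ab_group_add +
  assumes scaleC_add_right: "a *\<^sub>C (x + y) = a *\<^sub>C x + a *\<^sub>C y"
    and scaleC_add_left: "(a + b) *\<^sub>C x = a *\<^sub>C x + b *\<^sub>C x"
    and scaleC_scaleC: "a *\<^sub>C b *\<^sub>C x = (a * b) *\<^sub>C x"
    and scaleC_one: "1 *\<^sub>C x = x"

global_interpretation complex_vector: vector_space "scaleC :: complex \<Rightarrow> 'a \<Rightarrow> 'a :: complex_vector"
  defines cdependent = complex_vector.dependent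
    and crepresentation = complex_vector.representation
    and csubspace = complex_vector.subspace
    and cspan = complex_vector.span
    and cextend_basis = complex_vector.extend_basis
    and cdim = complex_vector.dim
  by unfold_locales (rule scaleC_add_right scaleC_add_left scaleC_scaleC scaleC_one)+

definition clinear_on :: "'a::complex_vector set \<Rightarrow> ('a \<Rightarrow> 'b::complex_vector) \<Rightarrow> bool" where
  "clinear_on S f \<longleftrightarrow>
     (\<forall>x\<in>S. \<forall>y\<in>S. f (x + y) = f x + f y) \<and> (\<forall>c. \<forall>x\<in>S. f (c *\<^sub>C x) = c *\<^sub>C f x)"

definition antilinear_on :: "'a::complex_vector set \<Rightarrow> ('a \<Rightarrow> 'b::complex_vector) \<Rightarrow> bool" where
  "antilinear_on S f \<longleftrightarrow>
     (\<forall>x\<in>S. \<forall>y\<in>S. f (x + y) = f x + f y) \<and> (\<forall>c. \<forall>x\<in>S. f (c *\<^sub>C x) = cnj c *\<^sub>C f x)"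


section \<open>Vertex algebras\<close>

text \<open>The underlying vector space is a subspace \<open>carr\<close> of an ambient complex vector space, so that
  a sequence of different spaces can be treated inside one type; \<open>mode V a n b\<close> stands for
  \<open>a\<^sub>n b\<close>, and \<open>grade V n\<close> for the homogeneous subspace of weight \<open>n\<close>. Values of \<open>mode\<close> outside
  \<open>carr\<close> are irrelevant.\<close>

record 'a graded_va =
  carr :: "'a set"
  vac :: 'a
  mode :: "'a \<Rightarrow> int \<Rightarrow> 'a \<Rightarrow> 'a"
  grade :: "int \<Rightarrow> 'a set"

text \<open>By the truncation property of a vertex algebra the sums over \<open>j\<close> in Borcherds' identity have
  only finitely many non-zero terms; \<open>Sum_any\<close> is the sum over the finite support.\<close>

definition borcherds_identity ::
    "'a::complex_vector graded_va \<Rightarrow> 'a \<Rightarrow> 'a \<Rightarrow> 'a \<Rightarrow> int \<Rightarrow> int \<Rightarrow> int \<Rightarrow> bool" where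
  "borcherds_identity V a b c k m n \<longleftrightarrow>
     Sum_any (\<lambda>j::nat. (of_int m gchoose j) *\<^sub>C
        mode V (mode V a (n + int j) b) (m + k - int j) c)
   = Sum_any (\<lambda>j::nat. ((-1) ^ j * (of_int n gchoose j)) *\<^sub>C
        mode V a (m + n - int j) (mode V b (k + int j) c))
   - Sum_any (\<lambda>j::nat. ((-1) powi (int j + n) * (of_int n gchoose j)) *\<^sub>C
        mode V b (n + k - int j) (mode V a (m + int j) c))"

definition vertex_algebra :: "'a::complex_vector graded_va \<Rightarrow> bool" where
  "vertex_algebra V \<longleftrightarrow>
     csubspace (carr V) \<and>
     vac V \<in> carr V \<and> vac V \<noteq> 0 \<and>
     (\<forall>a\<in>carr V. \<forall>n. \<forall>b\<in>carr V. mode V a n b \<in> carr V) \<and>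
     (\<forall>a\<in>carr V. \<forall>n. clinear_on (carr V) (mode V a n)) \<and>
     (\<forall>n. \<forall>b\<in>carr V. clinear_on (carr V) (\<lambda>a. mode V a n b)) \<and>
     (\<forall>a\<in>carr V. \<forall>b\<in>carr V. \<exists>K. \<forall>n\<ge>K. mode V a n b = 0) \<and>
     (\<forall>a\<in>carr V. mode V a (-1) (vac V) = a \<and> (\<forall>n\<ge>0. mode V a n (vac V) = 0)) \<and>
     (\<forall>b\<in>carr V. \<forall>n. mode V (vac V) n b = (if n = -1 then b else 0)) \<and>
     (\<forall>a\<in>carr V. \<forall>b\<in>carr V. \<forall>c\<in>carr V. \<forall>k m n. borcherds_identity V a b c k m n)"

definition homogeneous_decomposition ::
    "'a::complex_vector graded_va \<Rightarrow> 'a \<Rightarrow> (int \<Rightarrow> 'a) \<Rightarrow> bool" where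
  "homogeneous_decomposition V v x \<longleftrightarrow>
     (\<forall>n. x n \<in> grade V n) \<and> finite {n. x n \<noteq> 0} \<and> Sum_any x = v"

definition component :: "'a::complex_vector graded_va \<Rightarrow> 'a \<Rightarrow> int \<Rightarrow> 'a" where
  "component V v = (THE x. homogeneous_decomposition V v x)"

definition L0 :: "'a::complex_vector graded_va \<Rightarrow> 'a \<Rightarrow> 'a" where
  "L0 V v = Sum_any (\<lambda>n. of_int n *\<^sub>C component V v n)"

definition translation :: "'a graded_va \<Rightarrow> 'a \<Rightarrow> 'a" where
  "translation V a = mode V a (-2) (vac V)"

text \<open>The last condition is the coefficient of \<open>z\<^bsup>-n-1\<^esup>\<close> in
  \<open>[L(0), Y(v,z)] u = z d/dz Y(v,z) u + Y(L(0)v, z) u\<close>.\<close>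

definition grading_restricted :: "'a::complex_vector graded_va \<Rightarrow> bool" where
  "grading_restricted V \<longleftrightarrow>
     vertex_algebra V \<and>
     (\<forall>n. csubspace (grade V n) \<and> grade V n \<subseteq> carr V) \<and>
     (\<forall>v\<in>carr V. \<exists>!x. homogeneous_decomposition V v x) \<and>
     (\<exists>n0. \<forall>n<n0. grade V n = {0}) \<and>
     (\<forall>n. \<exists>B. finite B \<and> cspan B = grade V n) \<and>
     (\<forall>v\<in>carr V. \<forall>u\<in>carr V. \<forall>n.
        L0 V (mode V v n u) - mode V v n (L0 V u)
          = of_int (- n - 1) *\<^sub>C mode V v n u + mode V (L0 V v) n u)"

text \<open>In a graded vertex algebra the vacuum has weight zero, so
  \<open>V = \<complex>|0\<rangle> \<oplus> \<Oplus>\<^sub>n\<^sub>\<ge>\<^sub>1 V\<^sub>n\<close> says the following about the given grading.\<close>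

definition cft_type :: "'a::complex_vector graded_va \<Rightarrow> bool" where
  "cft_type V \<longleftrightarrow> grade V 0 = cspan {vac V} \<and> (\<forall>n<0. grade V n = {0})"

text \<open>\<open>\<omega>\<close> is the conformal vector; its modes \<open>L(n) = \<omega>\<^sub>n\<^sub>+\<^sub>1\<close> are those of the Virasoro field.\<close>

definition vertex_operator_algebra :: "'a::complex_vector graded_va \<Rightarrow> 'a \<Rightarrow> bool" where
  "vertex_operator_algebra V \<omega> \<longleftrightarrow>
     grading_restricted V \<and> \<omega> \<in> carr V \<and>
     (\<exists>c::complex. \<forall>m n. \<forall>v\<in>carr V.
        mode V \<omega> (m + 1) (mode V \<omega> (n + 1) v) - mode V \<omega> (n + 1) (mode V \<omega> (m + 1) v)
          = of_int (m - n) *\<^sub>C mode V \<omega> (m + n + 1) v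
            + (if m + n = 0 then (of_int (m ^ 3 - m) / 12 * c) *\<^sub>C v else 0)) \<and>
     (\<forall>v\<in>carr V. mode V \<omega> 1 v = L0 V v) \<and>
     (\<forall>v\<in>carr V. mode V \<omega> 0 v = translation V v)"

text \<open>The three commutators with \<open>mode V a n\<close> are the coefficients of \<open>z\<^bsup>-n-1\<^esup>\<close> in
  \<open>[L(-1), Y(a,z)] = \<partial>\<^sub>z Y(a,z)\<close>,
  \<open>[L(0), Y(a,z)] = z \<partial>\<^sub>z Y(a,z) + Y(L(0)a, z)\<close> and
  \<open>[L(1), Y(a,z)] = z\<^sup>2 \<partial>\<^sub>z Y(a,z) + 2 z Y(L(0)a, z) + Y(L(1)a, z)\<close>.\<close>

definition moebius :: "'a::complex_vector graded_va \<Rightarrow> ('a \<Rightarrow> 'a) \<Rightarrow> bool" where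
  "moebius V L1 \<longleftrightarrow>
     L1 ` carr V \<subseteq> carr V \<and> clinear_on (carr V) L1 \<and>
     (\<forall>v\<in>carr V. L1 (translation V v) - translation V (L1 v) = 2 *\<^sub>C L0 V v) \<and>
     (\<forall>v\<in>carr V. L1 (L0 V v) - L0 V (L1 v) = L1 v) \<and>
     (\<forall>v\<in>carr V. L0 V (translation V v) - translation V (L0 V v) = translation V v) \<and>
     translation V (vac V) = 0 \<and> L0 V (vac V) = 0 \<and> L1 (vac V) = 0 \<and>
     (\<forall>a\<in>carr V. \<forall>v\<in>carr V. \<forall>n.
        translation V (mode V a n v) - mode V a n (translation V v)
          = of_int (- n) *\<^sub>C mode V a (n - 1) v \<and>
        L0 V (mode V a n v) - mode V a n (L0 V v)
          = of_int (- n - 1) *\<^sub>C mode V a n v + mode V (L0 V a) n v \<and>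
        L1 (mode V a n v) - mode V a n (L1 v)
          = of_int (- n - 2) *\<^sub>C mode V a (n + 1) v + 2 *\<^sub>C mode V (L0 V a) (n + 1) v
            + mode V (L1 a) n v)"


section \<open>Unitarity\<close>

definition antilinear_involutive_automorphism ::
    "'a::complex_vector graded_va \<Rightarrow> ('a \<Rightarrow> 'a) \<Rightarrow> ('a \<Rightarrow> 'a) \<Rightarrow> bool" where
  "antilinear_involutive_automorphism V L1 \<theta> \<longleftrightarrow>
     \<theta> ` carr V \<subseteq> carr V \<and> antilinear_on (carr V) \<theta> \<and>
     (\<forall>v\<in>carr V. \<theta> (\<theta> v) = v) \<and>
     \<theta> (vac V) = vac V \<and>
     (\<forall>a\<in>carr V. \<forall>n. \<forall>b\<in>carr V. \<theta> (mode V a n b) = mode V (\<theta> a) n (\<theta> b)) \<and>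
     (\<forall>n. \<theta> ` grade V n \<subseteq> grade V n) \<and>
     (\<forall>v\<in>carr V. \<theta> (L1 v) = L1 (\<theta> v))"

text \<open>Linear in the first argument; the opposite convention gives the same notion of unitarity.\<close>

definition positive_definite_hermitian ::
    "'a::complex_vector set \<Rightarrow> ('a \<Rightarrow> 'a \<Rightarrow> complex) \<Rightarrow> bool" where
  "positive_definite_hermitian S ip \<longleftrightarrow>
     (\<forall>u\<in>S. \<forall>v\<in>S. \<forall>w\<in>S. ip (u + v) w = ip u w + ip v w) \<and>
     (\<forall>c. \<forall>u\<in>S. \<forall>v\<in>S. ip (c *\<^sub>C u) v = c * ip u v) \<and>
     (\<forall>u\<in>S. \<forall>v\<in>S. ip v u = cnj (ip u v)) \<and>
     (\<forall>u\<in>S. u \<noteq> 0 \<longrightarrow> Im (ip u u) = 0 \<and> Re (ip u u) > 0)"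

text \<open>Coefficient of \<open>z\<^bsup>-m-1\<^esup>\<close> in
  \<open>(Y(e\<^bsup>zL(1)\<^esup> (-z\<^bsup>-2\<^esup>)\<^bsup>L(0)\<^esup> a, z\<^bsup>-1\<^esup>) u, v) = (u, Y(\<theta>(a), z) v)\<close>, where
  \<open>(-z\<^bsup>-2\<^esup>)\<^bsup>L(0)\<^esup> a\<close> is the sum over the weights \<open>h\<close> of \<open>(-1)\<^sup>h z\<^bsup>-2h\<^esup> a\<^sub>h\<close>, with \<open>a\<^sub>h\<close> the component
  of \<open>a\<close> of weight \<open>h\<close>, and \<open>e\<^bsup>zL(1)\<^esup>\<close> is the sum over \<open>j\<close> of \<open>z\<^sup>j L(1)\<^sup>j / j!\<close>; the mode \<open>x\<^sub>n\<close> of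
  \<open>x = L(1)\<^sup>j a\<^sub>h\<close> then comes with \<open>z\<^bsup>j - 2h + n + 1\<^esup>\<close>. Only finitely many terms are non-zero because
  \<open>L(1)\<close> lowers weights.\<close>

definition invariant_form ::
    "'a::complex_vector graded_va \<Rightarrow> ('a \<Rightarrow> 'a) \<Rightarrow> ('a \<Rightarrow> 'a) \<Rightarrow> ('a \<Rightarrow> 'a \<Rightarrow> complex) \<Rightarrow> bool" where
  "invariant_form V L1 \<theta> ip \<longleftrightarrow>
     (\<forall>a\<in>carr V. \<forall>u\<in>carr V. \<forall>v\<in>carr V. \<forall>m.
        ip (Sum_any (\<lambda>(h::int, j::nat). ((-1) powi h / fact j) *\<^sub>C
              mode V ((L1 ^^ j) (component V a h)) (2 * h - int j - m - 2) u)) v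
          = ip u (mode V (\<theta> a) m v))"

definition unitary_structure ::
    "'a::complex_vector graded_va \<Rightarrow> ('a \<Rightarrow> 'a) \<Rightarrow> ('a \<Rightarrow> 'a) \<Rightarrow> ('a \<Rightarrow> 'a \<Rightarrow> complex) \<Rightarrow> bool" where
  "unitary_structure V L1 \<theta> ip \<longleftrightarrow>
     antilinear_involutive_automorphism V L1 \<theta> \<and>
     positive_definite_hermitian (carr V) ip \<and>
     invariant_form V L1 \<theta> ip"

text \<open>An automorphism of a vertex operator algebra fixes the conformal vector, and \<open>L(1) = \<omega>\<^sub>2\<close>.\<close>

definition unitary_voa ::
    "'a::complex_vector graded_va \<Rightarrow> 'a \<Rightarrow> ('a \<Rightarrow> 'a) \<Rightarrow> ('a \<Rightarrow> 'a \<Rightarrow> complex) \<Rightarrow> bool" where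
  "unitary_voa V \<omega> \<theta> ip \<longleftrightarrow>
     vertex_operator_algebra V \<omega> \<and> \<theta> \<omega> = \<omega> \<and> unitary_structure V (mode V \<omega> 2) \<theta> ip"

definition unitary_moebius :: "'a::complex_vector graded_va \<Rightarrow> bool" where
  "unitary_moebius V \<longleftrightarrow> (\<exists>L1. moebius V L1 \<and> (\<exists>\<theta> ip. unitary_structure V L1 \<theta> ip))"


section \<open>Factorization and isomorphism\<close>

definition vertex_subalgebra :: "'a::complex_vector graded_va \<Rightarrow> 'a set \<Rightarrow> bool" where
  "vertex_subalgebra V W \<longleftrightarrow>
     csubspace W \<and> W \<subseteq> carr V \<and> vac V \<in> W \<and> (\<forall>a\<in>W. \<forall>n. \<forall>b\<in>W. mode V a n b \<in> W)"

definition generates :: "'a::complex_vector graded_va \<Rightarrow> 'a set \<Rightarrow> bool" where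
  "generates V A \<longleftrightarrow> A \<subseteq> carr V \<and> (\<forall>W. vertex_subalgebra V W \<and> A \<subseteq> W \<longrightarrow> W = carr V)"

definition factorizes :: "'a::complex_vector graded_va \<Rightarrow> bool" where
  "factorizes V \<longleftrightarrow>
     (\<exists>A D. generates V A \<and>
        (\<forall>a\<in>A. \<forall>b\<in>A. \<forall>n m. \<forall>v\<in>carr V.
           mode V a n (mode V b m v) - mode V b m (mode V a n v) = D a b n m *\<^sub>C v))"

definition isomorphic ::
    "'a::complex_vector graded_va \<Rightarrow> 'b::complex_vector graded_va \<Rightarrow> bool" where
  "isomorphic V W \<longleftrightarrow>
     (\<exists>\<phi>. bij_betw \<phi> (carr V) (carr W) \<and> clinear_on (carr V) \<phi> \<and>
        \<phi> (vac V) = vac W \<and>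
        (\<forall>a\<in>carr V. \<forall>n. \<forall>b\<in>carr V. \<phi> (mode V a n b) = mode W (\<phi> a) n (\<phi> b)) \<and>
        (\<forall>n. \<phi> ` grade V n = grade W n))"


section \<open>Direct systems\<close>

definition grading_restricted_direct_system ::
    "(nat \<Rightarrow> 'a::complex_vector graded_va) \<Rightarrow> (nat \<Rightarrow> nat \<Rightarrow> 'a \<Rightarrow> 'a) \<Rightarrow> bool" where
  "grading_restricted_direct_system V f \<longleftrightarrow>
     (\<forall>N. grading_restricted (V N)) \<and>
     (\<forall>M N. M \<le> N \<longrightarrow> f M N ` carr (V M) \<subseteq> carr (V N) \<and>
        clinear_on (carr (V M)) (f M N) \<and> inj_on (f M N) (carr (V M))) \<and>
     (\<forall>M N K. M \<le> N \<longrightarrow> N \<le> K \<longrightarrow> (\<forall>u\<in>carr (V M). f N K (f M N u) = f M K u)) \<and>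
     (\<forall>N. \<forall>u\<in>carr (V N). f N N u = u) \<and>
     (\<forall>M N. M \<le> N \<longrightarrow> (\<forall>n. f M N ` grade (V M) n \<subseteq> grade (V N) n) \<and>
        f M N (vac (V M)) = vac (V N)) \<and>
     (\<forall>n. \<exists>K. \<forall>M\<ge>K. \<forall>N\<ge>K. cdim (grade (V M) n) = cdim (grade (V N) n)) \<and>
     (\<exists>n0 K. \<forall>N\<ge>K. \<forall>n<n0. grade (V N) n = {0})"

definition compatible_with_unitary_structure ::
    "(nat \<Rightarrow> 'a::complex_vector graded_va) \<Rightarrow> (nat \<Rightarrow> 'a \<Rightarrow> 'a) \<Rightarrow>
     (nat \<Rightarrow> 'a \<Rightarrow> 'a \<Rightarrow> complex) \<Rightarrow> (nat \<Rightarrow> nat \<Rightarrow> 'a \<Rightarrow> 'a) \<Rightarrow> bool" where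
  "compatible_with_unitary_structure V \<theta> ip f \<longleftrightarrow>
     (\<forall>M N. M \<le> N \<longrightarrow>
        (\<forall>u\<in>carr (V M). \<theta> N (f M N u) = f M N (\<theta> M u)) \<and>
        (\<forall>u\<in>carr (V M). \<forall>v\<in>carr (V M). ip M u v = ip N (f M N u) (f M N v)))"


section \<open>The direct limit\<close>

text \<open>Sequences modulo eventual equality. The direct limit of a sequence of spaces is the space of
  those germs that are eventually of the form \<open>N \<mapsto> f M N u\<close>; the universal property of this
  model is proved below.\<close>

quotient_type 'a germ = "nat \<Rightarrow> 'a" / "\<lambda>x y. eventually (\<lambda>N. x N = y N) sequentially"
  by (rule equivpI; simp add: reflp_def symp_def transp_def eq_commute)
     (auto elim: eventually_elim2)

instantiation germ :: (complex_vector) complex_vector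
begin

lift_definition zero_germ :: "'a germ" is "\<lambda>_. 0" .

lift_definition plus_germ :: "'a germ \<Rightarrow> 'a germ \<Rightarrow> 'a germ" is "\<lambda>x y N. x N + y N"
  by (auto elim: eventually_elim2)

lift_definition uminus_germ :: "'a germ \<Rightarrow> 'a germ" is "\<lambda>x N. - x N"
  by (auto elim: eventually_mono)

lift_definition minus_germ :: "'a germ \<Rightarrow> 'a germ \<Rightarrow> 'a germ" is "\<lambda>x y N. x N - y N"
  by (auto elim: eventually_elim2)

lift_definition scaleC_germ :: "complex \<Rightarrow> 'a germ \<Rightarrow> 'a germ" is "\<lambda>c x N. c *\<^sub>C x N"
  by (auto elim: eventually_mono)

instance
  by standard (transfer; simp add: algebra_simps scaleC_add_right scaleC_add_left scaleC_scaleC scaleC_one)+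

end

definition dl_map :: "(nat \<Rightarrow> nat \<Rightarrow> 'a::complex_vector \<Rightarrow> 'a) \<Rightarrow> nat \<Rightarrow> 'a \<Rightarrow> 'a germ" where
  "dl_map f M u = abs_germ (\<lambda>N. if M \<le> N then f M N u else 0)"

definition dl_carr ::
    "(nat \<Rightarrow> 'a::complex_vector graded_va) \<Rightarrow> (nat \<Rightarrow> nat \<Rightarrow> 'a \<Rightarrow> 'a) \<Rightarrow> 'a germ set" where
  "dl_carr V f = (\<Union>N. dl_map f N ` carr (V N))"

definition dl_grade ::
    "(nat \<Rightarrow> 'a::complex_vector graded_va) \<Rightarrow> (nat \<Rightarrow> nat \<Rightarrow> 'a \<Rightarrow> 'a) \<Rightarrow> int \<Rightarrow> 'a germ set" where
  "dl_grade V f n = (\<Union>N. dl_map f N ` grade (V N) n)"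

lemma dl_map_connecting:
  assumes "grading_restricted_direct_system V f" "M \<le> N" "u \<in> carr (V M)"
  shows "dl_map f N (f M N u) = dl_map f M u"
  unfolding dl_map_def germ.abs_eq_iff
  using assms
  by (auto simp: grading_restricted_direct_system_def eventually_sequentially intro!: exI[of _ N])

lemma dl_map_linear:
  assumes "grading_restricted_direct_system V f"
  shows "clinear_on (carr (V M)) (dl_map f M)"
  using assms
  by (auto simp: clinear_on_def dl_map_def plus_germ.abs_eq scaleC_germ.abs_eq germ.abs_eq_iff
      grading_restricted_direct_system_def eventually_sequentially intro!: exI[of _ M])

lemma dl_map_inj:
  assumes "grading_restricted_direct_system V f"
  shows "inj_on (dl_map f M) (carr (V M))"
proof (rule inj_onI)
  fix u v assume uv: "u \<in> carr (V M)" "v \<in> carr (V M)" "dl_map f M u = dl_map f M v"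
  then obtain K where K: "\<forall>N\<ge>K. (if M \<le> N then f M N u else 0) = (if M \<le> N then f M N v else 0)"
    by (auto simp: dl_map_def germ.abs_eq_iff eventually_sequentially)
  have "f M (max K M) u = f M (max K M) v"
    using K[rule_format, of "max K M"] by simp
  moreover have "inj_on (f M (max K M)) (carr (V M))"
    using assms by (simp add: grading_restricted_direct_system_def)
  ultimately show "u = v"
    using uv by (meson inj_onD)
qed

lemma dl_universal:
  fixes g :: "nat \<Rightarrow> 'a::complex_vector \<Rightarrow> 'b::complex_vector"
  assumes sys: "grading_restricted_direct_system V f"
    and lin: "\<And>N. clinear_on (carr (V N)) (g N)"
    and comp: "\<And>M N u. M \<le> N \<Longrightarrow> u \<in> carr (V M) \<Longrightarrow> g N (f M N u) = g M u"
  shows "\<exists>h. clinear_on (dl_carr V f) h \<and> (\<forall>N. \<forall>u\<in>carr (V N). h (dl_map f N u) = g N u)"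
proof -
  have eq: "g M u = g N v"
    if uv: "u \<in> carr (V M)" "v \<in> carr (V N)" "dl_map f M u = dl_map f N v" for M N u v
  proof -
    let ?K = "max M N"
    have "f M ?K u \<in> carr (V ?K)" "f N ?K v \<in> carr (V ?K)"
      using sys uv by (auto simp: grading_restricted_direct_system_def image_subset_iff)
    moreover have "dl_map f ?K (f M ?K u) = dl_map f ?K (f N ?K v)"
      using dl_map_connecting[OF sys] uv by simp
    ultimately have "f M ?K u = f N ?K v"
      using dl_map_inj[OF sys] by (meson inj_onD)
    then show ?thesis
      using comp[of M ?K u] comp[of N ?K v] uv by simp
  qed
  define h where "h x = (SOME y. \<exists>N. \<exists>u\<in>carr (V N). x = dl_map f N u \<and> y = g N u)" for x
  have h: "h (dl_map f N u) = g N u" if "u \<in> carr (V N)" for N u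
  proof -
    have "\<exists>M. \<exists>v\<in>carr (V M). dl_map f N u = dl_map f M v \<and> h (dl_map f N u) = g M v"
      unfolding h_def by (rule someI_ex) (use that in blast)
    then show ?thesis
      using eq that by metis
  qed
  have pair: "\<exists>K. \<exists>u\<in>carr (V K). \<exists>v\<in>carr (V K). x = dl_map f K u \<and> y = dl_map f K v"
    if "x \<in> dl_carr V f" "y \<in> dl_carr V f" for x y
  proof -
    obtain M u N v where *: "u \<in> carr (V M)" "x = dl_map f M u" "v \<in> carr (V N)" "y = dl_map f N v"
      using \<open>x \<in> dl_carr V f\<close> \<open>y \<in> dl_carr V f\<close> by (auto simp: dl_carr_def)
    let ?K = "max M N"
    have "f M ?K u \<in> carr (V ?K)" "f N ?K v \<in> carr (V ?K)"
      using sys * by (auto simp: grading_restricted_direct_system_def image_subset_iff)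
    moreover have "x = dl_map f ?K (f M ?K u)" "y = dl_map f ?K (f N ?K v)"
      using dl_map_connecting[OF sys] * by simp_all
    ultimately show ?thesis by blast
  qed
  have sub: "csubspace (carr (V N))" for N
    using sys by (simp add: grading_restricted_direct_system_def grading_restricted_def vertex_algebra_def)
  have "h (x + y) = h x + h y \<and> h (c *\<^sub>C x) = c *\<^sub>C h x"
    if xy: "x \<in> dl_carr V f" "y \<in> dl_carr V f" for x y c
  proof -
    obtain K u v where *: "u \<in> carr (V K)" "v \<in> carr (V K)" "x = dl_map f K u" "y = dl_map f K v"
      using pair[OF xy] by blast
    have "x + y = dl_map f K (u + v)" "c *\<^sub>C x = dl_map f K (c *\<^sub>C u)"
      using dl_map_linear[OF sys, of K] * by (auto simp: clinear_on_def)
    moreover have "u + v \<in> carr (V K)" "c *\<^sub>C u \<in> carr (V K)"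
      using sub[of K] * by (auto intro: complex_vector.subspace_add complex_vector.subspace_scale)
    ultimately show ?thesis
      using h lin[of K] * by (simp add: clinear_on_def)
  qed
  then have "clinear_on (dl_carr V f) h"
    by (auto simp: clinear_on_def)
  with h show ?thesis by blast
qed

definition representative ::
    "(nat \<Rightarrow> 'a::complex_vector graded_va) \<Rightarrow> (nat \<Rightarrow> nat \<Rightarrow> 'a \<Rightarrow> 'a) \<Rightarrow> nat \<Rightarrow> 'a germ \<Rightarrow> 'a" where
  "representative V f N u = inv_into (carr (V N)) (dl_map f N) u"

definition wt ::
    "(nat \<Rightarrow> 'a::complex_vector graded_va) \<Rightarrow> (nat \<Rightarrow> nat \<Rightarrow> 'a \<Rightarrow> 'a) \<Rightarrow> 'a germ \<Rightarrow> int" where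
  "wt V f u = (THE n. u \<in> dl_grade V f n)"


section \<open>The VA-limit\<close>

definition homogeneous_basis ::
    "(nat \<Rightarrow> 'a::complex_vector graded_va) \<Rightarrow> (nat \<Rightarrow> nat \<Rightarrow> 'a \<Rightarrow> 'a) \<Rightarrow> 'a germ set \<Rightarrow> bool" where
  "homogeneous_basis V f \<Phi> \<longleftrightarrow>
     \<Phi> \<subseteq> (\<Union>n. dl_grade V f n) \<and> \<not> cdependent \<Phi> \<and> cspan \<Phi> = dl_carr V f"

text \<open>\<open>struct_const V f \<Phi> N a b c\<close> is meaningful once \<open>N\<close> is so large that \<open>b\<close>, \<open>c\<close> and all basis
  vectors of the weight of \<open>a\<close> have representatives in \<open>V N\<close> and the latter span the weight space;
  only these \<open>N\<close> matter for the limit.\<close>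

definition struct_const ::
    "(nat \<Rightarrow> 'a::complex_vector graded_va) \<Rightarrow> (nat \<Rightarrow> nat \<Rightarrow> 'a \<Rightarrow> 'a) \<Rightarrow> 'a germ set \<Rightarrow> nat \<Rightarrow>
     'a germ \<Rightarrow> 'a germ \<Rightarrow> 'a germ \<Rightarrow> complex" where
  "struct_const V f \<Phi> N a b c =
     crepresentation (representative V f N ` (\<Phi> \<inter> dl_grade V f (wt V f a)))
       (mode (V N) (representative V f N b) (wt V f b + wt V f c - wt V f a - 1) (representative V f N c))
       (representative V f N a)"

definition struct_const_converge ::
    "(nat \<Rightarrow> 'a::complex_vector graded_va) \<Rightarrow> (nat \<Rightarrow> nat \<Rightarrow> 'a \<Rightarrow> 'a) \<Rightarrow> 'a germ set \<Rightarrow> bool" where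
  "struct_const_converge V f \<Phi> \<longleftrightarrow>
     (\<forall>a\<in>\<Phi>. \<forall>b\<in>\<Phi>. \<forall>c\<in>\<Phi>. convergent (\<lambda>N. struct_const V f \<Phi> N a b c))"

definition limit_struct_const ::
    "(nat \<Rightarrow> 'a::complex_vector graded_va) \<Rightarrow> (nat \<Rightarrow> nat \<Rightarrow> 'a \<Rightarrow> 'a) \<Rightarrow> 'a germ set \<Rightarrow>
     'a germ \<Rightarrow> 'a germ \<Rightarrow> 'a germ \<Rightarrow> complex" where
  "limit_struct_const V f \<Phi> a b c = lim (\<lambda>N. struct_const V f \<Phi> N a b c)"

text \<open>The coefficient of \<open>z\<^bsup>-n-1\<^esup>\<close> in \<open>Y\<^sub>\<infinity>(b,z)c\<close> for \<open>b\<close>, \<open>c\<close> in the basis, and its bilinear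
  extension.\<close>

definition limit_basis_mode ::
    "(nat \<Rightarrow> 'a::complex_vector graded_va) \<Rightarrow> (nat \<Rightarrow> nat \<Rightarrow> 'a \<Rightarrow> 'a) \<Rightarrow> 'a germ set \<Rightarrow>
     'a germ \<Rightarrow> int \<Rightarrow> 'a germ \<Rightarrow> 'a germ" where
  "limit_basis_mode V f \<Phi> b n c =
     (\<Sum>a\<in>{a \<in> \<Phi>. wt V f a - wt V f b - wt V f c = - n - 1}. limit_struct_const V f \<Phi> a b c *\<^sub>C a)"

definition VA_limit ::
    "(nat \<Rightarrow> 'a::complex_vector graded_va) \<Rightarrow> (nat \<Rightarrow> nat \<Rightarrow> 'a \<Rightarrow> 'a) \<Rightarrow> 'a germ set \<Rightarrow>
     'a germ graded_va" where
  "VA_limit V f \<Phi> =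
     \<lparr> carr = dl_carr V f,
       vac = dl_map f 0 (vac (V 0)),
       mode = (\<lambda>x n y. \<Sum>b | crepresentation \<Phi> x b \<noteq> 0. \<Sum>c | crepresentation \<Phi> y c \<noteq> 0.
          (crepresentation \<Phi> x b * crepresentation \<Phi> y c) *\<^sub>C limit_basis_mode V f \<Phi> b n c),
       grade = dl_grade V f \<rparr>"

definition is_VA_limit ::
    "(nat \<Rightarrow> 'a::complex_vector graded_va) \<Rightarrow> (nat \<Rightarrow> nat \<Rightarrow> 'a \<Rightarrow> 'a) \<Rightarrow> 'a germ set \<Rightarrow>
     'a germ graded_va \<Rightarrow> bool" where
  "is_VA_limit V f \<Phi> W \<longleftrightarrow> struct_const_converge V f \<Phi> \<and> W = VA_limit V f \<Phi>"

end

theory Submission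
  imports Defs "HOL-Library.Diagonal_Subsequence" "HOL-Library.Countable_Set"
begin

text \<open>Everything happens in finite-dimensional weight spaces carrying a positive definite form. A
  sequence of vectors \<open>x N\<close> of \<open>V N\<close> is said to converge to a vector of the direct limit if it is a
  finite combination of fixed vectors of the limit, read in \<open>V N\<close>, with convergent coefficients
  (\<open>seq_limit\<close>). The connecting maps are isometric, so inner products of convergent sequences
  converge (\<open>tends_ip\<close>) and limits are unique (\<open>tends_unique\<close>); the convergence of the structure
  constants says that modes of convergent sequences converge (\<open>tends_mode\<close>). Hence an identity
  between finitely many such expressions that holds in all \<open>V N\<close> holds in the limit. The sums over
  all \<open>j\<close> in Borcherds' identity and in the invariance of the form are of this kind because weights
  are non-negative and the weights occurring in a fixed vector of the limit are bounded
  independently of \<open>N\<close> (\<open>mode_truncated\<close>, \<open>weights_bounded\<close>).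

  The conformal vectors of the \<open>V N\<close> need not converge, so \<open>L(1)\<close> has to be found differently. It is
  the adjoint of \<open>L(-1)\<close> (\<open>L1_adjoint\<close>), and \<open>L(-1)a = a\<^sub>-\<^sub>2|0\<rangle>\<close> does converge; expanding in
  orthonormal bases of the weight spaces of the limit shows that \<open>L(1)\<close> converges as well
  (\<open>L1_converges_homogeneous\<close>).

  For uniqueness, consider the unitary maps \<open>f'\<^sub>N \<circ> f\<^sub>N\<^sup>-\<^sup>1\<close> between corresponding weight spaces of
  the two direct limits. Their matrix coefficients with respect to orthonormal bases are bounded, so
  along a common subsequence all of them converge (\<open>pairings_converge_exists\<close>). The limit map sends
  the limit of a sequence with respect to the first system to its limit with respect to the second
  (\<open>transfer_map\<close>). Since the products in both limits are limits of the same products in \<open>V N\<close>, it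
  is a homomorphism, and exchanging the two systems gives its inverse.\<close>

section \<open>Linear algebra on subspaces\<close>

lemma clinear_on_add: "clinear_on S g \<Longrightarrow> x \<in> S \<Longrightarrow> y \<in> S \<Longrightarrow> g (x + y) = g x + g y"
  by (simp add: clinear_on_def)

lemma clinear_on_scale: "clinear_on S g \<Longrightarrow> x \<in> S \<Longrightarrow> g (c *\<^sub>C x) = c *\<^sub>C g x"
  by (simp add: clinear_on_def)

lemma clinear_on_zero:
  assumes "csubspace S" "clinear_on S g"
  shows "g 0 = 0"
  using clinear_on_scale[OF assms(2) complex_vector.subspace_0[OF assms(1)], of 0]
  by simp

lemma clinear_on_sum:
  assumes "csubspace S" "clinear_on S g" "\<And>i. i \<in> I \<Longrightarrow> x i \<in> S"
  shows "g (\<Sum>i\<in>I. x i) = (\<Sum>i\<in>I. g (x i))"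
  using assms(3)
proof (induction I rule: infinite_finite_induct)
  case (insert i I)
  have "(\<Sum>i\<in>I. x i) \<in> S" using insert.prems assms(1) by (intro complex_vector.subspace_sum) auto
  then show ?case using insert by (simp add: clinear_on_add[OF assms(2)])
qed (auto simp: clinear_on_zero[OF assms(1,2)])

lemma clinear_on_lincomb:
  assumes "csubspace S" "clinear_on S g" "\<And>i. i \<in> I \<Longrightarrow> x i \<in> S"
  shows "g (\<Sum>i\<in>I. c i *\<^sub>C x i) = (\<Sum>i\<in>I. c i *\<^sub>C g (x i))"
proof -
  have "g (\<Sum>i\<in>I. c i *\<^sub>C x i) = (\<Sum>i\<in>I. g (c i *\<^sub>C x i))"
    by (rule clinear_on_sum[OF assms(1,2)]) (simp add: assms(3) complex_vector.subspace_scale[OF assms(1)])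
  then show ?thesis by (simp add: clinear_on_scale[OF assms(2)] assms(3))
qed

lemma clinear_on_span_image:
  assumes "csubspace S" "clinear_on S g" "B \<subseteq> S"
  shows "g ` cspan B \<subseteq> cspan (g ` B)"
proof (rule image_subsetI)
  fix x assume "x \<in> cspan B"
  then obtain t c where t: "finite t" "t \<subseteq> B" "x = (\<Sum>a\<in>t. c a *\<^sub>C a)"
    by (auto simp: complex_vector.span_explicit)
  have "g x = (\<Sum>a\<in>t. c a *\<^sub>C g a)"
    using clinear_on_lincomb[OF assms(1,2), of t "\<lambda>a. a"] t assms(3) by auto
  moreover have "\<dots> \<in> cspan (g ` B)"
    using t(2) by (intro complex_vector.span_sum complex_vector.span_scale complex_vector.span_base) auto
  ultimately show "g x \<in> cspan (g ` B)" by simp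
qed

locale hermitian_form =
  fixes S :: "'a::complex_vector set" and ip :: "'a \<Rightarrow> 'a \<Rightarrow> complex"
  assumes subspace_S: "csubspace S" and pdh: "positive_definite_hermitian S ip"
begin

lemma ip_add_left: "u \<in> S \<Longrightarrow> v \<in> S \<Longrightarrow> w \<in> S \<Longrightarrow> ip (u + v) w = ip u w + ip v w"
  using pdh unfolding positive_definite_hermitian_def by blast

lemma ip_scale_left: "u \<in> S \<Longrightarrow> v \<in> S \<Longrightarrow> ip (c *\<^sub>C u) v = c * ip u v"
  using pdh unfolding positive_definite_hermitian_def by blast

lemma ip_cnj: "u \<in> S \<Longrightarrow> v \<in> S \<Longrightarrow> ip v u = cnj (ip u v)"
  using pdh unfolding positive_definite_hermitian_def by blast

lemma S_add: "u \<in> S \<Longrightarrow> v \<in> S \<Longrightarrow> u + v \<in> S"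
  using subspace_S by (rule complex_vector.subspace_add)

lemma S_diff: "u \<in> S \<Longrightarrow> v \<in> S \<Longrightarrow> u - v \<in> S"
  using subspace_S by (rule complex_vector.subspace_diff)

lemma S_scale: "u \<in> S \<Longrightarrow> c *\<^sub>C u \<in> S"
  using subspace_S by (rule complex_vector.subspace_scale)

lemma S_zero: "0 \<in> S"
  using subspace_S by (rule complex_vector.subspace_0)

lemma ip_add_right:
  assumes "u \<in> S" "v \<in> S" "w \<in> S"
  shows "ip w (u + v) = ip w u + ip w v"
proof -
  have "ip w (u + v) = cnj (ip (u + v) w)" using assms by (intro ip_cnj S_add)
  also have "\<dots> = cnj (ip u w) + cnj (ip v w)" using assms by (simp add: ip_add_left)
  also have "\<dots> = ip w u + ip w v"
    using ip_cnj[OF assms(1,3)] ip_cnj[OF assms(2,3)] by simp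
  finally show ?thesis .
qed

lemma ip_scale_right:
  assumes "u \<in> S" "v \<in> S"
  shows "ip u (c *\<^sub>C v) = cnj c * ip u v"
proof -
  have "ip u (c *\<^sub>C v) = cnj (ip (c *\<^sub>C v) u)" using assms by (intro ip_cnj S_scale)
  also have "\<dots> = cnj c * cnj (ip v u)" using assms by (simp add: ip_scale_left)
  also have "\<dots> = cnj c * ip u v" using ip_cnj[OF assms(2,1)] by simp
  finally show ?thesis .
qed

lemma ip_linear_left: "v \<in> S \<Longrightarrow> u \<in> S \<Longrightarrow> w \<in> S \<Longrightarrow> ip (u + c *\<^sub>C v) w = ip u w + c * ip v w"
  by (simp add: ip_add_left ip_scale_left S_scale)

lemma ip_linear_right:
  "v \<in> S \<Longrightarrow> u \<in> S \<Longrightarrow> w \<in> S \<Longrightarrow> ip w (u + c *\<^sub>C v) = ip w u + cnj c * ip w v"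
  by (simp add: ip_add_right ip_scale_right S_scale)

lemma ip_zero_left: "v \<in> S \<Longrightarrow> ip 0 v = 0"
  using ip_scale_left[OF S_zero, of v 0] by simp

lemma ip_lincomb_left:
  assumes "\<And>i. i \<in> I \<Longrightarrow> x i \<in> S" "v \<in> S"
  shows "ip (\<Sum>i\<in>I. c i *\<^sub>C x i) v = (\<Sum>i\<in>I. c i * ip (x i) v)"
  using assms(1)
proof (induction I rule: infinite_finite_induct)
  case (insert i I)
  have "(\<Sum>i\<in>I. c i *\<^sub>C x i) \<in> S"
    using insert.prems subspace_S by (intro complex_vector.subspace_sum) (auto intro: S_scale)
  then show ?case using insert assms(2) by (simp add: ip_add_left ip_scale_left S_scale)
qed (auto simp: ip_zero_left[OF assms(2)])

lemma ip_pos: "u \<in> S \<Longrightarrow> u \<noteq> 0 \<Longrightarrow> Im (ip u u) = 0 \<and> Re (ip u u) > 0"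
  using pdh unfolding positive_definite_hermitian_def by blast

lemma ip_eq_zero: "u \<in> S \<Longrightarrow> ip u u = 0 \<Longrightarrow> u = 0"
  using ip_pos[of u] by (cases "u = 0") simp_all

lemma ip_self_real: "u \<in> S \<Longrightarrow> ip u u = complex_of_real (Re (ip u u))"
  using ip_pos[of u] ip_zero_left[OF S_zero] by (cases "u = 0") (simp_all add: complex_eq_iff)

lemma ip_self_nonneg: "u \<in> S \<Longrightarrow> Re (ip u u) \<ge> 0"
  using ip_pos[of u] ip_zero_left[OF S_zero] by (cases "u = 0") simp_all

text \<open>Cauchy--Schwarz for unit vectors: expand the square of the norm of \<open>u - (u,v)v\<close>.\<close>

lemma norm_ip_le_one:
  assumes u: "u \<in> S" "ip u u = 1" and v: "v \<in> S" "ip v v = 1"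
  shows "cmod (ip u v) \<le> 1"
proof -
  define c where "c = ip u v"
  have c': "ip v u = cnj c" unfolding c_def by (rule ip_cnj[OF u(1) v(1)])
  let ?w = "u + (- c) *\<^sub>C v"
  have w: "?w \<in> S" using u v by (intro S_add S_scale)
  have "ip ?w ?w = ip u ?w + (- c) * ip v ?w" using v(1) u(1) w by (rule ip_linear_left)
  also have "ip u ?w = ip u u + cnj (- c) * ip u v" using v(1) u(1) u(1) by (rule ip_linear_right)
  also have "ip v ?w = ip v u + cnj (- c) * ip v v" using v(1) u(1) v(1) by (rule ip_linear_right)
  finally have "ip ?w ?w = 1 - c * cnj c" by (simp add: u v c' flip: c_def)
  then have "Re (ip ?w ?w) = 1 - (cmod c)\<^sup>2" by (simp add: complex_mult_cnj cmod_power2)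
  then have "(cmod c)\<^sup>2 \<le> 1\<^sup>2" using ip_self_nonneg[OF w] by simp
  then show ?thesis unfolding c_def by (rule power2_le_imp_le) simp
qed

definition orthonormal :: "'a set \<Rightarrow> bool" where
  "orthonormal E \<longleftrightarrow> finite E \<and> E \<subseteq> S \<and> (\<forall>e\<in>E. \<forall>e'\<in>E. ip e e' = (if e = e' then 1 else 0))"

lemma ip_orthonormal_coeff:
  assumes E: "orthonormal E" and "e \<in> E"
  shows "ip (\<Sum>e'\<in>E. c e' *\<^sub>C e') e = c e"
proof -
  have "ip (\<Sum>e'\<in>E. c e' *\<^sub>C e') e = (\<Sum>e'\<in>E. c e' * ip e' e)"
    using E \<open>e \<in> E\<close> by (intro ip_lincomb_left) (auto simp: orthonormal_def)
  also have "\<dots> = (\<Sum>e'\<in>E. if e' = e then c e' else 0)"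
    using E \<open>e \<in> E\<close> by (intro sum.cong) (auto simp: orthonormal_def)
  also have "\<dots> = c e" using E \<open>e \<in> E\<close> by (simp add: orthonormal_def)
  finally show ?thesis .
qed

lemma orthonormal_expansion:
  assumes E: "orthonormal E" and "x \<in> cspan E"
  shows "x = (\<Sum>e\<in>E. ip x e *\<^sub>C e)"
proof -
  have "finite E" using E by (simp add: orthonormal_def)
  then obtain c where "x = (\<Sum>e\<in>E. c e *\<^sub>C e)"
    using \<open>x \<in> cspan E\<close> by (auto simp: complex_vector.span_finite)
  then show ?thesis using ip_orthonormal_coeff[OF E, of _ c] by (metis (no_types, lifting) sum.cong)
qed

text \<open>Gram--Schmidt, adding the vectors of \<open>B\<close> one at a time.\<close>

lemma orthonormal_basis_exists:
  assumes "finite B" "B \<subseteq> S"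
  shows "\<exists>E. orthonormal E \<and> cspan E = cspan B"
  using assms
proof (induction B rule: finite_induct)
  case empty
  then show ?case by (intro exI[of _ "{}"]) (simp add: orthonormal_def)
next
  case (insert b B)
  then obtain E where E: "orthonormal E" "cspan E = cspan B" by auto
  have ES: "finite E" "E \<subseteq> S" and bS: "b \<in> S" using E insert.prems by (auto simp: orthonormal_def)
  (* the component of b orthogonal to E *)
  define r where "r = b - (\<Sum>e\<in>E. ip b e *\<^sub>C e)"
  have psp: "(\<Sum>e\<in>E. ip b e *\<^sub>C e) \<in> cspan E"
    by (intro complex_vector.span_sum complex_vector.span_scale complex_vector.span_base)
  have pS: "(\<Sum>e\<in>E. ip b e *\<^sub>C e) \<in> S"
    using ES subspace_S by (intro complex_vector.subspace_sum) (auto intro: S_scale)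
  have rS: "r \<in> S" unfolding r_def using bS pS by (rule S_diff)
  have orth: "ip r e = 0" if "e \<in> E" for e
  proof -
    have "ip b e = ip (r + (\<Sum>e\<in>E. ip b e *\<^sub>C e)) e" by (simp add: r_def)
    also have "\<dots> = ip r e + ip b e"
      using ip_add_left[OF rS pS, of e] ip_orthonormal_coeff[OF E(1) that, of "ip b"] that ES by auto
    finally show ?thesis by simp
  qed
  have span_b: "cspan (insert r E) = cspan (insert b B)"
  proof -
    have "cspan (insert r E) = cspan (insert b E)"
      using psp complex_vector.eq_span_insert_eq[of b r E] by (simp add: r_def)
    also have "\<dots> = cspan (insert b B)"
      using E(2) by (simp add: complex_vector.span_insert)
    finally show ?thesis .
  qed
  show ?case
  proof (cases "r = 0")
    case True
    then have "cspan E = cspan (insert b B)" using span_b by simp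
    then show ?thesis using E(1) by blast
  next
    case False
    define s where "s = complex_of_real (1 / sqrt (Re (ip r r)))"
    have pos: "Re (ip r r) > 0"
      using False rS ip_pos by simp
    have "s \<noteq> 0" using pos by (simp add: s_def)
    have unit: "ip (s *\<^sub>C r) (s *\<^sub>C r) = 1"
    proof -
      have "ip (s *\<^sub>C r) (s *\<^sub>C r) = s * (cnj s * complex_of_real (Re (ip r r)))"
        using rS by (simp add: ip_scale_left ip_scale_right S_scale flip: ip_self_real)
      also have "\<dots> = complex_of_real (1 / sqrt (Re (ip r r)) * (1 / sqrt (Re (ip r r)) * Re (ip r r)))"
        by (simp only: s_def complex_cnj_complex_of_real of_real_mult)
      also have "1 / sqrt (Re (ip r r)) * (1 / sqrt (Re (ip r r)) * Re (ip r r)) = 1"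
        using pos by (simp add: field_simps)
      finally show ?thesis by simp
    qed
    have orth': "ip (s *\<^sub>C r) e = 0 \<and> ip e (s *\<^sub>C r) = 0" if "e \<in> E" for e
    proof -
      have "e \<in> S" using that ES by auto
      then have "ip (s *\<^sub>C r) e = 0" using orth[OF that] rS by (simp add: ip_scale_left)
      then show ?thesis using ip_cnj[of "s *\<^sub>C r" e] \<open>e \<in> S\<close> rS S_scale by simp
    qed
    have "orthonormal (insert (s *\<^sub>C r) E)"
      using E(1) unit orth' rS unfolding orthonormal_def by (auto intro: S_scale)
    moreover have "cspan (insert (s *\<^sub>C r) E) = cspan (insert r E)"
    proof -
      have "s *\<^sub>C r \<in> cspan (insert r E)"
        by (intro complex_vector.span_scale complex_vector.span_base) simp
      moreover have "inverse s *\<^sub>C (s *\<^sub>C r) \<in> cspan (insert (s *\<^sub>C r) E)"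
        by (intro complex_vector.span_scale complex_vector.span_base) simp
      then have "r \<in> cspan (insert (s *\<^sub>C r) E)" using \<open>s \<noteq> 0\<close> by (simp add: scaleC_scaleC scaleC_one)
      ultimately show ?thesis
        by (intro complex_vector.span_eq[THEN iffD2]) (auto intro: complex_vector.span_base)
    qed
    ultimately show ?thesis using span_b by blast
  qed
qed

end

section \<open>Diagonal subsequences\<close>

text \<open>Each sequence has a monotone, hence convergent, subsequence; the diagonal argument treats all of
  them at once.\<close>

lemma diagonal_subsequence:
  fixes g :: "nat \<Rightarrow> nat \<Rightarrow> real"
  assumes "\<And>i. Bseq (g i)"
  shows "\<exists>r. strict_mono r \<and> (\<forall>i. convergent (\<lambda>k. g i (r k)))"
proof -
  define P where "P i s = convergent (\<lambda>k. g i (s k))" for i and s :: "nat \<Rightarrow> nat"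
  interpret subseqs P
  proof
    fix n and s :: "nat \<Rightarrow> nat" assume "strict_mono s"
    obtain r where r: "strict_mono r" "monoseq (\<lambda>k. g n (s (r k)))"
      using seq_monosub[of "\<lambda>k. g n (s k)"] by auto
    moreover have "Bseq (\<lambda>k. g n (s (r k)))"
      using Bseq_subseq[OF assms[of n], of "s \<circ> r"] by (simp add: o_def)
    ultimately have "convergent (\<lambda>k. g n (s (r k)))" by (rule_tac Bseq_monoseq_convergent)
    then show "\<exists>r'. strict_mono r' \<and> P n (s \<circ> r')" using r by (auto simp: P_def)
  qed
  have "P i diagseq" for i
  proof -
    have "P i (diagseq \<circ> ((+) (Suc i)))"
    proof (rule diagseq_holds)
      fix r s :: "nat \<Rightarrow> nat" and n assume "strict_mono r" "P n s"
      then show "P n (s \<circ> r)"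
        using convergent_subseq_convergent[of "\<lambda>k. g n (s k)" r] by (simp add: P_def o_def)
    qed
    then have "convergent (\<lambda>k. g i (diagseq (k + Suc i)))" by (simp add: P_def o_def add.commute)
    then show ?thesis unfolding P_def by (rule convergent_ignore_initial_segment[THEN iffD1])
  qed
  then show ?thesis using subseq_diagseq by (auto simp: P_def)
qed

section \<open>Graded spaces\<close>

text \<open>The conditions involve the carrier and the grading but not the modes, so that components and
  \<open>L(0)\<close> are available in the direct limit before its modes are known to obey any law.\<close>

locale graded_space =
  fixes V :: "'a::complex_vector graded_va"
  assumes subspace_carr: "csubspace (carr V)"
    and subspace_grade: "\<And>n. csubspace (grade V n)"
    and grade_subset: "\<And>n. grade V n \<subseteq> carr V"
    and unique_decomposition: "\<And>v. v \<in> carr V \<Longrightarrow> \<exists>!x. homogeneous_decomposition V v x"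
begin

lemma carr_add: "u \<in> carr V \<Longrightarrow> v \<in> carr V \<Longrightarrow> u + v \<in> carr V"
  using subspace_carr by (rule complex_vector.subspace_add)

lemma carr_scale: "u \<in> carr V \<Longrightarrow> c *\<^sub>C u \<in> carr V"
  using subspace_carr by (rule complex_vector.subspace_scale)

lemma carr_zero: "0 \<in> carr V"
  using subspace_carr by (rule complex_vector.subspace_0)

lemma carr_sum: "(\<And>i. i \<in> I \<Longrightarrow> x i \<in> carr V) \<Longrightarrow> sum x I \<in> carr V"
  using subspace_carr by (rule complex_vector.subspace_sum)

lemma grade_carr: "v \<in> grade V n \<Longrightarrow> v \<in> carr V"
  using grade_subset by blast

lemma component_decomposition: "v \<in> carr V \<Longrightarrow> homogeneous_decomposition V v (component V v)"
  unfolding component_def by (rule theI'[OF unique_decomposition])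

lemma component_eqI:
  assumes "v \<in> carr V" "homogeneous_decomposition V v x"
  shows "component V v = x"
  unfolding component_def
  by (rule the1_equality[of "homogeneous_decomposition V v", OF unique_decomposition[OF assms(1)] assms(2)])

lemma component_grade: "v \<in> carr V \<Longrightarrow> component V v n \<in> grade V n"
  and component_finite: "v \<in> carr V \<Longrightarrow> finite {n. component V v n \<noteq> 0}"
  and component_Sum_any: "v \<in> carr V \<Longrightarrow> Sum_any (component V v) = v"
  using component_decomposition unfolding homogeneous_decomposition_def by blast+

lemma component_carr: "v \<in> carr V \<Longrightarrow> component V v n \<in> carr V"
  by (blast intro: component_grade grade_carr)

lemma component_sum:
  "v \<in> carr V \<Longrightarrow> finite S \<Longrightarrow> {n. component V v n \<noteq> 0} \<subseteq> S \<Longrightarrow> (\<Sum>n\<in>S. component V v n) = v"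
  using component_Sum_any[of v] Sum_any.expand_superset[of S "component V v"] by simp

lemma component_homogeneous:
  assumes "v \<in> grade V n"
  shows "component V v = (\<lambda>m. if m = n then v else 0)"
proof (rule component_eqI)
  show "v \<in> carr V" using assms by (rule grade_carr)
  have "{m. (if m = n then v else 0) \<noteq> 0} \<subseteq> {n}" by auto
  then have "finite {m. (if m = n then v else 0) \<noteq> 0}"
    and "Sum_any (\<lambda>m. if m = n then v else 0) = (\<Sum>m\<in>{n}. if m = n then v else 0)"
    by (auto intro: finite_subset Sum_any.expand_superset)
  then show "homogeneous_decomposition V v (\<lambda>m. if m = n then v else 0)"
    using assms by (auto simp: homogeneous_decomposition_def complex_vector.subspace_0[OF subspace_grade])
qed

lemma component_lincomb:
  assumes u: "u \<in> carr V" and v: "v \<in> carr V"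
  shows "component V (u + c *\<^sub>C v) = (\<lambda>n. component V u n + c *\<^sub>C component V v n)"
proof (rule component_eqI)
  show "u + c *\<^sub>C v \<in> carr V" using u v by (intro carr_add carr_scale)
  let ?S = "{n. component V u n \<noteq> 0} \<union> {n. component V v n \<noteq> 0}"
  let ?x = "\<lambda>n. component V u n + c *\<^sub>C component V v n"
  have S: "finite ?S" using component_finite[OF u] component_finite[OF v] by simp
  have sub: "{n. ?x n \<noteq> 0} \<subseteq> ?S" by auto
  have "Sum_any ?x = (\<Sum>n\<in>?S. ?x n)" using S sub by (rule Sum_any.expand_superset)
  also have "\<dots> = u + c *\<^sub>C v"
    using component_sum[OF u S] component_sum[OF v S]
    by (simp add: sum.distrib complex_vector.scale_sum_right[symmetric])
  finally show "homogeneous_decomposition V (u + c *\<^sub>C v) ?x"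
    using finite_subset[OF sub S] component_grade[OF u] component_grade[OF v] subspace_grade
    by (auto simp: homogeneous_decomposition_def
        intro!: complex_vector.subspace_add complex_vector.subspace_scale)
qed

lemma component_linear: "clinear_on (carr V) (\<lambda>v. component V v n)"
  unfolding clinear_on_def
proof (intro conjI ballI allI)
  fix x y assume "x \<in> carr V" "y \<in> carr V"
  then show "component V (x + y) n = component V x n + component V y n"
    using component_lincomb[of x y 1] by (simp add: scaleC_one)
next
  fix c x assume x: "x \<in> carr V"
  have "component V (0::'a) n = 0"
    using component_homogeneous[OF complex_vector.subspace_0[OF subspace_grade]] by simp
  then show "component V (c *\<^sub>C x) n = c *\<^sub>C component V x n"
    using component_lincomb[OF carr_zero x, of c] by simp
qed

lemma L0_eq_sum:
  assumes "finite S" "{n. component V v n \<noteq> 0} \<subseteq> S"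
  shows "L0 V v = (\<Sum>n\<in>S. of_int n *\<^sub>C component V v n)"
  unfolding L0_def using assms by (intro Sum_any.expand_superset) auto

lemma L0_decomposition:
  assumes v: "v \<in> carr V"
  shows "homogeneous_decomposition V (L0 V v) (\<lambda>n. of_int n *\<^sub>C component V v n)"
proof -
  have "{n. of_int n *\<^sub>C component V v n \<noteq> 0} \<subseteq> {n. component V v n \<noteq> 0}" by auto
  then have "finite {n. of_int n *\<^sub>C component V v n \<noteq> 0}"
    using component_finite[OF v] by (rule finite_subset)
  then show ?thesis
    using component_grade[OF v] unfolding homogeneous_decomposition_def L0_def
    by (auto intro: complex_vector.subspace_scale[OF subspace_grade])
qed

lemma L0_carr: "v \<in> carr V \<Longrightarrow> L0 V v \<in> carr V"
  using component_finite[of v]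
  by (subst L0_eq_sum[of "{n. component V v n \<noteq> 0}"]) (auto intro!: carr_sum carr_scale component_carr)

lemma L0_homogeneous: "v \<in> grade V n \<Longrightarrow> L0 V v = of_int n *\<^sub>C v"
  by (subst L0_eq_sum[of "{n}"]) (auto simp: component_homogeneous)

lemma L0_linear: "clinear_on (carr V) (L0 V)"
proof -
  have *: "L0 V (u + c *\<^sub>C v) = L0 V u + c *\<^sub>C L0 V v" if u: "u \<in> carr V" and v: "v \<in> carr V" for u v c
  proof -
    let ?S = "{n. component V u n \<noteq> 0} \<union> {n. component V v n \<noteq> 0}"
    have S: "finite ?S" using component_finite[OF u] component_finite[OF v] by simp
    have sub: "{n. component V (u + c *\<^sub>C v) n \<noteq> 0} \<subseteq> ?S" by (auto simp: component_lincomb[OF u v])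
    show ?thesis
      using L0_eq_sum[OF S sub] L0_eq_sum[OF S, of u] L0_eq_sum[OF S, of v]
      by (simp add: component_lincomb[OF u v] scaleC_add_right sum.distrib complex_vector.scale_sum_right
          scaleC_scaleC mult.commute)
  qed
  have L00: "L0 V 0 = 0"
    using L0_homogeneous[OF complex_vector.subspace_0[OF subspace_grade]] by simp
  show ?thesis
    unfolding clinear_on_def using *[of _ _ 1] *[OF carr_zero] by (simp add: L00 scaleC_one)
qed

text \<open>Both \<open>L(0)v\<close> and \<open>kv\<close> have an explicit homogeneous decomposition in terms of the components of
  \<open>v\<close>; by uniqueness these agree, which kills all components of weight other than \<open>k\<close>.\<close>

lemma L0_eigenvector:
  assumes v: "v \<in> carr V" and eq: "L0 V v = of_int k *\<^sub>C v"
  shows "v \<in> grade V k"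
proof -
  have "component V (of_int k *\<^sub>C v) n = of_int n *\<^sub>C component V v n" for n
    using component_eqI[OF L0_carr[OF v] L0_decomposition[OF v]] eq by simp
  then have "of_int k *\<^sub>C component V v n = of_int n *\<^sub>C component V v n" for n
    using clinear_on_scale[OF component_linear v] by metis
  then have "component V v n = 0" if "n \<noteq> k" for n
    using that by (metis complex_vector.scale_cancel_right of_int_eq_iff)
  then have "(\<Sum>n\<in>{k}. component V v n) = v" by (intro component_sum[OF v]) auto
  then show ?thesis using component_grade[OF v, of k] by simp
qed

lemma homogeneous_decomposition_map:
  assumes g: "clinear_on (carr V) g" "\<And>n. g ` grade V n \<subseteq> grade V' n"
    and x: "homogeneous_decomposition V u x"
  shows "homogeneous_decomposition V' (g u) (\<lambda>n. g (x n))"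
proof -
  let ?S = "{n. x n \<noteq> 0}"
  have xg: "\<And>n. x n \<in> grade V n" and S: "finite ?S" and u: "Sum_any x = u"
    using x by (auto simp: homogeneous_decomposition_def)
  have sub: "{n. g (x n) \<noteq> 0} \<subseteq> ?S"
    using clinear_on_zero[OF subspace_carr g(1)] by auto
  have "u = (\<Sum>n\<in>?S. x n)" using u Sum_any.expand_superset[OF S, of x] by simp
  then have "g u = g (\<Sum>n\<in>?S. x n)" by (rule arg_cong)
  also have "\<dots> = (\<Sum>n\<in>?S. g (x n))"
    by (rule clinear_on_sum[OF subspace_carr g(1)]) (rule grade_carr[OF xg])
  also have "\<dots> = Sum_any (\<lambda>n. g (x n))" using Sum_any.expand_superset[OF S sub] by simp
  finally show ?thesis
    using xg g(2) finite_subset[OF sub S] unfolding homogeneous_decomposition_def by auto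
qed

end

text \<open>The image of the homogeneous decomposition of \<open>u\<close> is a homogeneous decomposition of \<open>g u\<close>. The
  maps \<open>g\<close> of interest are the canonical maps into the direct limit.\<close>

lemma
  assumes "graded_space V" "graded_space V'"
    and g: "clinear_on (carr V) g" "g ` carr V \<subseteq> carr V'" "\<And>n. g ` grade V n \<subseteq> grade V' n"
    and u: "u \<in> carr V"
  shows component_map: "component V' (g u) n = g (component V u n)"
    and L0_map: "L0 V' (g u) = g (L0 V u)"
proof -
  interpret A: graded_space V by fact
  interpret B: graded_space V' by fact
  have comp: "component V' (g u) n = g (component V u n)" for n
    using B.component_eqI[OF _ A.homogeneous_decomposition_map[OF g(1,3) A.component_decomposition[OF u]]]
      g(2) u by (simp add: image_subset_iff)
  then show "component V' (g u) n = g (component V u n)" .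
  let ?S = "{n. component V u n \<noteq> 0}"
  have S: "finite ?S" using A.component_finite[OF u] .
  have sub: "{n. component V' (g u) n \<noteq> 0} \<subseteq> ?S"
    using clinear_on_zero[OF A.subspace_carr g(1)] by (auto simp: comp)
  show "L0 V' (g u) = g (L0 V u)"
    using B.L0_eq_sum[OF S sub] A.L0_eq_sum[OF S, of u]
      clinear_on_lincomb[OF A.subspace_carr g(1), of ?S "component V u" of_int] A.component_carr[OF u]
    by (simp add: comp)
qed

section \<open>Vertex algebras\<close>

lemma Sum_any_truncated: "(\<And>j::nat. j \<ge> J \<Longrightarrow> g j = 0) \<Longrightarrow> Sum_any g = (\<Sum>j<J. g j)"
  by (rule Sum_any.expand_superset) (auto simp: not_le[symmetric])

locale graded_vertex_algebra =
  fixes V :: "'a::complex_vector graded_va"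
  assumes gr: "grading_restricted V"
begin

sublocale graded_space V
  using gr by unfold_locales (auto simp: grading_restricted_def vertex_algebra_def)

lemma va: "vertex_algebra V"
  using gr by (simp add: grading_restricted_def)

lemma vac_carr: "vac V \<in> carr V" and vac_nonzero: "vac V \<noteq> 0"
  using va by (auto simp: vertex_algebra_def)

lemma grade_finite_dim: "\<exists>B. finite B \<and> cspan B = grade V n"
  using gr by (simp add: grading_restricted_def)

lemma mode_carr: "a \<in> carr V \<Longrightarrow> b \<in> carr V \<Longrightarrow> mode V a n b \<in> carr V"
  using va unfolding vertex_algebra_def by blast

lemma mode_linear_right: "a \<in> carr V \<Longrightarrow> clinear_on (carr V) (mode V a n)"
  using va unfolding vertex_algebra_def by blast

lemma mode_linear_left: "b \<in> carr V \<Longrightarrow> clinear_on (carr V) (\<lambda>a. mode V a n b)"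
  using va unfolding vertex_algebra_def by blast

lemma mode_vac_right: "a \<in> carr V \<Longrightarrow> mode V a (-1) (vac V) = a"
  "a \<in> carr V \<Longrightarrow> n \<ge> 0 \<Longrightarrow> mode V a n (vac V) = 0"
  using va unfolding vertex_algebra_def by blast+

lemma mode_vac_left: "b \<in> carr V \<Longrightarrow> mode V (vac V) n b = (if n = -1 then b else 0)"
  using va unfolding vertex_algebra_def by blast

lemma borcherds:
  "a \<in> carr V \<Longrightarrow> b \<in> carr V \<Longrightarrow> c \<in> carr V \<Longrightarrow> borcherds_identity V a b c k m n"
  using va unfolding vertex_algebra_def by blast

lemma mode_zero_right: "a \<in> carr V \<Longrightarrow> mode V a n 0 = 0"
  using clinear_on_zero[OF subspace_carr mode_linear_right] .

lemma mode_zero_left: "b \<in> carr V \<Longrightarrow> mode V 0 n b = 0"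
  using clinear_on_zero[OF subspace_carr mode_linear_left] .

lemma L0_commutator:
  "v \<in> carr V \<Longrightarrow> u \<in> carr V \<Longrightarrow>
     L0 V (mode V v n u) - mode V v n (L0 V u)
       = of_int (- n - 1) *\<^sub>C mode V v n u + mode V (L0 V v) n u"
  using gr unfolding grading_restricted_def by blast

text \<open>The commutator of \<open>L(0)\<close> with \<open>a\<^sub>n\<close>, applied to eigenvectors.\<close>

lemma mode_grade:
  assumes a: "a \<in> grade V p" and b: "b \<in> grade V q"
  shows "mode V a n b \<in> grade V (p + q - n - 1)"
proof (rule L0_eigenvector)
  have ab: "a \<in> carr V" "b \<in> carr V" using a b grade_carr by auto
  show "mode V a n b \<in> carr V" using ab by (rule mode_carr)
  have "L0 V (mode V a n b) = mode V a n (of_int q *\<^sub>C b) + of_int (- n - 1) *\<^sub>C mode V a n b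
      + mode V (of_int p *\<^sub>C a) n b"
    using L0_commutator[OF ab, of n] by (simp add: L0_homogeneous[OF a] L0_homogeneous[OF b] algebra_simps)
  also have "\<dots> = (of_int q + of_int (- n - 1) + of_int p) *\<^sub>C mode V a n b"
    by (simp add: clinear_on_scale[OF mode_linear_right] clinear_on_scale[OF mode_linear_left] ab
        scaleC_add_left)
  finally show "L0 V (mode V a n b) = of_int (p + q - n - 1) *\<^sub>C mode V a n b"
    by (simp add: algebra_simps)
qed

text \<open>Borcherds' identity with its parameter \<open>n\<close> equal to zero.\<close>

lemma commutator_formula:
  assumes a: "a \<in> carr V" and b: "b \<in> carr V" and c: "c \<in> carr V"
  shows "mode V a (int m) (mode V b k c) - mode V b k (mode V a (int m) c)
    = (\<Sum>j\<le>m. of_nat (m choose j) *\<^sub>C mode V (mode V a (int j) b) (int m + k - int j) c)"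
proof -
  have 0: "((0::complex) gchoose j) = (if j = 0 then 1 else 0)" for j
    by (cases j) simp_all
  have "Sum_any (\<lambda>j::nat. (of_int (int m) gchoose j) *\<^sub>C mode V (mode V a (0 + int j) b) (int m + k - int j) c)
      = (\<Sum>j\<le>m. (of_int (int m) gchoose j) *\<^sub>C mode V (mode V a (0 + int j) b) (int m + k - int j) c)"
    by (rule Sum_any.expand_superset) (auto simp flip: binomial_gbinomial)
  moreover have "Sum_any (\<lambda>j::nat. ((-1) ^ j * (of_int 0 gchoose j)) *\<^sub>C
        mode V a (int m + 0 - int j) (mode V b (k + int j) c)) = mode V a (int m) (mode V b k c)"
    by (subst Sum_any.expand_superset[of "{0}"]) (auto simp: 0 scaleC_one)
  moreover have "Sum_any (\<lambda>j::nat. ((-1) powi (int j + 0) * (of_int 0 gchoose j)) *\<^sub>C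
        mode V b (0 + k - int j) (mode V a (int m + int j) c)) = mode V b k (mode V a (int m) c)"
    by (subst Sum_any.expand_superset[of "{0}"]) (auto simp: 0 scaleC_one)
  ultimately show ?thesis
    using borcherds[OF a b c, of k "int m" 0] unfolding borcherds_identity_def
    by (simp add: binomial_gbinomial)
qed

text \<open>Borcherds' identity for \<open>a\<close> and \<open>|0\<rangle>\<close> with parameters \<open>0\<close> and \<open>-2\<close>. The modes of \<open>|0\<rangle>\<close> leave at
  most one non-zero term on the right: in the first sum if \<open>n < 0\<close>, in the second if \<open>n > 0\<close>.\<close>

lemma mode_translation:
  assumes a: "a \<in> carr V" and b: "b \<in> carr V"
  shows "mode V (translation V a) n b = of_int (- n) *\<^sub>C mode V a (n - 1) b"
proof -
  have 0: "((0::complex) gchoose j) = (if j = 0 then 1 else 0)" for j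
    by (cases j) simp_all
  have 2: "(-1) ^ j * ((-2::complex) gchoose j) = of_nat (j + 1)" for j
  proof -
    have "(-2::complex) gchoose j = (-1) ^ j * ((of_nat (Suc j)) gchoose j)"
      using gbinomial_minus[of "2::complex" j] by (simp add: algebra_simps)
    also have "(of_nat (Suc j) :: complex) gchoose j = of_nat (j + 1)"
      by (subst binomial_gbinomial[symmetric]) simp
    finally show ?thesis by (simp flip: power_add)
  qed
  have 3: "(-1) powi (int j + - 2) * ((-2::complex) gchoose j) = of_nat (j + 1)" for j
    using 2[of j] by (simp add: power_int_diff)
  let ?F = "\<lambda>j. ((-1) ^ j * (of_int (-2) gchoose j)) *\<^sub>C
      mode V a (0 + -2 - int j) (mode V (vac V) (n + int j) b)"
  let ?G = "\<lambda>j. ((-1) powi (int j + -2) * (of_int (-2) gchoose j)) *\<^sub>C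
      mode V (vac V) (-2 + n - int j) (mode V a (0 + int j) b)"
  have F: "?F j = (if n = - 1 - int j then of_nat (j + 1) *\<^sub>C mode V a (n - 1) b else 0)" for j
    using 2[of j] a b by (auto simp: mode_vac_left mode_zero_right)
  have G: "?G j = (if n = 1 + int j then of_nat (j + 1) *\<^sub>C mode V a (n - 1) b else 0)" for j
    using 3[of j] a b mode_carr[OF a b] by (auto simp: mode_vac_left)
  have "Sum_any (\<lambda>j. (of_int 0 gchoose j) *\<^sub>C
        mode V (mode V a (-2 + int j) (vac V)) (0 + n - int j) b) = mode V (translation V a) n b"
    by (subst Sum_any.expand_superset[of "{0}"]) (auto simp: 0 scaleC_one translation_def)
  then have "mode V (translation V a) n b = Sum_any ?F - Sum_any ?G"
    using borcherds[OF a vac_carr b, of n 0 "-2"] unfolding borcherds_identity_def by simp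
  also have "\<dots> = of_int (- n) *\<^sub>C mode V a (n - 1) b"
  proof -
    consider "n < 0" | "n = 0" | "n > 0" by linarith
    then show ?thesis
    proof cases
      case 1
      have "Sum_any ?F = (\<Sum>j\<in>{nat (- 1 - n)}. ?F j)"
        by (rule Sum_any.expand_superset) (use F in \<open>auto split: if_splits\<close>)
      moreover have "Sum_any ?G = (\<Sum>j\<in>{}. ?G j)"
        by (rule Sum_any.expand_superset) (use G 1 in \<open>auto split: if_splits\<close>)
      ultimately show ?thesis using 1 by (simp only: F G sum.insert) (simp)
    next
      case 2
      have "Sum_any ?F = (\<Sum>j\<in>{}. ?F j)" "Sum_any ?G = (\<Sum>j\<in>{}. ?G j)"
        by (rule Sum_any.expand_superset; use F G 2 in \<open>auto split: if_splits\<close>)+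
      then show ?thesis using 2 by simp
    next
      case 3
      have "Sum_any ?F = (\<Sum>j\<in>{}. ?F j)"
        by (rule Sum_any.expand_superset) (use F 3 in \<open>auto split: if_splits\<close>)
      moreover have "Sum_any ?G = (\<Sum>j\<in>{nat (n - 1)}. ?G j)"
        by (rule Sum_any.expand_superset) (use G in \<open>auto split: if_splits\<close>)
      ultimately show ?thesis using 3 by (simp only: F G sum.insert) (simp)
    qed
  qed
  finally show ?thesis .
qed

end

section \<open>Unitary vertex operator algebras of CFT type\<close>

locale unitary_cft_voa =
  fixes V :: "'a::complex_vector graded_va" and \<omega> :: 'a
    and \<theta> :: "'a \<Rightarrow> 'a" and ip :: "'a \<Rightarrow> 'a \<Rightarrow> complex"
  assumes uvoa: "unitary_voa V \<omega> \<theta> ip" and cft: "cft_type V"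
begin

lemma voa: "vertex_operator_algebra V \<omega>"
  using uvoa by (simp add: unitary_voa_def)

sublocale graded_vertex_algebra V
  using voa by unfold_locales (simp add: vertex_operator_algebra_def)

sublocale hermitian_form "carr V" ip
  using uvoa subspace_carr by unfold_locales (simp_all add: unitary_voa_def unitary_structure_def)

lemma automorphism: "antilinear_involutive_automorphism V (mode V \<omega> 2) \<theta>"
  and invariant: "invariant_form V (mode V \<omega> 2) \<theta> ip"
  and theta_omega: "\<theta> \<omega> = \<omega>"
  using uvoa by (simp_all add: unitary_voa_def unitary_structure_def)

lemma omega_carr: "\<omega> \<in> carr V"
  using voa by (simp add: vertex_operator_algebra_def)

lemma omega_1: "v \<in> carr V \<Longrightarrow> mode V \<omega> 1 v = L0 V v"
  and omega_0: "v \<in> carr V \<Longrightarrow> mode V \<omega> 0 v = translation V v"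
  using voa by (simp_all add: vertex_operator_algebra_def)

lemma virasoro:
  obtains c where "\<And>m n v. v \<in> carr V \<Longrightarrow>
        mode V \<omega> (m + 1) (mode V \<omega> (n + 1) v) - mode V \<omega> (n + 1) (mode V \<omega> (m + 1) v)
          = of_int (m - n) *\<^sub>C mode V \<omega> (m + n + 1) v
            + (if m + n = 0 then (of_int (m ^ 3 - m) / 12 * c) *\<^sub>C v else 0)"
  using voa unfolding vertex_operator_algebra_def by blast

lemma grade_negative: "n < 0 \<Longrightarrow> grade V n = {0}"
  and grade_zero: "grade V 0 = cspan {vac V}"
  using cft by (simp_all add: cft_type_def)

text \<open>\<open>L(0)\<omega> = [L(0), L(-2)]|0\<rangle> = 2 L(-2)|0\<rangle> = 2\<omega>\<close>.\<close>

lemma omega_grade: "\<omega> \<in> grade V 2"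
proof (rule L0_eigenvector[OF omega_carr])
  obtain c where c: "\<And>m n v. v \<in> carr V \<Longrightarrow>
        mode V \<omega> (m + 1) (mode V \<omega> (n + 1) v) - mode V \<omega> (n + 1) (mode V \<omega> (m + 1) v)
          = of_int (m - n) *\<^sub>C mode V \<omega> (m + n + 1) v
            + (if m + n = 0 then (of_int (m ^ 3 - m) / 12 * c) *\<^sub>C v else 0)"
    using virasoro by blast
  show "L0 V \<omega> = of_int 2 *\<^sub>C \<omega>"
    using c[OF vac_carr, of 0 "-2"] omega_carr
    by (simp add: mode_vac_right mode_zero_right flip: omega_1)
qed

text \<open>\<open>L(1)\<omega> = [L(1), L(-2)]|0\<rangle> = 3 L(-1)|0\<rangle> = 0\<close>.\<close>

lemma L1_omega: "mode V \<omega> 2 \<omega> = 0"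
proof -
  obtain c where c: "\<And>m n v. v \<in> carr V \<Longrightarrow>
        mode V \<omega> (m + 1) (mode V \<omega> (n + 1) v) - mode V \<omega> (n + 1) (mode V \<omega> (m + 1) v)
          = of_int (m - n) *\<^sub>C mode V \<omega> (m + n + 1) v
            + (if m + n = 0 then (of_int (m ^ 3 - m) / 12 * c) *\<^sub>C v else 0)"
    using virasoro by blast
  show ?thesis
    using c[OF vac_carr, of 1 "-2"] omega_carr by (simp add: mode_vac_right mode_zero_right)
qed

lemma L1_grade: "v \<in> grade V n \<Longrightarrow> mode V \<omega> 2 v \<in> grade V (n - 1)"
  using mode_grade[OF omega_grade, of v n 2] by simp

lemma L1_power_grade: "v \<in> grade V n \<Longrightarrow> (mode V \<omega> 2 ^^ j) v \<in> grade V (n - int j)"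
proof (induction j)
  case (Suc j)
  then show ?case using L1_grade[of "(mode V \<omega> 2 ^^ j) v" "n - int j"] by (simp add: algebra_simps)
qed simp

text \<open>Invariance of the form for \<open>\<omega>\<close>: since \<open>\<omega>\<close> has weight two and is annihilated by \<open>L(1)\<close>, only
  the term with \<open>h = 2\<close> and \<open>j = 0\<close> is left on the left-hand side; on the right, \<open>\<theta>\<close> fixes \<open>\<omega>\<close>.\<close>

lemma L1_adjoint:
  assumes u: "u \<in> carr V" and v: "v \<in> carr V"
  shows "ip (mode V \<omega> 2 u) v = ip u (translation V v)"
proof -
  have z: "(mode V \<omega> 2 ^^ j) (component V \<omega> h) = (if h = 2 \<and> j = 0 then \<omega> else 0)" for h j
  proof (cases "h = 2")
    case True
    then show ?thesis
      by (induction j) (auto simp: component_homogeneous[OF omega_grade] L1_omega mode_zero_right omega_carr)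
  next
    case False
    then show ?thesis
      by (induction j) (auto simp: component_homogeneous[OF omega_grade] mode_zero_right omega_carr)
  qed
  let ?t = "\<lambda>(h::int, j::nat). ((-1) powi h / fact j) *\<^sub>C
              mode V ((mode V \<omega> 2 ^^ j) (component V \<omega> h)) (2 * h - int j - 0 - 2) u"
  have "Sum_any ?t = (\<Sum>p\<in>{(2, 0)}. ?t p)"
    by (rule Sum_any.expand_superset) (auto simp: z mode_zero_left[OF u] split: if_splits)
  also have "\<dots> = mode V \<omega> 2 u" by (simp add: z scaleC_one component_homogeneous[OF omega_grade])
  finally have t: "Sum_any ?t = mode V \<omega> 2 u" .
  have "ip (Sum_any ?t) v = ip u (mode V (\<theta> \<omega>) 0 v)"
    using invariant omega_carr u v unfolding invariant_form_def by blast
  then have "ip (mode V \<omega> 2 u) v = ip u (mode V (\<theta> \<omega>) 0 v)" by (simp only: t)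
  then show ?thesis by (simp add: theta_omega omega_0 v)
qed

text \<open>The commutator of \<open>L(1) = \<omega>\<^sub>2\<close> with a mode is the commutator formula together with
  \<open>\<omega>\<^sub>0 a = L(-1)a\<close> and \<open>\<omega>\<^sub>1 a = L(0)a\<close>. The relations among \<open>L(-1)\<close>, \<open>L(0)\<close>, \<open>L(1)\<close> are
  Virasoro relations whose central term vanishes.\<close>

lemma moebius: "moebius V (mode V \<omega> 2)"
proof -
  obtain c where c: "\<And>m n v. v \<in> carr V \<Longrightarrow>
        mode V \<omega> (m + 1) (mode V \<omega> (n + 1) v) - mode V \<omega> (n + 1) (mode V \<omega> (m + 1) v)
          = of_int (m - n) *\<^sub>C mode V \<omega> (m + n + 1) v
            + (if m + n = 0 then (of_int (m ^ 3 - m) / 12 * c) *\<^sub>C v else 0)"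
    using virasoro by blast
  note car = mode_carr[OF omega_carr]
  have "translation V (mode V a n v) - mode V a n (translation V v) = of_int (- n) *\<^sub>C mode V a (n - 1) v"
    if "a \<in> carr V" "v \<in> carr V" for a n v
    using commutator_formula[OF omega_carr that, of 0 n] mode_translation[OF that, of n] that
    by (simp add: omega_0 mode_carr scaleC_one)
  moreover have "mode V \<omega> 2 (mode V a n v) - mode V a n (mode V \<omega> 2 v)
      = of_int (- n - 2) *\<^sub>C mode V a (n + 1) v + 2 *\<^sub>C mode V (L0 V a) (n + 1) v
        + mode V (mode V \<omega> 2 a) n v"
    if "a \<in> carr V" "v \<in> carr V" for a n v
  proof -
    have "(\<Sum>j\<le>2. of_nat (2 choose j) *\<^sub>C mode V (mode V \<omega> (int j) a) (int 2 + n - int j) v)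
        = mode V (mode V \<omega> 0 a) (n + 2) v + 2 *\<^sub>C mode V (mode V \<omega> 1 a) (n + 1) v
          + mode V (mode V \<omega> 2 a) n v"
      by (simp add: numeral_2_eq_2 scaleC_one) (simp add: add.commute)
    moreover have "mode V (mode V \<omega> 0 a) (n + 2) v = of_int (- n - 2) *\<^sub>C mode V a (n + 1) v"
      using mode_translation[OF that, of "n + 2"] that(1) by (simp add: omega_0 add.commute)
    ultimately show ?thesis
      using commutator_formula[OF omega_carr that, of 2 n] that(1) by (simp add: omega_1)
  qed
  moreover have "mode V \<omega> 2 (translation V v) - translation V (mode V \<omega> 2 v) = 2 *\<^sub>C L0 V v"
    "mode V \<omega> 2 (L0 V v) - L0 V (mode V \<omega> 2 v) = mode V \<omega> 2 v"
    "L0 V (translation V v) - translation V (L0 V v) = translation V v" if "v \<in> carr V" for v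
    using c[OF that, of 1 "-1"] c[OF that, of 1 0] c[OF that, of 0 "-1"] that car[OF that, of 0]
      car[OF that, of 1] car[OF that, of 2]
    by (simp_all add: omega_0 omega_1 scaleC_one)
  moreover have "translation V (vac V) = 0" "L0 V (vac V) = 0" "mode V \<omega> 2 (vac V) = 0"
    using mode_vac_right(2)[OF omega_carr] omega_0[OF vac_carr] omega_1[OF vac_carr] by simp_all
  ultimately show ?thesis
    unfolding moebius_def
    using L0_commutator car mode_linear_right[OF omega_carr] by (simp add: image_subset_iff)
qed

lemma component_negative: "v \<in> carr V \<Longrightarrow> n < 0 \<Longrightarrow> component V v n = 0"
  using component_grade[of v n] grade_negative by simp

text \<open>The product would have negative weight. The bound depends only on the weights of the factors, and
  therefore serves all algebras of a direct system at once.\<close>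

lemma mode_eq_zero:
  assumes a: "a \<in> carr V" "\<And>n. n > p \<Longrightarrow> component V a n = 0"
    and b: "b \<in> carr V" "\<And>n. n > q \<Longrightarrow> component V b n = 0"
    and n: "n \<ge> p + q"
  shows "mode V a n b = 0"
proof -
  have hom: "mode V x n y = 0" if x: "x \<in> grade V r" and y: "y \<in> grade V s" and "r \<le> p" "s \<le> q" for x y r s
    using mode_grade[OF x y, of n] grade_negative[of "r + s - n - 1"] that n by simp
  let ?A = "{n. component V a n \<noteq> 0}" and ?B = "{n. component V b n \<noteq> 0}"
  have A: "(\<Sum>r\<in>?A. component V a r) = a" using component_sum[OF a(1) component_finite[OF a(1)]] by simp
  have B: "(\<Sum>s\<in>?B. component V b s) = b" using component_sum[OF b(1) component_finite[OF b(1)]] by simp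
  have "mode V (component V a r) n b = 0" if r: "r \<in> ?A" for r
  proof -
    have rp: "r \<le> p" using a(2)[of r] r by fastforce
    have "mode V (component V a r) n (\<Sum>s\<in>?B. component V b s)
        = (\<Sum>s\<in>?B. mode V (component V a r) n (component V b s))"
      by (rule clinear_on_sum[OF subspace_carr mode_linear_right])
        (auto intro: component_carr a b)
    also have "\<dots> = 0"
    proof (intro sum.neutral ballI)
      fix s assume "s \<in> ?B"
      then have "s \<le> q" using b(2)[of s] by fastforce
      then show "mode V (component V a r) n (component V b s) = 0"
        using hom[OF component_grade[OF a(1)] component_grade[OF b(1)] rp] by blast
    qed
    finally show ?thesis by (simp only: B)
  qed
  then have "(\<Sum>r\<in>?A. mode V (component V a r) n b) = 0" by (intro sum.neutral) blast
  moreover have "mode V (\<Sum>r\<in>?A. component V a r) n b = (\<Sum>r\<in>?A. mode V (component V a r) n b)"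
    by (rule clinear_on_sum[OF subspace_carr mode_linear_left]) (auto intro: component_carr a b)
  ultimately show ?thesis by (simp only: A)
qed

lemma L1_linear: "clinear_on (carr V) (mode V \<omega> 2)"
  by (rule mode_linear_right[OF omega_carr])

lemma L1_power_zero: "(mode V \<omega> 2 ^^ j) 0 = 0"
  by (induction j) (simp_all add: mode_zero_right omega_carr)

end

section \<open>Germs\<close>

text \<open>\<open>rep_germ\<close> chooses a sequence representing a germ. Since only its tail is determined, the
  operations of the limit can be read off from it only for large indices.\<close>

lemma eventually_rep_abs_germ: "eventually (\<lambda>N. rep_germ (abs_germ x) N = x N) sequentially"
proof -
  have "abs_germ (rep_germ (abs_germ x)) = abs_germ x"
    by (rule Quotient3_abs_rep[OF Quotient3_germ])
  then show ?thesis by (simp add: germ.abs_eq_iff)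
qed

lemma eventually_rep_lincomb:
  "eventually (\<lambda>N. rep_germ (a + c *\<^sub>C b) N = rep_germ a N + c *\<^sub>C rep_germ b N) sequentially"
proof -
  have "abs_germ (\<lambda>N. rep_germ a N + c *\<^sub>C rep_germ b N)
      = abs_germ (rep_germ a) + c *\<^sub>C abs_germ (rep_germ b)"
    by (simp add: plus_germ.abs_eq scaleC_germ.abs_eq)
  then have "a + c *\<^sub>C b = abs_germ (\<lambda>N. rep_germ a N + c *\<^sub>C rep_germ b N)"
    by (simp add: Quotient3_abs_rep[OF Quotient3_germ])
  then show ?thesis using eventually_rep_abs_germ by metis
qed

lemma eventually_rep_add:
  "eventually (\<lambda>N. rep_germ (a + b) N = rep_germ a N + rep_germ b N) sequentially"
  using eventually_rep_lincomb[of a 1 b] by (simp add: scaleC_one)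

lemma eventually_rep_zero: "eventually (\<lambda>N. rep_germ 0 N = 0) sequentially"
  using eventually_rep_abs_germ[of "\<lambda>_. 0"] by (simp add: zero_germ_def)

lemma eventually_rep_scale:
  "eventually (\<lambda>N. rep_germ (c *\<^sub>C b) N = c *\<^sub>C rep_germ b N) sequentially"
  using eventually_rep_zero eventually_rep_lincomb[of 0 c b] by eventually_elim simp

lemma eventually_rep_sum:
  "eventually (\<lambda>N. rep_germ (\<Sum>i\<in>I. c i *\<^sub>C a i) N = (\<Sum>i\<in>I. c i *\<^sub>C rep_germ (a i) N)) sequentially"
proof (induction I rule: infinite_finite_induct)
  case (insert i I)
  from insert.IH eventually_rep_lincomb[of "\<Sum>i\<in>I. c i *\<^sub>C a i" "c i" "a i"] show ?case
    by eventually_elim (use insert.hyps in \<open>simp add: add.commute\<close>)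
qed (use eventually_rep_zero in simp_all)

section \<open>Unitary direct systems\<close>

locale convergent_unitary_system =
  fixes V :: "nat \<Rightarrow> 'a::complex_vector graded_va"
    and \<omega> :: "nat \<Rightarrow> 'a"
    and \<theta> :: "nat \<Rightarrow> 'a \<Rightarrow> 'a"
    and ip :: "nat \<Rightarrow> 'a \<Rightarrow> 'a \<Rightarrow> complex"
    and f :: "nat \<Rightarrow> nat \<Rightarrow> 'a \<Rightarrow> 'a"
    and \<Phi> :: "'a germ set"
  assumes uvoa: "\<And>N. unitary_voa (V N) (\<omega> N) (\<theta> N) (ip N)"
    and cft: "\<And>N. cft_type (V N)"
    and system: "grading_restricted_direct_system V f"
    and compatible: "compatible_with_unitary_structure V \<theta> ip f"
    and basis: "homogeneous_basis V f \<Phi>"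
    and converge: "struct_const_converge V f \<Phi>"
begin

sublocale alg: unitary_cft_voa "V N" "\<omega> N" "\<theta> N" "ip N" for N
  using uvoa cft by unfold_locales

abbreviation G :: "'a germ set" where "G \<equiv> dl_carr V f"

abbreviation rep :: "'a germ \<Rightarrow> nat \<Rightarrow> 'a" where "rep \<equiv> rep_germ"

abbreviation W :: "'a germ graded_va" where "W \<equiv> VA_limit V f \<Phi>"

lemma f_carr: "M \<le> N \<Longrightarrow> u \<in> carr (V M) \<Longrightarrow> f M N u \<in> carr (V N)"
  and f_grade: "M \<le> N \<Longrightarrow> u \<in> grade (V M) n \<Longrightarrow> f M N u \<in> grade (V N) n"
  and f_vac: "M \<le> N \<Longrightarrow> f M N (vac (V M)) = vac (V N)"
  using system unfolding grading_restricted_direct_system_def image_subset_iff by auto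

lemma f_theta: "M \<le> N \<Longrightarrow> u \<in> carr (V M) \<Longrightarrow> \<theta> N (f M N u) = f M N (\<theta> M u)"
  using compatible unfolding compatible_with_unitary_structure_def by blast

lemma f_ip: "M \<le> N \<Longrightarrow> u \<in> carr (V M) \<Longrightarrow> v \<in> carr (V M) \<Longrightarrow> ip M u v = ip N (f M N u) (f M N v)"
  using compatible unfolding compatible_with_unitary_structure_def by blast

lemma dl_map_carr: "u \<in> carr (V N) \<Longrightarrow> dl_map f N u \<in> G"
  by (auto simp: dl_carr_def)

lemma dl_map_grade: "u \<in> grade (V N) n \<Longrightarrow> dl_map f N u \<in> dl_grade V f n"
  by (auto simp: dl_grade_def)

lemma dl_map_eqD: "dl_map f N u = dl_map f N v \<Longrightarrow> u \<in> carr (V N) \<Longrightarrow> v \<in> carr (V N) \<Longrightarrow> u = v"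
  using dl_map_inj[OF system] by (rule inj_onD)

lemma dl_map_lincomb:
  "(\<And>i. i \<in> I \<Longrightarrow> x i \<in> carr (V N)) \<Longrightarrow>
     dl_map f N (\<Sum>i\<in>I. c i *\<^sub>C x i) = (\<Sum>i\<in>I. c i *\<^sub>C dl_map f N (x i))"
  by (rule clinear_on_lincomb[OF alg.subspace_carr dl_map_linear[OF system]])

lemma eventually_rep_dl_map:
  "eventually (\<lambda>N. M \<le> N \<and> rep (dl_map f M u) N = f M N u) sequentially"
  using eventually_rep_abs_germ[of "\<lambda>N. if M \<le> N then f M N u else 0"] eventually_ge_at_top[of M]
  unfolding dl_map_def by eventually_elim simp

lemma G_cases:
  assumes "a \<in> G"
  obtains M u where "u \<in> carr (V M)" "a = dl_map f M u"
  using assms by (auto simp: dl_carr_def)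

lemma eventually_rep:
  assumes "a \<in> G"
  shows "eventually (\<lambda>N. rep a N \<in> carr (V N) \<and> dl_map f N (rep a N) = a) sequentially"
proof -
  obtain M u where u: "u \<in> carr (V M)" "a = dl_map f M u" using assms by (rule G_cases)
  show ?thesis
    using eventually_rep_dl_map[of M u] unfolding u(2)
    by eventually_elim (simp add: f_carr u(1) dl_map_connecting[OF system])
qed

lemma eventually_rep_carr: "a \<in> G \<Longrightarrow> eventually (\<lambda>N. rep a N \<in> carr (V N)) sequentially"
  by (rule eventually_mono[OF eventually_rep conjunct1])

lemma dl_grade_subset: "dl_grade V f n \<subseteq> G"
  unfolding dl_grade_def dl_carr_def using alg.grade_subset by blast

lemma eventually_rep_grade:
  assumes "a \<in> dl_grade V f n"
  shows "eventually (\<lambda>N. rep a N \<in> grade (V N) n) sequentially"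
proof -
  obtain M u where u: "u \<in> grade (V M) n" "a = dl_map f M u" using assms by (auto simp: dl_grade_def)
  show ?thesis
    using eventually_rep_dl_map[of M u] unfolding u(2) by eventually_elim (simp add: f_grade u(1))
qed

lemma eventually_rep_vac: "eventually (\<lambda>N. rep (vac W) N = vac (V N)) sequentially"
  using eventually_rep_dl_map[of 0 "vac (V 0)"]
  by eventually_elim (simp add: f_vac VA_limit_def)

lemma vac_W: "vac W \<in> G"
  using dl_map_carr[OF alg.vac_carr] by (simp add: VA_limit_def)

lemma carr_W [simp]: "carr W = G" and grade_W [simp]: "grade W = dl_grade V f"
  by (simp_all add: VA_limit_def)

lemma subspace_G: "csubspace G"
proof (rule complex_vector.subspaceI)
  show "0 \<in> G"
    using dl_map_carr[OF alg.carr_zero, of 0]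
    by (simp add: clinear_on_zero[OF alg.subspace_carr dl_map_linear[OF system]])
next
  fix a b assume ab: "a \<in> G" "b \<in> G"
  have "eventually (\<lambda>N. a + b \<in> G) sequentially"
    using eventually_rep[OF ab(1)] eventually_rep[OF ab(2)]
  proof eventually_elim
    case (elim N)
    then have "a + b = dl_map f N (rep a N + rep b N)"
      by (simp add: clinear_on_add[OF dl_map_linear[OF system]])
    then show ?case using elim by (simp add: dl_map_carr alg.carr_add)
  qed
  then show "a + b \<in> G" by simp
next
  fix c a assume a: "a \<in> G"
  have "eventually (\<lambda>N. c *\<^sub>C a \<in> G) sequentially"
    using eventually_rep[OF a]
  proof eventually_elim
    case (elim N)
    then have "c *\<^sub>C a = dl_map f N (c *\<^sub>C rep a N)"
      by (simp add: clinear_on_scale[OF dl_map_linear[OF system]])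
    then show ?case using elim by (simp add: dl_map_carr alg.carr_scale)
  qed
  then show "c *\<^sub>C a \<in> G" by simp
qed

lemma subspace_dl_grade: "csubspace (dl_grade V f n)"
proof (rule complex_vector.subspaceI)
  show "0 \<in> dl_grade V f n"
    using dl_map_grade[OF complex_vector.subspace_0[OF alg.subspace_grade], of 0 n]
    by (simp add: clinear_on_zero[OF alg.subspace_carr dl_map_linear[OF system]])
next
  fix a b assume ab: "a \<in> dl_grade V f n" "b \<in> dl_grade V f n"
  then have abG: "a \<in> G" "b \<in> G" using dl_grade_subset by auto
  have "eventually (\<lambda>N. a + b \<in> dl_grade V f n) sequentially"
    using eventually_rep[OF abG(1)] eventually_rep[OF abG(2)]
      eventually_rep_grade[OF ab(1)] eventually_rep_grade[OF ab(2)]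
  proof eventually_elim
    case (elim N)
    then have "a + b = dl_map f N (rep a N + rep b N)"
      by (simp add: clinear_on_add[OF dl_map_linear[OF system]])
    then show ?case using elim
      by (simp add: dl_map_grade complex_vector.subspace_add[OF alg.subspace_grade])
  qed
  then show "a + b \<in> dl_grade V f n" by simp
next
  fix c a assume a: "a \<in> dl_grade V f n"
  then have aG: "a \<in> G" using dl_grade_subset by auto
  have "eventually (\<lambda>N. c *\<^sub>C a \<in> dl_grade V f n) sequentially"
    using eventually_rep[OF aG] eventually_rep_grade[OF a]
  proof eventually_elim
    case (elim N)
    then have "c *\<^sub>C a = dl_map f N (c *\<^sub>C rep a N)"
      by (simp add: clinear_on_scale[OF dl_map_linear[OF system]])
    then show ?case using elim
      by (simp add: dl_map_grade complex_vector.subspace_scale[OF alg.subspace_grade])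
  qed
  then show "c *\<^sub>C a \<in> dl_grade V f n" by simp
qed

subsection \<open>The grading of the limit\<close>

lemma decomposition_W_exists:
  assumes "a \<in> G"
  shows "\<exists>x. homogeneous_decomposition W a x"
proof -
  obtain M u where u: "u \<in> carr (V M)" "a = dl_map f M u" using assms by (rule G_cases)
  have "homogeneous_decomposition W (dl_map f M u) (\<lambda>n. dl_map f M (component (V M) u n))"
    by (rule alg.homogeneous_decomposition_map[OF dl_map_linear[OF system] _
          alg.component_decomposition[OF u(1)]])
      (auto simp: dl_map_grade)
  then show ?thesis using u(2) by blast
qed

text \<open>A decomposition in the limit involves finitely many germs, so it becomes the decomposition of
  \<open>rep a N\<close> in \<open>V N\<close> once \<open>N\<close> is large; this reduces uniqueness in the limit to uniqueness in \<open>V N\<close>.\<close>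

lemma eventually_decomposition:
  assumes a: "a \<in> G" and x: "homogeneous_decomposition W a x" and S: "finite S" "{n. x n \<noteq> 0} \<subseteq> S"
  shows "eventually (\<lambda>N. (\<forall>n\<in>S. dl_map f N (rep (x n) N) = x n) \<and>
     component (V N) (rep a N) = (\<lambda>n. if n \<in> S then rep (x n) N else 0)) sequentially"
proof -
  have xg: "x n \<in> dl_grade V f n" for n using x by (simp add: homogeneous_decomposition_def)
  then have xG: "x n \<in> G" for n using dl_grade_subset by blast
  have a_eq: "a = (\<Sum>n\<in>S. x n)"
    using x Sum_any.expand_superset[OF S] by (simp add: homogeneous_decomposition_def)
  have "eventually (\<lambda>N. \<forall>n\<in>S. rep (x n) N \<in> carr (V N) \<and> dl_map f N (rep (x n) N) = x n) sequentially"
    using S(1) by (intro eventually_ball_finite) (auto intro: eventually_rep[OF xG])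
  moreover have "eventually (\<lambda>N. \<forall>n\<in>S. rep (x n) N \<in> grade (V N) n) sequentially"
    using S(1) by (intro eventually_ball_finite) (auto intro: eventually_rep_grade[OF xg])
  ultimately show ?thesis using eventually_rep[OF a]
  proof eventually_elim
    case (elim N)
    have "dl_map f N (\<Sum>n\<in>S. rep (x n) N) = (\<Sum>n\<in>S. x n)"
      using elim clinear_on_sum[OF alg.subspace_carr dl_map_linear[OF system], of S "\<lambda>n. rep (x n) N"] by simp
    then have sum: "rep a N = (\<Sum>n\<in>S. rep (x n) N)"
      using elim a_eq dl_map_eqD[of N "rep a N" "\<Sum>n\<in>S. rep (x n) N"] by (simp add: alg.carr_sum)
    let ?y = "\<lambda>n. if n \<in> S then rep (x n) N else 0"
    have sub: "{n. ?y n \<noteq> 0} \<subseteq> S" by auto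
    have "Sum_any ?y = (\<Sum>n\<in>S. ?y n)" using S(1) sub by (rule Sum_any.expand_superset)
    then have "homogeneous_decomposition (V N) (rep a N) ?y"
      unfolding homogeneous_decomposition_def
      using elim sum finite_subset[OF sub S(1)] complex_vector.subspace_0[OF alg.subspace_grade] by auto
    then show ?case using alg.component_eqI elim by blast
  qed
qed

sublocale limit_space: graded_space W
proof
  show "csubspace (carr W)" "\<And>n. csubspace (grade W n)" "\<And>n. grade W n \<subseteq> carr W"
    using subspace_G subspace_dl_grade dl_grade_subset by auto
  fix a assume "a \<in> carr W"
  then have a: "a \<in> G" by simp
  have "x = y" if x: "homogeneous_decomposition W a x" and y: "homogeneous_decomposition W a y" for x y
  proof -
    let ?S = "{n. x n \<noteq> 0} \<union> {n. y n \<noteq> 0}"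
    have S: "finite ?S" using x y by (simp add: homogeneous_decomposition_def)
    have sub: "{n. x n \<noteq> 0} \<subseteq> ?S" "{n. y n \<noteq> 0} \<subseteq> ?S" by auto
    have "eventually (\<lambda>N. \<forall>n\<in>?S. x n = y n) sequentially"
      using eventually_decomposition[OF a x S sub(1)] eventually_decomposition[OF a y S sub(2)]
    proof eventually_elim
      case (elim N)
      show ?case
      proof
        fix n assume n: "n \<in> ?S"
        have "(if n \<in> ?S then rep (x n) N else 0) = (if n \<in> ?S then rep (y n) N else 0)"
          using elim by metis
        then have "rep (x n) N = rep (y n) N" using n by metis
        then show "x n = y n" using elim n by metis
      qed
    qed
    then have eq: "\<forall>n\<in>?S. x n = y n" by (simp only: eventually_const[OF sequentially_bot])
    show ?thesis
    proof
      fix n show "x n = y n"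
      proof (cases "n \<in> ?S")
        case True
        then show ?thesis by (rule bspec[OF eq])
      next
        case False
        then show ?thesis by simp
      qed
    qed
  qed
  then show "\<exists>!x. homogeneous_decomposition W a x" using decomposition_W_exists[OF a] by blast
qed

lemma graded_spaces: "graded_space (V N)" "graded_space W"
  by unfold_locales

lemma rep_eqI:
  "u \<in> carr (V N) \<Longrightarrow> dl_map f N u = a \<Longrightarrow> rep a N \<in> carr (V N) \<and> dl_map f N (rep a N) = a \<Longrightarrow>
     rep a N = u"
  using dl_map_eqD by blast

lemma component_dl_map: "u \<in> carr (V N) \<Longrightarrow> component W (dl_map f N u) n = dl_map f N (component (V N) u n)"
  by (rule component_map[OF graded_spaces dl_map_linear[OF system]]) (auto simp: dl_map_carr dl_map_grade)

lemma L0_dl_map: "u \<in> carr (V N) \<Longrightarrow> L0 W (dl_map f N u) = dl_map f N (L0 (V N) u)"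
  by (rule L0_map[OF graded_spaces dl_map_linear[OF system]]) (auto simp: dl_map_carr dl_map_grade)

lemma eventually_rep_component:
  assumes a: "a \<in> G"
  shows "eventually (\<lambda>N. rep (component W a n) N = component (V N) (rep a N) n) sequentially"
proof -
  have "component W a n \<in> G" using limit_space.component_carr a by simp
  from eventually_rep[OF this] eventually_rep[OF a] show ?thesis
    by eventually_elim (rule rep_eqI; metis alg.component_carr component_dl_map)
qed

lemma eventually_rep_L0:
  assumes a: "a \<in> G"
  shows "eventually (\<lambda>N. rep (L0 W a) N = L0 (V N) (rep a N)) sequentially"
proof -
  have "L0 W a \<in> G" using limit_space.L0_carr a by simp
  from eventually_rep[OF this] eventually_rep[OF a] show ?thesis
    by eventually_elim (rule rep_eqI; metis alg.L0_carr L0_dl_map)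
qed

subsection \<open>The form and the anti-linear involution of the limit\<close>

text \<open>The connecting maps are isometric, so the sequence is eventually constant.\<close>

definition ip_inf :: "'a germ \<Rightarrow> 'a germ \<Rightarrow> complex" where
  "ip_inf a b = lim (\<lambda>N. ip N (rep a N) (rep b N))"

definition theta_inf :: "'a germ \<Rightarrow> 'a germ" where
  "theta_inf a = abs_germ (\<lambda>N. \<theta> N (rep a N))"

lemma eventually_ip:
  assumes "a \<in> G" "b \<in> G"
  shows "eventually (\<lambda>N. ip N (rep a N) (rep b N) = ip_inf a b) sequentially"
proof -
  have "eventually (\<lambda>K. eventually (\<lambda>N. ip N (rep a N) (rep b N) = ip K (rep a K) (rep b K)) sequentially) sequentially"
    using eventually_rep[OF assms(1)] eventually_rep[OF assms(2)]
  proof eventually_elim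
    case (elim K)
    have "eventually (\<lambda>N. K \<le> N \<and> rep a N = f K N (rep a K)) sequentially"
      "eventually (\<lambda>N. K \<le> N \<and> rep b N = f K N (rep b K)) sequentially"
      using eventually_rep_dl_map[of K "rep a K"] eventually_rep_dl_map[of K "rep b K"] elim by simp_all
    then show ?case by eventually_elim (use elim f_ip in metis)
  qed
  then obtain c where c: "eventually (\<lambda>N. ip N (rep a N) (rep b N) = c) sequentially"
    by (auto dest: eventually_happens)
  then have "ip_inf a b = c"
    unfolding ip_inf_def by (intro limI tendsto_eventually)
  then show ?thesis using c by simp
qed

lemma eventually_rep_theta: "eventually (\<lambda>N. rep (theta_inf a) N = \<theta> N (rep a N)) sequentially"
  unfolding theta_inf_def by (rule eventually_rep_abs_germ)

lemma theta_carr: "u \<in> carr (V N) \<Longrightarrow> \<theta> N u \<in> carr (V N)"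
  and theta_grade: "u \<in> grade (V N) n \<Longrightarrow> \<theta> N u \<in> grade (V N) n"
  and theta_antilinear: "antilinear_on (carr (V N)) (\<theta> N)"
  and theta_theta: "u \<in> carr (V N) \<Longrightarrow> \<theta> N (\<theta> N u) = u"
  and theta_vac: "\<theta> N (vac (V N)) = vac (V N)"
  and theta_mode: "u \<in> carr (V N) \<Longrightarrow> v \<in> carr (V N) \<Longrightarrow>
    \<theta> N (mode (V N) u n v) = mode (V N) (\<theta> N u) n (\<theta> N v)"
  and theta_L1: "u \<in> carr (V N) \<Longrightarrow> \<theta> N (mode (V N) (\<omega> N) 2 u) = mode (V N) (\<omega> N) 2 (\<theta> N u)"
  using alg.automorphism[of N] unfolding antilinear_involutive_automorphism_def image_subset_iff by auto

lemma theta_inf_dl_map: "u \<in> carr (V M) \<Longrightarrow> theta_inf (dl_map f M u) = dl_map f M (\<theta> M u)"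
  unfolding theta_inf_def dl_map_def[of f M "\<theta> M u"] germ.abs_eq_iff
  using eventually_rep_dl_map[of M u] by eventually_elim (simp add: f_theta)

lemma theta_inf_carr: "a \<in> G \<Longrightarrow> theta_inf a \<in> G"
  by (elim G_cases) (simp add: theta_inf_dl_map dl_map_carr theta_carr)

lemma theta_inf_grade: "a \<in> dl_grade V f n \<Longrightarrow> theta_inf a \<in> dl_grade V f n"
proof -
  assume "a \<in> dl_grade V f n"
  then obtain M u where "u \<in> grade (V M) n" "a = dl_map f M u" by (auto simp: dl_grade_def)
  then show ?thesis
    by (simp add: theta_inf_dl_map alg.grade_carr dl_map_grade theta_grade)
qed

sublocale form: hermitian_form G ip_inf
proof
  show "csubspace G" by (rule subspace_G)
  have "ip_inf (u + v) w = ip_inf u w + ip_inf v w" if uvw: "u \<in> G" "v \<in> G" "w \<in> G" for u v w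
  proof -
    have "u + v \<in> G" using uvw by (simp add: complex_vector.subspace_add[OF subspace_G])
    from eventually_ip[OF this uvw(3)] eventually_ip[OF uvw(1,3)] eventually_ip[OF uvw(2,3)]
      eventually_rep_carr[OF uvw(1)] eventually_rep_carr[OF uvw(2)] eventually_rep_carr[OF uvw(3)]
      eventually_rep_add[of u v]
    have "eventually (\<lambda>N. ip_inf (u + v) w = ip_inf u w + ip_inf v w) sequentially"
      by eventually_elim (metis alg.ip_add_left)
    then show ?thesis by simp
  qed
  moreover have "ip_inf (c *\<^sub>C u) v = c * ip_inf u v" if uv: "u \<in> G" "v \<in> G" for c u v
  proof -
    have "c *\<^sub>C u \<in> G" using uv by (simp add: complex_vector.subspace_scale[OF subspace_G])
    from eventually_ip[OF this uv(2)] eventually_ip[OF uv]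
      eventually_rep_carr[OF uv(1)] eventually_rep_carr[OF uv(2)] eventually_rep_scale[of c u]
    have "eventually (\<lambda>N. ip_inf (c *\<^sub>C u) v = c * ip_inf u v) sequentially"
      by eventually_elim (metis alg.ip_scale_left)
    then show ?thesis by simp
  qed
  moreover have "ip_inf v u = cnj (ip_inf u v)" if uv: "u \<in> G" "v \<in> G" for u v
  proof -
    from eventually_ip[OF uv] eventually_ip[OF uv(2,1)]
      eventually_rep_carr[OF uv(1)] eventually_rep_carr[OF uv(2)]
    have "eventually (\<lambda>N. ip_inf v u = cnj (ip_inf u v)) sequentially"
      by eventually_elim (metis alg.ip_cnj)
    then show ?thesis by simp
  qed
  moreover have "Im (ip_inf u u) = 0 \<and> Re (ip_inf u u) > 0" if u: "u \<in> G" "u \<noteq> 0" for u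
  proof -
    from eventually_ip[OF u(1) u(1)] eventually_rep[OF u(1)]
    have "eventually (\<lambda>N. Im (ip_inf u u) = 0 \<and> Re (ip_inf u u) > 0) sequentially"
    proof eventually_elim
      case (elim N)
      then have "rep u N \<noteq> 0"
        using u(2) clinear_on_zero[OF alg.subspace_carr dl_map_linear[OF system], of N] by auto
      then show ?case using elim alg.ip_pos[of "rep u N" N] by simp
    qed
    then show ?thesis by simp
  qed
  ultimately show "positive_definite_hermitian G ip_inf"
    unfolding positive_definite_hermitian_def by blast
qed

end

section \<open>Limits of sequences of vectors along a direct system\<close>

text \<open>Closing the constant germs under combinations with convergent coefficients makes the limit notion
  independent of any choice of a basis, and linearity arguments become inductions. The filter is
  \<open>sequentially\<close> for the existence of the limit algebra and that of a subsequence for uniqueness.\<close>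

inductive seq_limit ::
    "(nat \<Rightarrow> 'a::complex_vector graded_va) \<Rightarrow> (nat \<Rightarrow> nat \<Rightarrow> 'a \<Rightarrow> 'a) \<Rightarrow> nat filter \<Rightarrow>
     (nat \<Rightarrow> 'a) \<Rightarrow> 'a germ \<Rightarrow> bool" for V f F where
  germ: "a \<in> dl_carr V f \<Longrightarrow> seq_limit V f F (rep_germ a) a"
| lincomb: "seq_limit V f F x a \<Longrightarrow> seq_limit V f F y b \<Longrightarrow> (c \<longlongrightarrow> l) F \<Longrightarrow>
    seq_limit V f F (\<lambda>N. x N + c N *\<^sub>C y N) (a + l *\<^sub>C b)"
| cong: "seq_limit V f F x a \<Longrightarrow> eventually (\<lambda>N. x N = y N) F \<Longrightarrow> seq_limit V f F y a"

context convergent_unitary_system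
begin

subsection \<open>Weight spaces of the limit\<close>

text \<open>Finitely many vectors of a weight space of the limit have representatives in the same \<open>V N\<close>, whose
  weight space has the stable dimension \<open>d\<close>.\<close>

lemma card_independent_dl_grade:
  obtains d where "\<And>S. finite S \<Longrightarrow> S \<subseteq> dl_grade V f n \<Longrightarrow> \<not> cdependent S \<Longrightarrow> card S \<le> d"
proof -
  obtain K where K: "\<And>M N. M \<ge> K \<Longrightarrow> N \<ge> K \<Longrightarrow> cdim (grade (V M) n) = cdim (grade (V N) n)"
    using system unfolding grading_restricted_direct_system_def by meson
  have "card S \<le> cdim (grade (V K) n)"
    if S: "finite S" "S \<subseteq> dl_grade V f n" "\<not> cdependent S" for S
  proof -
    have "eventually (\<lambda>N. \<forall>s\<in>S. rep s N \<in> grade (V N) n) sequentially"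
      using S(1,2) by (intro eventually_ball_finite ballI eventually_rep_grade) blast+
    moreover have "eventually (\<lambda>N. \<forall>s\<in>S. rep s N \<in> carr (V N) \<and> dl_map f N (rep s N) = s) sequentially"
      using S(1,2) dl_grade_subset by (intro eventually_ball_finite ballI eventually_rep) blast+
    ultimately have "eventually (\<lambda>N. card S \<le> cdim (grade (V K) n)) sequentially"
      using eventually_ge_at_top[of K]
    proof eventually_elim
      case (elim N)
      obtain B where B: "B \<subseteq> grade (V N) n" "\<not> cdependent B" "grade (V N) n \<subseteq> cspan B"
        "card B = cdim (grade (V N) n)"
        using complex_vector.basis_exists[of "grade (V N) n"] by blast
      obtain B0 where B0: "finite B0" "cspan B0 = grade (V N) n"
        using alg.grade_finite_dim[of N n] by blast
      have "finite B" using complex_vector.independent_span_bound[OF B0(1) B(2)] B0(2) B(1) by simp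
      have "S \<subseteq> dl_map f N ` cspan B"
      proof
        fix s assume "s \<in> S"
        then have "dl_map f N (rep s N) = s" "rep s N \<in> cspan B" using elim B(3) by auto
        then show "s \<in> dl_map f N ` cspan B" by (metis imageI)
      qed
      also have "\<dots> \<subseteq> cspan (dl_map f N ` B)"
        using B(1) alg.grade_subset
        by (intro clinear_on_span_image[OF alg.subspace_carr dl_map_linear[OF system]]) blast
      finally have "card S \<le> card (dl_map f N ` B)"
        using complex_vector.independent_span_bound[of "dl_map f N ` B" S] \<open>finite B\<close> S(3) by simp
      also have "\<dots> \<le> card B" using \<open>finite B\<close> by (rule card_image_le)
      also have "\<dots> = cdim (grade (V K) n)" using B(4) K[of N K] elim by simp
      finally show ?case .
    qed
    then show ?thesis by simp
  qed
  then show ?thesis using that by blast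
qed

lemma finite_independent_dl_grade:
  assumes "B \<subseteq> dl_grade V f n" "\<not> cdependent B"
  shows "finite B"
proof (rule ccontr)
  assume "infinite B"
  obtain d where d: "\<And>S. finite S \<Longrightarrow> S \<subseteq> dl_grade V f n \<Longrightarrow> \<not> cdependent S \<Longrightarrow> card S \<le> d"
    using card_independent_dl_grade by blast
  obtain T where T: "finite T" "card T = Suc d" "T \<subseteq> B"
    using infinite_arbitrarily_large[OF \<open>infinite B\<close>] by blast
  then have "card T \<le> d" using assms complex_vector.independent_mono by (intro d) blast+
  then show False using T(2) by simp
qed

definition onb :: "int \<Rightarrow> 'a germ set" where
  "onb n = (SOME E. form.orthonormal E \<and> cspan E = dl_grade V f n)"

lemma onb: "form.orthonormal (onb n)" "cspan (onb n) = dl_grade V f n"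
proof -
  obtain B where B: "B \<subseteq> dl_grade V f n" "\<not> cdependent B" "dl_grade V f n \<subseteq> cspan B"
    using complex_vector.maximal_independent_subset[of "dl_grade V f n"] by blast
  have "finite B" using finite_independent_dl_grade[OF B(1,2)] .
  moreover have "B \<subseteq> G" using B(1) dl_grade_subset by blast
  moreover have "cspan B = dl_grade V f n"
    using B(3) complex_vector.span_minimal[OF B(1) subspace_dl_grade] by blast
  ultimately have "\<exists>E. form.orthonormal E \<and> cspan E = dl_grade V f n"
    using form.orthonormal_basis_exists by metis
  then show "form.orthonormal (onb n)" "cspan (onb n) = dl_grade V f n"
    unfolding onb_def using someI_ex[of "\<lambda>E. form.orthonormal E \<and> cspan E = dl_grade V f n"] by blast+
qed

lemma finite_onb: "finite (onb n)"
  using onb(1) by (simp add: form.orthonormal_def)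

lemma onb_grade: "e \<in> onb n \<Longrightarrow> e \<in> dl_grade V f n"
  using onb(2)[of n] complex_vector.span_base[of e "onb n"] by simp

lemma onb_G: "e \<in> onb n \<Longrightarrow> e \<in> G"
  using onb_grade dl_grade_subset by blast

text \<open>The canonical map sends \<open>y\<close> to a combination of \<open>B\<close>; as it is injective, the same coefficients
  express \<open>y\<close> in terms of the representatives.\<close>

lemma eventually_rep_spans:
  assumes B: "finite B" "B \<subseteq> G" "cspan B = dl_grade V f n"
  shows "eventually (\<lambda>N. \<forall>y\<in>grade (V N) n. \<exists>c. y = (\<Sum>e\<in>B. c e *\<^sub>C rep e N)) sequentially"
proof -
  have "eventually (\<lambda>N. \<forall>e\<in>B. rep e N \<in> carr (V N) \<and> dl_map f N (rep e N) = e) sequentially"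
    using B(1,2) by (intro eventually_ball_finite ballI eventually_rep) blast+
  then show ?thesis
  proof eventually_elim
    case (elim N)
    show ?case
    proof
      fix y assume y: "y \<in> grade (V N) n"
      then have "dl_map f N y \<in> cspan B" using dl_map_grade B(3) by simp
      then obtain c where "dl_map f N y = (\<Sum>e\<in>B. c e *\<^sub>C e)"
        using B(1) by (auto simp: complex_vector.span_finite)
      also have "\<dots> = (\<Sum>e\<in>B. c e *\<^sub>C dl_map f N (rep e N))" using elim by simp
      also have "\<dots> = dl_map f N (\<Sum>e\<in>B. c e *\<^sub>C rep e N)"
        using elim by (intro dl_map_lincomb[symmetric]) simp
      finally have eq: "dl_map f N y = dl_map f N (\<Sum>e\<in>B. c e *\<^sub>C rep e N)" .
      have "(\<Sum>e\<in>B. c e *\<^sub>C rep e N) \<in> carr (V N)"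
        using elim by (intro alg.carr_sum alg.carr_scale) blast
      then have "y = (\<Sum>e\<in>B. c e *\<^sub>C rep e N)"
        by (rule dl_map_eqD[OF eq alg.grade_carr[OF y]])
      then show "\<exists>c. y = (\<Sum>e\<in>B. c e *\<^sub>C rep e N)" by blast
    qed
  qed
qed

text \<open>Representatives of an orthonormal family are orthonormal because the connecting maps are isometric.
  The expansion makes a sequence of vectors of \<open>V N\<close> accessible through its inner products with
  fixed vectors of the limit.\<close>

lemma eventually_onb_expansion:
  "eventually (\<lambda>N. \<forall>y\<in>grade (V N) n. y = (\<Sum>e\<in>onb n. ip N y (rep e N) *\<^sub>C rep e N)) sequentially"
proof -
  have "eventually (\<lambda>N. \<forall>e\<in>onb n. rep e N \<in> carr (V N)) sequentially"
    by (intro eventually_ball_finite ballI eventually_rep_carr finite_onb onb_G)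
  moreover have "eventually (\<lambda>N. \<forall>e\<in>onb n. \<forall>e'\<in>onb n. ip N (rep e N) (rep e' N) = ip_inf e e') sequentially"
    by (intro eventually_ball_finite ballI eventually_ip finite_onb onb_G)
  moreover have "eventually (\<lambda>N. \<forall>y\<in>grade (V N) n. \<exists>c. y = (\<Sum>e\<in>onb n. c e *\<^sub>C rep e N)) sequentially"
    by (intro eventually_rep_spans finite_onb onb subsetI onb_G)
  ultimately show ?thesis
  proof eventually_elim
    case (elim N)
    show ?case
    proof
      fix y assume "y \<in> grade (V N) n"
      then obtain c where c: "y = (\<Sum>e\<in>onb n. c e *\<^sub>C rep e N)" using elim by blast
      have "ip N y (rep e N) = c e" if e: "e \<in> onb n" for e
      proof -
        have "ip N y (rep e N) = (\<Sum>e'\<in>onb n. c e' * ip N (rep e' N) (rep e N))"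
          unfolding c using elim e by (intro alg.ip_lincomb_left) auto
        also have "\<dots> = (\<Sum>e'\<in>onb n. if e' = e then c e' else 0)"
          using elim e onb(1)[of n] by (intro sum.cong) (auto simp: form.orthonormal_def)
        also have "\<dots> = c e" using e finite_onb by simp
        finally show ?thesis .
      qed
      then have "(\<Sum>e\<in>onb n. ip N y (rep e N) *\<^sub>C rep e N) = (\<Sum>e\<in>onb n. c e *\<^sub>C rep e N)"
        by (intro sum.cong) auto
      then show "y = (\<Sum>e\<in>onb n. ip N y (rep e N) *\<^sub>C rep e N)" using c by metis
    qed
  qed
qed

subsection \<open>The basis\<close>

lemma basis_independent: "\<not> cdependent \<Phi>" and basis_span: "cspan \<Phi> = G"
  and basis_homogeneous: "\<And>a. a \<in> \<Phi> \<Longrightarrow> \<exists>n. a \<in> dl_grade V f n"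
  using basis unfolding homogeneous_basis_def by blast+

lemma basis_nonzero: "a \<in> \<Phi> \<Longrightarrow> a \<noteq> 0"
  using basis_independent complex_vector.dependent_zero by blast

lemma basis_G: "a \<in> \<Phi> \<Longrightarrow> a \<in> G"
  using basis_homogeneous dl_grade_subset by blast

lemma wt_eq:
  assumes "a \<in> dl_grade V f n" "a \<noteq> 0"
  shows "wt V f a = n"
  unfolding wt_def
proof (rule the_equality)
  fix m assume "a \<in> dl_grade V f m"
  then have "component W a n = (if n = m then a else 0)" using limit_space.component_homogeneous by simp
  moreover have "component W a n = a" using limit_space.component_homogeneous assms by simp
  ultimately show "m = n" using assms(2) by (simp split: if_splits)
qed fact

lemma wt_basis: "a \<in> \<Phi> \<Longrightarrow> a \<in> dl_grade V f n \<longleftrightarrow> wt V f a = n"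
  using wt_eq basis_nonzero basis_homogeneous by metis

text \<open>Taking components of weight \<open>n\<close> removes the basis vectors of other weights from an expansion.\<close>

lemma basis_grade_span: "cspan (\<Phi> \<inter> dl_grade V f n) = dl_grade V f n"
proof
  show "cspan (\<Phi> \<inter> dl_grade V f n) \<subseteq> dl_grade V f n"
    by (rule complex_vector.span_minimal) (auto simp: subspace_dl_grade)
  show "dl_grade V f n \<subseteq> cspan (\<Phi> \<inter> dl_grade V f n)"
  proof
    fix x assume x: "x \<in> dl_grade V f n"
    then have "x \<in> cspan \<Phi>" using basis_span dl_grade_subset by blast
    then obtain t c where t: "finite t" "t \<subseteq> \<Phi>" "x = (\<Sum>a\<in>t. c a *\<^sub>C a)"
      by (auto simp: complex_vector.span_explicit)
    have "x = component W x n" using limit_space.component_homogeneous[of x n] x by simp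
    also have "\<dots> = (\<Sum>a\<in>t. c a *\<^sub>C component W a n)"
      unfolding t(3) using t(2) basis_G
      by (intro clinear_on_lincomb[OF limit_space.subspace_carr limit_space.component_linear]) auto
    also have "\<dots> \<in> cspan (\<Phi> \<inter> dl_grade V f n)"
    proof (intro complex_vector.span_sum complex_vector.span_scale)
      fix a assume "a \<in> t"
      then obtain m where "a \<in> \<Phi>" "a \<in> dl_grade V f m" using t(2) basis_homogeneous by blast
      then show "component W a n \<in> cspan (\<Phi> \<inter> dl_grade V f n)"
        using limit_space.component_homogeneous[of a m]
        by (cases "n = m") (auto intro: complex_vector.span_base complex_vector.span_zero)
    qed
    finally show "x \<in> cspan (\<Phi> \<inter> dl_grade V f n)" .
  qed
qed

lemma finite_basis_grade: "finite (\<Phi> \<inter> dl_grade V f n)"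
  using finite_independent_dl_grade[of "\<Phi> \<inter> dl_grade V f n" n]
    complex_vector.independent_mono[OF basis_independent] by blast

lemma eventually_representative: "a \<in> G \<Longrightarrow> eventually (\<lambda>N. representative V f N a = rep a N) sequentially"
proof -
  assume "a \<in> G"
  from eventually_rep[OF this] show ?thesis
  proof eventually_elim
    case (elim N)
    then show ?case
      unfolding representative_def using inv_into_f_f[OF dl_map_inj[OF system], of "rep a N" N] by metis
  qed
qed

text \<open>The representatives of the basis vectors of weight \<open>q\<close> are eventually a basis of the weight space
  of \<open>V N\<close>, and the structure constants are the coordinates with respect to it.\<close>

lemma eventually_struct_const:
  fixes n :: int
  assumes b: "b \<in> \<Phi>" and c: "c \<in> \<Phi>"
  defines "q \<equiv> wt V f b + wt V f c - n - 1"
  shows "eventually (\<lambda>N. mode (V N) (rep b N) n (rep c N)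
      = (\<Sum>a\<in>\<Phi> \<inter> dl_grade V f q. struct_const V f \<Phi> N a b c *\<^sub>C rep a N)) sequentially"
proof -
  let ?B = "\<Phi> \<inter> dl_grade V f q"
  have B: "finite ?B" "?B \<subseteq> G" "cspan ?B = dl_grade V f q"
    using finite_basis_grade basis_grade_span dl_grade_subset by blast+
  have "eventually (\<lambda>N. \<forall>a\<in>?B. rep a N \<in> carr (V N) \<and> dl_map f N (rep a N) = a) sequentially"
    using B(1,2) by (intro eventually_ball_finite ballI eventually_rep) blast+
  moreover have "eventually (\<lambda>N. \<forall>a\<in>?B. representative V f N a = rep a N) sequentially"
    using B(1,2) by (intro eventually_ball_finite ballI eventually_representative) blast+
  moreover note eventually_representative[OF basis_G[OF b]] eventually_representative[OF basis_G[OF c]]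
    eventually_rep_spans[OF B]
  moreover have "eventually (\<lambda>N. rep b N \<in> grade (V N) (wt V f b)) sequentially"
    "eventually (\<lambda>N. rep c N \<in> grade (V N) (wt V f c)) sequentially"
    using wt_basis b c by (auto intro: eventually_rep_grade)
  ultimately show ?thesis
  proof eventually_elim
    case (elim N)
    let ?y = "mode (V N) (rep b N) n (rep c N)"
    let ?R = "(\<lambda>a. rep a N) ` ?B"
    have inj: "inj_on (\<lambda>a. rep a N) ?B" using elim(1) by (intro inj_onI) metis
    have R: "representative V f N ` ?B = ?R" using elim(2) by (intro image_cong) auto
    have y: "?y \<in> grade (V N) q" unfolding q_def using elim(6,7) by (rule alg.mode_grade)
    then obtain d where "?y = (\<Sum>a\<in>?B. d a *\<^sub>C rep a N)" using elim(5) by blast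
    moreover have "(\<Sum>a\<in>?B. d a *\<^sub>C rep a N) \<in> cspan ?R"
      by (intro complex_vector.span_sum complex_vector.span_scale complex_vector.span_base imageI)
    ultimately have span: "?y \<in> cspan ?R" by metis
    have indep: "\<not> cdependent ?R"
    proof
      assume "cdependent ?R"
      then obtain u where u: "\<exists>v\<in>?R. u v \<noteq> 0" "(\<Sum>v\<in>?R. u v *\<^sub>C v) = 0"
        using B(1) by (auto simp: complex_vector.dependent_finite)
      have "(\<Sum>a\<in>?B. u (rep a N) *\<^sub>C a) = (\<Sum>a\<in>?B. u (rep a N) *\<^sub>C dl_map f N (rep a N))"
        using elim(1) by (intro sum.cong) auto
      also have "\<dots> = dl_map f N (\<Sum>a\<in>?B. u (rep a N) *\<^sub>C rep a N)"
        using elim(1) by (intro dl_map_lincomb[symmetric]) simp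
      also have "(\<Sum>a\<in>?B. u (rep a N) *\<^sub>C rep a N) = 0"
        using u(2) by (simp add: sum.reindex[OF inj] o_def)
      finally have "(\<Sum>a\<in>?B. u (rep a N) *\<^sub>C a) = 0"
        using clinear_on_zero[OF alg.subspace_carr dl_map_linear[OF system]] by simp
      moreover have "\<exists>a\<in>?B. u (rep a N) \<noteq> 0" using u(1) by blast
      ultimately have "cdependent ?B"
        unfolding complex_vector.dependent_finite[OF B(1)] by (intro exI[of _ "\<lambda>a. u (rep a N)"]) blast
      then show False
        using complex_vector.independent_mono[OF basis_independent, of ?B] by blast
    qed
    have "(\<Sum>v\<in>?R. crepresentation ?R ?y v *\<^sub>C v) = ?y"
      using indep span B(1) by (intro complex_vector.sum_representation_eq) auto
    then have "?y = (\<Sum>a\<in>?B. crepresentation ?R ?y (rep a N) *\<^sub>C rep a N)"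
      by (simp add: sum.reindex[OF inj] o_def)
    also have "\<dots> = (\<Sum>a\<in>?B. struct_const V f \<Phi> N a b c *\<^sub>C rep a N)"
    proof (rule sum.cong)
      fix a assume a: "a \<in> ?B"
      then have wa: "wt V f a = q" using wt_basis by blast
      have "wt V f b + wt V f c - q - 1 = n" by (simp add: q_def)
      then have "struct_const V f \<Phi> N a b c = crepresentation ?R ?y (rep a N)"
        unfolding struct_const_def wa R elim(3) elim(4) using elim(2) a by simp
      then show "crepresentation ?R ?y (rep a N) *\<^sub>C rep a N = struct_const V f \<Phi> N a b c *\<^sub>C rep a N"
        by simp
    qed simp
    finally show ?case .
  qed
qed

context
  fixes F :: "nat filter"
  assumes F_le: "F \<le> sequentially" and F_bot: "F \<noteq> bot"
begin

abbreviation tends :: "(nat \<Rightarrow> 'a) \<Rightarrow> 'a germ \<Rightarrow> bool" where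
  "tends \<equiv> seq_limit V f F"

lemma eventually_F: "eventually P sequentially \<Longrightarrow> eventually P F"
  using F_le by (rule filter_leD)

lemma tends_carr: "tends x a \<Longrightarrow> a \<in> G \<and> eventually (\<lambda>N. x N \<in> carr (V N)) F"
proof (induction rule: seq_limit.induct)
  case (germ a)
  then show ?case using eventually_F[OF eventually_rep_carr] by blast
next
  case (lincomb x a y b c l)
  have "eventually (\<lambda>N. x N + c N *\<^sub>C y N \<in> carr (V N)) F"
    using conjunct2[OF lincomb.IH(1)] conjunct2[OF lincomb.IH(2)]
    by eventually_elim (intro alg.carr_add alg.carr_scale)
  moreover have "a + l *\<^sub>C b \<in> G" using lincomb.IH by (intro form.S_add form.S_scale) blast+
  ultimately show ?case by blast
next
  case (cong x a y)
  have "eventually (\<lambda>N. y N \<in> carr (V N)) F"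
    using conjunct2[OF cong.IH] cong.hyps(2) by eventually_elim simp
  then show ?case using cong.IH by blast
qed

lemmas tends_G = tends_carr[THEN conjunct1]
lemmas tends_in_carr = tends_carr[THEN conjunct2]

lemma tends_zero: "tends (\<lambda>_. 0) 0"
  using seq_limit.germ[OF form.S_zero] eventually_F[OF eventually_rep_zero] by (rule seq_limit.cong)

lemma tends_scale: "tends x a \<Longrightarrow> (c \<longlongrightarrow> l) F \<Longrightarrow> tends (\<lambda>N. c N *\<^sub>C x N) (l *\<^sub>C a)"
  using seq_limit.lincomb[OF tends_zero, of x a c l] by simp

lemma tends_scale_const: "tends x a \<Longrightarrow> tends (\<lambda>N. c *\<^sub>C x N) (c *\<^sub>C a)"
  by (rule tends_scale) (auto intro: tendsto_const)

lemma tends_add: "tends x a \<Longrightarrow> tends y b \<Longrightarrow> tends (\<lambda>N. x N + y N) (a + b)"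
  using seq_limit.lincomb[of V f F x a y b "\<lambda>_. 1" 1] by (simp add: scaleC_one tendsto_const)

lemma tends_diff: "tends x a \<Longrightarrow> tends y b \<Longrightarrow> tends (\<lambda>N. x N - y N) (a - b)"
  using seq_limit.lincomb[of V f F x a y b "\<lambda>_. - 1" "- 1"] by (simp add: scaleC_one tendsto_const)

lemma tends_sum:
  "(\<And>i. i \<in> I \<Longrightarrow> tends (x i) (a i)) \<Longrightarrow> tends (\<lambda>N. \<Sum>i\<in>I. x i N) (\<Sum>i\<in>I. a i)"
  by (induction I rule: infinite_finite_induct) (auto intro: tends_zero tends_add)

lemma tends_ip:
  assumes "tends x a" "tends y b"
  shows "((\<lambda>N. ip N (x N) (y N)) \<longlongrightarrow> ip_inf a b) F"
  using assms(1)
proof (induction rule: seq_limit.induct)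
  case (germ a)
  from assms(2) show ?case
  proof (induction rule: seq_limit.induct)
    case (germ b)
    then show ?case using \<open>a \<in> G\<close> by (intro tendsto_eventually eventually_F eventually_ip)
  next
    case (lincomb x b y b' c l)
    have "((\<lambda>N. ip N (rep a N) (x N) + cnj (c N) * ip N (rep a N) (y N))
        \<longlongrightarrow> ip_inf a b + cnj l * ip_inf a b') F"
      by (intro tendsto_intros lincomb)
    moreover have "eventually (\<lambda>N. ip N (rep a N) (x N) + cnj (c N) * ip N (rep a N) (y N)
        = ip N (rep a N) (x N + c N *\<^sub>C y N)) F"
      using tends_in_carr[OF lincomb.hyps(1)] tends_in_carr[OF lincomb.hyps(2)]
        eventually_F[OF eventually_rep_carr[OF \<open>a \<in> G\<close>]]
      by eventually_elim (rule alg.ip_linear_right[symmetric])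
    moreover have "ip_inf a (b + l *\<^sub>C b') = ip_inf a b + cnj l * ip_inf a b'"
      using tends_G[OF lincomb.hyps(1)] tends_G[OF lincomb.hyps(2)] \<open>a \<in> G\<close>
      by (intro form.ip_linear_right)
    ultimately show ?case by (simp only:) (rule Lim_transform_eventually)
  next
    case (cong x b y)
    have "eventually (\<lambda>N. ip N (rep a N) (x N) = ip N (rep a N) (y N)) F"
      using cong.hyps(2) by eventually_elim simp
    then show ?case by (rule Lim_transform_eventually[OF cong.IH])
  qed
next
  case (lincomb x a x' a' c l)
  have "((\<lambda>N. ip N (x N) (y N) + c N * ip N (x' N) (y N)) \<longlongrightarrow> ip_inf a b + l * ip_inf a' b) F"
    by (intro tendsto_intros lincomb)
  moreover have "eventually (\<lambda>N. ip N (x N) (y N) + c N * ip N (x' N) (y N)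
      = ip N (x N + c N *\<^sub>C x' N) (y N)) F"
    using tends_in_carr[OF lincomb.hyps(1)] tends_in_carr[OF lincomb.hyps(2)] tends_in_carr[OF assms(2)]
    by eventually_elim (rule alg.ip_linear_left[symmetric])
  moreover have "ip_inf (a + l *\<^sub>C a') b = ip_inf a b + l * ip_inf a' b"
    using tends_G[OF lincomb.hyps(1)] tends_G[OF lincomb.hyps(2)] tends_G[OF assms(2)]
    by (intro form.ip_linear_left)
  ultimately show ?case by (simp only:) (rule Lim_transform_eventually)
next
  case (cong x a x')
  have "eventually (\<lambda>N. ip N (x N) (y N) = ip N (x' N) (y N)) F"
    using cong.hyps(2) by eventually_elim simp
  then show ?case by (rule Lim_transform_eventually[OF cong.IH])
qed

text \<open>The norm of the difference is eventually zero and converges to the norm of \<open>a - b\<close>.\<close>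

lemma tends_unique:
  assumes "tends x a" "tends y b" "eventually (\<lambda>N. x N = y N) F"
  shows "a = b"
proof -
  have d: "tends (\<lambda>N. x N - y N) (a - b)" using assms(1,2) by (rule tends_diff)
  have "eventually (\<lambda>N. ip N (x N - y N) (x N - y N) = 0) F"
    using assms(3) by eventually_elim (simp add: alg.ip_zero_left alg.carr_zero)
  then have "((\<lambda>N. ip N (x N - y N) (x N - y N)) \<longlongrightarrow> 0) F" by (rule tendsto_eventually)
  then have "ip_inf (a - b) (a - b) = 0" using tends_ip[OF d d] F_bot by (rule_tac tendsto_unique)
  then have "a - b = 0" by (rule form.ip_eq_zero[OF tends_G[OF d]])
  then show ?thesis by simp
qed

text \<open>A pointwise limit of linear maps is linear since limits are unique.\<close>

lemma limit_map_linear: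
  assumes lin: "eventually (\<lambda>N. clinear_on (carr (V N)) (g N)) F"
    and base: "\<And>a. a \<in> G \<Longrightarrow> tends (\<lambda>N. g N (rep a N)) (h a)"
  shows "clinear_on G h"
proof -
  have *: "h (a + c *\<^sub>C b) = h a + c *\<^sub>C h b" if ab: "a \<in> G" "b \<in> G" for a b c
  proof (rule tends_unique[OF base])
    show "a + c *\<^sub>C b \<in> G" using ab by (intro form.S_add form.S_scale)
    show "tends (\<lambda>N. g N (rep a N) + c *\<^sub>C g N (rep b N)) (h a + c *\<^sub>C h b)"
      using ab by (intro seq_limit.lincomb base tendsto_const)
    show "eventually (\<lambda>N. g N (rep (a + c *\<^sub>C b) N) = g N (rep a N) + c *\<^sub>C g N (rep b N)) F"
      using lin eventually_F[OF eventually_rep_carr[OF ab(1)]] eventually_F[OF eventually_rep_carr[OF ab(2)]]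
        eventually_F[OF eventually_rep_lincomb[of a c b]]
      by eventually_elim (simp add: clinear_on_add clinear_on_scale alg.carr_scale)
  qed
  have "h 0 = 0"
  proof (rule tends_unique[OF base tends_zero])
    show "eventually (\<lambda>N. g N (rep 0 N) = 0) F"
      using lin eventually_F[OF eventually_rep_zero[where 'a = 'a]]
      by eventually_elim (metis clinear_on_zero alg.subspace_carr)
  qed (rule form.S_zero)
  then show ?thesis
    unfolding clinear_on_def using *[of _ _ 1] *[OF form.S_zero] by (simp add: scaleC_one)
qed

text \<open>Pointwise convergence on fixed vectors is enough, because a convergent sequence is a finite
  combination of fixed vectors with convergent coefficients.\<close>

lemma tends_map:
  assumes lin: "eventually (\<lambda>N. clinear_on (carr (V N)) (g N)) F"
    and base: "\<And>a. a \<in> G \<Longrightarrow> tends (\<lambda>N. g N (rep a N)) (h a)"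
    and x: "tends x a"
  shows "tends (\<lambda>N. g N (x N)) (h a)"
  using x
proof (induction rule: seq_limit.induct)
  case (germ a)
  then show ?case by (rule base)
next
  case (lincomb x a y b c l)
  have "h (a + l *\<^sub>C b) = h a + l *\<^sub>C h b"
    using limit_map_linear[OF lin base] tends_G[OF lincomb.hyps(1)] tends_G[OF lincomb.hyps(2)]
    by (simp add: clinear_on_add clinear_on_scale form.S_scale)
  moreover have "tends (\<lambda>N. g N (x N) + c N *\<^sub>C g N (y N)) (h a + l *\<^sub>C h b)"
    by (intro seq_limit.lincomb lincomb)
  moreover have "eventually (\<lambda>N. g N (x N) + c N *\<^sub>C g N (y N) = g N (x N + c N *\<^sub>C y N)) F"
    using lin tends_in_carr[OF lincomb.hyps(1)] tends_in_carr[OF lincomb.hyps(2)]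
    by eventually_elim (simp add: clinear_on_add clinear_on_scale alg.carr_scale)
  ultimately show ?case by (simp only:) (rule seq_limit.cong)
next
  case (cong x a y)
  have "eventually (\<lambda>N. g N (x N) = g N (y N)) F" using cong.hyps(2) by eventually_elim simp
  then show ?case by (rule seq_limit.cong[OF cong.IH])
qed

subsection \<open>Convergence of the modes\<close>

lemma tends_basis_mode:
  assumes b: "b \<in> \<Phi>" and c: "c \<in> \<Phi>"
  shows "tends (\<lambda>N. mode (V N) (rep b N) n (rep c N)) (limit_basis_mode V f \<Phi> b n c)"
proof -
  let ?q = "wt V f b + wt V f c - n - 1"
  let ?B = "\<Phi> \<inter> dl_grade V f ?q"
  have "{a \<in> \<Phi>. wt V f a - wt V f b - wt V f c = - n - 1} = ?B"
    using wt_basis[of _ ?q] by auto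
  then have lim: "limit_basis_mode V f \<Phi> b n c = (\<Sum>a\<in>?B. limit_struct_const V f \<Phi> a b c *\<^sub>C a)"
    by (simp add: limit_basis_mode_def)
  have "tends (\<lambda>N. \<Sum>a\<in>?B. struct_const V f \<Phi> N a b c *\<^sub>C rep a N)
      (\<Sum>a\<in>?B. limit_struct_const V f \<Phi> a b c *\<^sub>C a)"
  proof (intro tends_sum tends_scale)
    fix a assume a: "a \<in> ?B"
    then show "tends (rep a) a" using basis_G by (intro seq_limit.germ) blast
    have "(\<lambda>N. struct_const V f \<Phi> N a b c) \<longlonglongrightarrow> limit_struct_const V f \<Phi> a b c"
      using converge a b c unfolding struct_const_converge_def limit_struct_const_def
      by (simp add: convergent_LIMSEQ_iff)
    then show "((\<lambda>N. struct_const V f \<Phi> N a b c) \<longlongrightarrow> limit_struct_const V f \<Phi> a b c) F"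
      by (rule tendsto_mono[OF F_le])
  qed
  moreover have "eventually (\<lambda>N. (\<Sum>a\<in>?B. struct_const V f \<Phi> N a b c *\<^sub>C rep a N)
      = mode (V N) (rep b N) n (rep c N)) F"
    using eventually_F[OF eventually_struct_const[OF b c, of n]] by eventually_elim (rule sym)
  ultimately show ?thesis unfolding lim by (rule seq_limit.cong)
qed

text \<open>Both sides are bilinear, and for two basis vectors this is the convergence of the structure
  constants.\<close>

lemma tends_mode_rep:
  assumes a: "a \<in> G" and b: "b \<in> G"
  shows "tends (\<lambda>N. mode (V N) (rep a N) n (rep b N)) (mode W a n b)"
proof -
  let ?S = "\<lambda>x. {e. crepresentation \<Phi> x e \<noteq> 0}"
  have S: "?S x \<subseteq> \<Phi>" for x using complex_vector.representation_ne_zero by blast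
  have SG: "e \<in> ?S x \<Longrightarrow> e \<in> G" for x e using S basis_G by blast
  have fin: "finite (?S x)" for x by (rule complex_vector.finite_representation)
  have expand: "(\<Sum>e\<in>?S x. crepresentation \<Phi> x e *\<^sub>C e) = x" if "x \<in> G" for x
    using that basis_span by (intro complex_vector.sum_nonzero_representation_eq basis_independent) simp
  have W: "mode W a n b = (\<Sum>e\<in>?S a. crepresentation \<Phi> a e *\<^sub>C
      (\<Sum>e'\<in>?S b. crepresentation \<Phi> b e' *\<^sub>C limit_basis_mode V f \<Phi> e n e'))"
    by (simp add: VA_limit_def complex_vector.scale_sum_right scaleC_scaleC)
  have "tends (\<lambda>N. \<Sum>e\<in>?S a. crepresentation \<Phi> a e *\<^sub>C
      (\<Sum>e'\<in>?S b. crepresentation \<Phi> b e' *\<^sub>C mode (V N) (rep e N) n (rep e' N))) (mode W a n b)"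
    unfolding W using S by (intro tends_sum tends_scale_const tends_basis_mode) blast+
  moreover have "eventually (\<lambda>N. (\<Sum>e\<in>?S a. crepresentation \<Phi> a e *\<^sub>C
      (\<Sum>e'\<in>?S b. crepresentation \<Phi> b e' *\<^sub>C mode (V N) (rep e N) n (rep e' N)))
      = mode (V N) (rep a N) n (rep b N)) F"
  proof (rule eventually_F)
    have "eventually (\<lambda>N. \<forall>e\<in>?S x. rep e N \<in> carr (V N)) sequentially" for x
      by (intro eventually_ball_finite fin ballI eventually_rep_carr SG)
    from this[of a] this[of b] eventually_rep_carr[OF b]
      eventually_rep_sum[of "crepresentation \<Phi> a" "\<lambda>e. e" "?S a"]
      eventually_rep_sum[of "crepresentation \<Phi> b" "\<lambda>e. e" "?S b"]
    show "eventually (\<lambda>N. (\<Sum>e\<in>?S a. crepresentation \<Phi> a e *\<^sub>C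
      (\<Sum>e'\<in>?S b. crepresentation \<Phi> b e' *\<^sub>C mode (V N) (rep e N) n (rep e' N)))
      = mode (V N) (rep a N) n (rep b N)) sequentially"
      unfolding expand[OF a] expand[OF b]
    proof eventually_elim
      case (elim N)
      have "mode (V N) (rep a N) n (rep b N)
          = (\<Sum>e\<in>?S a. crepresentation \<Phi> a e *\<^sub>C mode (V N) (rep e N) n (rep b N))"
        unfolding elim(4) using elim(1,3)
        by (intro clinear_on_lincomb[OF alg.subspace_carr alg.mode_linear_left]) auto
      also have "\<dots> = (\<Sum>e\<in>?S a. crepresentation \<Phi> a e *\<^sub>C
          (\<Sum>e'\<in>?S b. crepresentation \<Phi> b e' *\<^sub>C mode (V N) (rep e N) n (rep e' N)))"
      proof (rule sum.cong)
        fix e assume "e \<in> ?S a"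
        then have e: "rep e N \<in> carr (V N)" using elim(1) by blast
        show "crepresentation \<Phi> a e *\<^sub>C mode (V N) (rep e N) n (rep b N) = crepresentation \<Phi> a e *\<^sub>C
          (\<Sum>e'\<in>?S b. crepresentation \<Phi> b e' *\<^sub>C mode (V N) (rep e N) n (rep e' N))"
          unfolding elim(5) using elim(2)
          by (subst clinear_on_lincomb[OF alg.subspace_carr alg.mode_linear_right[OF e]]) auto
      qed simp
      finally show ?case by (rule sym)
    qed
  qed
  ultimately show ?thesis by (rule seq_limit.cong)
qed

lemma tends_mode:
  assumes x: "tends x a" and y: "tends y b"
  shows "tends (\<lambda>N. mode (V N) (x N) n (y N)) (mode W a n b)"
proof -
  have "eventually (\<lambda>N. clinear_on (carr (V N)) (mode (V N) (x N) n)) F"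
    using tends_in_carr[OF x] by eventually_elim (rule alg.mode_linear_right)
  then show ?thesis
  proof (rule tends_map[OF _ _ y])
    fix b assume b: "b \<in> G"
    have "eventually (\<lambda>N. clinear_on (carr (V N)) (\<lambda>u. mode (V N) u n (rep b N))) F"
      using eventually_F[OF eventually_rep_carr[OF b]] by eventually_elim (rule alg.mode_linear_left)
    then show "tends (\<lambda>N. mode (V N) (x N) n (rep b N)) (mode W a n b)"
      by (rule tends_map[where g = "\<lambda>N u. mode (V N) u n (rep b N)" and h = "\<lambda>a. mode W a n b",
            OF _ tends_mode_rep[OF _ b] x])
  qed
qed

end

section \<open>The limit algebra\<close>

abbreviation limits :: "(nat \<Rightarrow> 'a) \<Rightarrow> 'a germ \<Rightarrow> bool" where
  "limits \<equiv> seq_limit V f sequentially"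

lemmas limits_G = tends_G[OF order_refl sequentially_bot]
lemmas limits_in_carr = tends_in_carr[OF order_refl sequentially_bot]
lemmas limits_zero = tends_zero[OF order_refl sequentially_bot]
lemmas limits_scale = tends_scale[OF order_refl sequentially_bot]
lemmas limits_scale_const = tends_scale_const[OF order_refl sequentially_bot]
lemmas limits_add = tends_add[OF order_refl sequentially_bot]
lemmas limits_diff = tends_diff[OF order_refl sequentially_bot]
lemmas limits_sum = tends_sum[OF order_refl sequentially_bot]
lemmas limits_ip = tends_ip[OF order_refl sequentially_bot]
lemmas limits_unique = tends_unique[OF order_refl sequentially_bot]
lemmas limits_map = tends_map[OF order_refl sequentially_bot]
lemmas limits_map_linear = limit_map_linear[OF order_refl sequentially_bot]
lemmas limits_mode = tends_mode[OF order_refl sequentially_bot]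
lemmas limits_mode_rep = tends_mode_rep[OF order_refl sequentially_bot]

lemma limits_rep: "a \<in> G \<Longrightarrow> limits (rep a) a"
  by (rule seq_limit.germ)

lemma limits_vac: "limits (\<lambda>N. vac (V N)) (vac W)"
  using limits_rep[OF vac_W] eventually_rep_vac by (rule seq_limit.cong)

lemma limits_translation: "limits x a \<Longrightarrow> limits (\<lambda>N. translation (V N) (x N)) (translation W a)"
  unfolding translation_def by (intro limits_mode limits_vac)

lemma limits_L0: "limits x a \<Longrightarrow> limits (\<lambda>N. L0 (V N) (x N)) (L0 W a)"
proof (rule limits_map[where g = "\<lambda>N. L0 (V N)" and h = "L0 W"])
  show "eventually (\<lambda>N. clinear_on (carr (V N)) (L0 (V N))) sequentially" by (simp add: alg.L0_linear)
  fix a assume a: "a \<in> G"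
  then have "limits (rep (L0 W a)) (L0 W a)" using limit_space.L0_carr by (intro limits_rep) simp
  then show "limits (\<lambda>N. L0 (V N) (rep a N)) (L0 W a)"
    using eventually_rep_L0[OF a] by (rule seq_limit.cong)
qed

lemma limits_component: "limits x a \<Longrightarrow> limits (\<lambda>N. component (V N) (x N) n) (component W a n)"
proof (rule limits_map[where g = "\<lambda>N u. component (V N) u n" and h = "\<lambda>a. component W a n"])
  show "eventually (\<lambda>N. clinear_on (carr (V N)) (\<lambda>u. component (V N) u n)) sequentially"
    by (simp add: alg.component_linear)
  fix a assume a: "a \<in> G"
  then have "limits (rep (component W a n)) (component W a n)"
    using limit_space.component_carr by (intro limits_rep) simp
  then show "limits (\<lambda>N. component (V N) (rep a N) n) (component W a n)"
    using eventually_rep_component[OF a] by (rule seq_limit.cong)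
qed

lemma rep_eventually_eq_imp_eq:
  "a \<in> G \<Longrightarrow> b \<in> G \<Longrightarrow> eventually (\<lambda>N. rep a N = rep b N) sequentially \<Longrightarrow> a = b"
  using limits_unique[OF limits_rep limits_rep] .

lemma theta_lincomb:
  assumes "u \<in> carr (V N)" "v \<in> carr (V N)"
  shows "\<theta> N (u + c *\<^sub>C v) = \<theta> N u + cnj c *\<^sub>C \<theta> N v"
  using theta_antilinear[of N] assms alg.carr_scale[of v N c] unfolding antilinear_on_def by simp

lemma theta_inf_lincomb:
  assumes a: "a \<in> G" and b: "b \<in> G"
  shows "theta_inf (a + c *\<^sub>C b) = theta_inf a + cnj c *\<^sub>C theta_inf b"
proof (rule rep_eventually_eq_imp_eq)
  show "theta_inf (a + c *\<^sub>C b) \<in> G" "theta_inf a + cnj c *\<^sub>C theta_inf b \<in> G"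
    using a b by (auto intro!: theta_inf_carr form.S_add form.S_scale)
  show "eventually (\<lambda>N. rep (theta_inf (a + c *\<^sub>C b)) N = rep (theta_inf a + cnj c *\<^sub>C theta_inf b) N) sequentially"
    using eventually_rep_theta[of "a + c *\<^sub>C b"] eventually_rep_theta[of a] eventually_rep_theta[of b]
      eventually_rep_lincomb[of a c b] eventually_rep_lincomb[of "theta_inf a" "cnj c" "theta_inf b"]
      eventually_rep_carr[OF a] eventually_rep_carr[OF b]
    by eventually_elim (metis theta_lincomb)
qed

lemma limits_theta: "limits x a \<Longrightarrow> limits (\<lambda>N. \<theta> N (x N)) (theta_inf a)"
proof (induction rule: seq_limit.induct)
  case (germ a)
  show ?case
    using limits_rep[OF theta_inf_carr[OF germ]] eventually_rep_theta by (rule seq_limit.cong)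
next
  case (lincomb x a y b c l)
  have "limits (\<lambda>N. \<theta> N (x N) + cnj (c N) *\<^sub>C \<theta> N (y N)) (theta_inf a + cnj l *\<^sub>C theta_inf b)"
    using lincomb by (intro seq_limit.lincomb tendsto_cnj)
  moreover have "eventually (\<lambda>N. \<theta> N (x N) + cnj (c N) *\<^sub>C \<theta> N (y N) = \<theta> N (x N + c N *\<^sub>C y N)) sequentially"
    using limits_in_carr[OF lincomb.hyps(1)] limits_in_carr[OF lincomb.hyps(2)]
    by eventually_elim (rule theta_lincomb[symmetric])
  moreover have "theta_inf (a + l *\<^sub>C b) = theta_inf a + cnj l *\<^sub>C theta_inf b"
    by (intro theta_inf_lincomb limits_G[OF lincomb.hyps(1)] limits_G[OF lincomb.hyps(2)])
  ultimately show ?case by (simp only:) (rule seq_limit.cong)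
next
  case (cong x a y)
  have "eventually (\<lambda>N. \<theta> N (x N) = \<theta> N (y N)) sequentially" using cong.hyps(2) by eventually_elim simp
  then show ?case by (rule seq_limit.cong[OF cong.IH])
qed

subsection \<open>Truncation\<close>

lemma dl_grade_negative: "n < 0 \<Longrightarrow> dl_grade V f n = {0}"
  using alg.grade_negative clinear_on_zero[OF alg.subspace_carr dl_map_linear[OF system]]
  by (simp add: dl_grade_def)

text \<open>The weights occurring in \<open>rep a N\<close> are eventually those occurring in \<open>a\<close>.\<close>

lemma weights_bounded:
  assumes a: "a \<in> G"
  obtains p :: int where "p \<ge> 0"
    "eventually (\<lambda>N. rep a N \<in> carr (V N) \<and>
       (\<forall>n. n < 0 \<or> n > p \<longrightarrow> component (V N) (rep a N) n = 0)) sequentially"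
proof -
  let ?S = "{n. component W a n \<noteq> 0}"
  have aW: "a \<in> carr W" using a by simp
  have S: "finite ?S" using limit_space.component_finite[OF aW] .
  define p where "p = Max (insert 0 ?S)"
  have "n \<notin> ?S" if "n > p" for n using that S by (auto simp: p_def)
  moreover have "eventually (\<lambda>N. (\<forall>n\<in>?S. dl_map f N (rep (component W a n) N) = component W a n) \<and>
      component (V N) (rep a N) = (\<lambda>n. if n \<in> ?S then rep (component W a n) N else 0)) sequentially"
    by (rule eventually_decomposition[OF a limit_space.component_decomposition[OF aW] S]) simp
  then have "eventually (\<lambda>N. rep a N \<in> carr (V N) \<and>
       (\<forall>n. n < 0 \<or> n > p \<longrightarrow> component (V N) (rep a N) n = 0)) sequentially"
    using eventually_rep_carr[OF a]
  proof eventually_elim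
    case (elim N)
    have "component (V N) (rep a N) n = 0" if "n > p" for n
    proof -
      have "component (V N) (rep a N) n = (if n \<in> ?S then rep (component W a n) N else 0)"
        using conjunct2[OF elim(1)] by (rule fun_cong)
      then show ?thesis using \<open>\<And>n. n > p \<Longrightarrow> n \<notin> ?S\<close>[OF that] by (simp only: if_False)
    qed
    then show ?case using alg.component_negative elim(2) by blast
  qed
  moreover have "p \<ge> 0" using S by (simp add: p_def)
  ultimately show ?thesis using that by blast
qed

lemma mode_truncated:
  assumes a: "a \<in> G" and b: "b \<in> G"
  obtains K where "\<And>n. n \<ge> K \<Longrightarrow> mode W a n b = 0"
    "eventually (\<lambda>N. \<forall>n\<ge>K. mode (V N) (rep a N) n (rep b N) = 0) sequentially"
proof -
  obtain p where p: "eventually (\<lambda>N. rep a N \<in> carr (V N) \<and>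
      (\<forall>n. n < 0 \<or> n > p \<longrightarrow> component (V N) (rep a N) n = 0)) sequentially"
    using weights_bounded[OF a] by blast
  obtain q where q: "eventually (\<lambda>N. rep b N \<in> carr (V N) \<and>
      (\<forall>n. n < 0 \<or> n > q \<longrightarrow> component (V N) (rep b N) n = 0)) sequentially"
    using weights_bounded[OF b] by blast
  have ev: "eventually (\<lambda>N. \<forall>n\<ge>p + q. mode (V N) (rep a N) n (rep b N) = 0) sequentially"
    using p q
  proof eventually_elim
    case (elim N)
    show ?case
      by (intro allI impI alg.mode_eq_zero[of _ _ p _ q]) (use elim in blast)+
  qed
  have "mode W a n b = 0" if n: "n \<ge> p + q" for n
  proof (rule limits_unique[OF limits_mode_rep[OF a b] limits_zero])
    show "eventually (\<lambda>N. mode (V N) (rep a N) n (rep b N) = 0) sequentially"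
      using ev by eventually_elim (use n in blast)
  qed
  then show ?thesis using ev that by blast
qed

subsection \<open>The vertex algebra structure\<close>

lemma mode_W_G: "a \<in> G \<Longrightarrow> b \<in> G \<Longrightarrow> mode W a n b \<in> G"
  by (rule limits_G[OF limits_mode_rep])

lemma mode_W_linear_right: "a \<in> G \<Longrightarrow> clinear_on G (mode W a n)"
proof (rule limits_map_linear)
  assume a: "a \<in> G"
  show "eventually (\<lambda>N. clinear_on (carr (V N)) (mode (V N) (rep a N) n)) sequentially"
    using eventually_rep_carr[OF a] by eventually_elim (rule alg.mode_linear_right)
  show "limits (\<lambda>N. mode (V N) (rep a N) n (rep b N)) (mode W a n b)" if "b \<in> G" for b
    using a that by (rule limits_mode_rep)
qed

lemma mode_W_linear_left: "b \<in> G \<Longrightarrow> clinear_on G (\<lambda>a. mode W a n b)"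
proof (rule limits_map_linear)
  assume b: "b \<in> G"
  show "eventually (\<lambda>N. clinear_on (carr (V N)) (\<lambda>a. mode (V N) a n (rep b N))) sequentially"
    using eventually_rep_carr[OF b] by eventually_elim (rule alg.mode_linear_left)
  show "limits (\<lambda>N. mode (V N) (rep a N) n (rep b N)) (mode W a n b)" if "a \<in> G" for a
    using that b by (rule limits_mode_rep)
qed

lemma mode_W_zero_left: "b \<in> G \<Longrightarrow> mode W 0 n b = 0"
  by (rule clinear_on_zero[OF subspace_G mode_W_linear_left])

lemma mode_W_zero_right: "a \<in> G \<Longrightarrow> mode W a n 0 = 0"
  by (rule clinear_on_zero[OF subspace_G mode_W_linear_right])

text \<open>Beyond a bound \<open>J\<close> on \<open>j\<close>, the products \<open>a\<^sub>n\<^sub>+\<^sub>j b\<close>, \<open>b\<^sub>k\<^sub>+\<^sub>j c\<close> and \<open>a\<^sub>m\<^sub>+\<^sub>j c\<close> vanish in the limit and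
  in all \<open>V N\<close> with \<open>N\<close> large; what is left is an identity between finite sums.\<close>

lemma borcherds_W:
  assumes a: "a \<in> G" and b: "b \<in> G" and c: "c \<in> G"
  shows "borcherds_identity W a b c k m n"
proof -
  obtain K1 where K1: "\<And>n. n \<ge> K1 \<Longrightarrow> mode W a n b = 0"
    "eventually (\<lambda>N. \<forall>n\<ge>K1. mode (V N) (rep a N) n (rep b N) = 0) sequentially"
    using mode_truncated[OF a b] by blast
  obtain K2 where K2: "\<And>n. n \<ge> K2 \<Longrightarrow> mode W b n c = 0"
    "eventually (\<lambda>N. \<forall>n\<ge>K2. mode (V N) (rep b N) n (rep c N) = 0) sequentially"
    using mode_truncated[OF b c] by blast
  obtain K3 where K3: "\<And>n. n \<ge> K3 \<Longrightarrow> mode W a n c = 0"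
    "eventually (\<lambda>N. \<forall>n\<ge>K3. mode (V N) (rep a N) n (rep c N) = 0) sequentially"
    using mode_truncated[OF a c] by blast
  define J where "J = nat (max (K1 - n) (max (K2 - k) (K3 - m)))"
  have J: "n + int j \<ge> K1" "k + int j \<ge> K2" "m + int j \<ge> K3" if "j \<ge> J" for j
    using that by (auto simp: J_def)
  let ?P = "\<lambda>U x y z j. (of_int m gchoose j) *\<^sub>C mode U (mode U x (n + int j) y) (m + k - int j) z"
  let ?Q = "\<lambda>U x y z j. ((-1) ^ j * (of_int n gchoose j)) *\<^sub>C
      mode U x (m + n - int j) (mode U y (k + int j) z)"
  let ?R = "\<lambda>U x y z j. ((-1) powi (int j + n) * (of_int n gchoose j)) *\<^sub>C
      mode U y (n + k - int j) (mode U x (m + int j) z)"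
  have WP: "Sum_any (?P W a b c) = (\<Sum>j<J. ?P W a b c j)"
    by (rule Sum_any_truncated)
      (simp add: K1(1)[OF J(1)] mode_W_zero_left[OF c])
  have WQ: "Sum_any (?Q W a b c) = (\<Sum>j<J. ?Q W a b c j)"
    by (rule Sum_any_truncated)
      (simp add: K2(1)[OF J(2)] mode_W_zero_right[OF a])
  have WR: "Sum_any (?R W a b c) = (\<Sum>j<J. ?R W a b c j)"
    by (rule Sum_any_truncated)
      (simp add: K3(1)[OF J(3)] mode_W_zero_right[OF b])
  have "(\<Sum>j<J. ?P W a b c j) = (\<Sum>j<J. ?Q W a b c j) - (\<Sum>j<J. ?R W a b c j)"
  proof (rule limits_unique)
    show "limits (\<lambda>N. \<Sum>j<J. ?P (V N) (rep a N) (rep b N) (rep c N) j) (\<Sum>j<J. ?P W a b c j)"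
      using a b c by (intro limits_sum limits_scale_const limits_mode limits_rep)
    show "limits (\<lambda>N. (\<Sum>j<J. ?Q (V N) (rep a N) (rep b N) (rep c N) j)
        - (\<Sum>j<J. ?R (V N) (rep a N) (rep b N) (rep c N) j))
      ((\<Sum>j<J. ?Q W a b c j) - (\<Sum>j<J. ?R W a b c j))"
      using a b c by (intro limits_diff limits_sum limits_scale_const limits_mode limits_rep)
    show "eventually (\<lambda>N. (\<Sum>j<J. ?P (V N) (rep a N) (rep b N) (rep c N) j)
        = (\<Sum>j<J. ?Q (V N) (rep a N) (rep b N) (rep c N) j)
          - (\<Sum>j<J. ?R (V N) (rep a N) (rep b N) (rep c N) j)) sequentially"
      using K1(2) K2(2) K3(2) eventually_rep_carr[OF a] eventually_rep_carr[OF b] eventually_rep_carr[OF c]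
    proof eventually_elim
      case (elim N)
      let ?a = "rep a N" and ?b = "rep b N" and ?c = "rep c N"
      have P: "Sum_any (?P (V N) ?a ?b ?c) = (\<Sum>j<J. ?P (V N) ?a ?b ?c j)"
        by (rule Sum_any_truncated)
          (simp add: elim(1)[rule_format, OF J(1)] alg.mode_zero_left[OF elim(6)])
      have Q: "Sum_any (?Q (V N) ?a ?b ?c) = (\<Sum>j<J. ?Q (V N) ?a ?b ?c j)"
        by (rule Sum_any_truncated)
          (simp add: elim(2)[rule_format, OF J(2)] alg.mode_zero_right[OF elim(4)])
      have R: "Sum_any (?R (V N) ?a ?b ?c) = (\<Sum>j<J. ?R (V N) ?a ?b ?c j)"
        by (rule Sum_any_truncated)
          (simp add: elim(3)[rule_format, OF J(3)] alg.mode_zero_right[OF elim(5)])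
      show ?case
        using alg.borcherds[OF elim(4,5,6), of k m n] unfolding borcherds_identity_def P Q R .
    qed
  qed
  then show ?thesis unfolding borcherds_identity_def WP WQ WR .
qed

lemma vertex_algebra_W: "vertex_algebra W"
  unfolding vertex_algebra_def carr_W
proof (intro conjI ballI allI)
  show "csubspace G" by (rule subspace_G)
  show "vac W \<in> G" by (rule vac_W)
  show "vac W \<noteq> 0"
  proof
    assume "vac W = 0"
    have "eventually (\<lambda>N. False) sequentially"
      using eventually_rep_vac eventually_rep_zero[where 'a = 'a] unfolding \<open>vac W = 0\<close>
      by eventually_elim (use alg.vac_nonzero in metis)
    then show False by simp
  qed
next
  fix a n b assume "a \<in> G" "b \<in> G"
  then show "mode W a n b \<in> G" by (rule mode_W_G)
next
  fix a n assume "a \<in> G" then show "clinear_on G (mode W a n)" by (rule mode_W_linear_right)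
next
  fix n b assume "b \<in> G" then show "clinear_on G (\<lambda>a. mode W a n b)" by (rule mode_W_linear_left)
next
  fix a b assume "a \<in> G" "b \<in> G"
  then show "\<exists>K. \<forall>n\<ge>K. mode W a n b = 0" using mode_truncated by metis
next
  fix a assume a: "a \<in> G"
  show "mode W a (-1) (vac W) = a"
    by (rule limits_unique[OF limits_mode[OF limits_rep[OF a] limits_vac] limits_rep[OF a]],
        rule eventually_mono[OF eventually_rep_carr[OF a]]) (rule alg.mode_vac_right)
  fix n :: int
  show "0 \<le> n \<longrightarrow> mode W a n (vac W) = 0"
  proof
    assume "n \<ge> 0"
    then show "mode W a n (vac W) = 0"
      by (rule_tac limits_unique[OF limits_mode[OF limits_rep[OF a] limits_vac] limits_zero],
          rule_tac eventually_mono[OF eventually_rep_carr[OF a]]) (rule alg.mode_vac_right(2))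
  qed
next
  fix b and n :: int assume b: "b \<in> G"
  have "limits (\<lambda>N. if n = -1 then rep b N else 0) (if n = -1 then b else 0)"
    using b by (auto intro: limits_rep limits_zero)
  moreover have "eventually (\<lambda>N. mode (V N) (vac (V N)) n (rep b N) = (if n = -1 then rep b N else 0)) sequentially"
    using eventually_rep_carr[OF b] by eventually_elim (rule alg.mode_vac_left)
  ultimately show "mode W (vac W) n b = (if n = -1 then b else 0)"
    by (rule limits_unique[OF limits_mode[OF limits_vac limits_rep[OF b]]])
next
  fix a b c k m n assume "a \<in> G" "b \<in> G" "c \<in> G"
  then show "borcherds_identity W a b c k m n" by (rule borcherds_W)
qed

lemma L0_commutator_W:
  assumes a: "a \<in> G" and u: "u \<in> G"
  shows "L0 W (mode W a n u) - mode W a n (L0 W u)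
       = of_int (- n - 1) *\<^sub>C mode W a n u + mode W (L0 W a) n u"
  by (rule limits_unique[OF
      limits_diff[OF limits_L0[OF limits_mode[OF limits_rep[OF a] limits_rep[OF u]]]
        limits_mode[OF limits_rep[OF a] limits_L0[OF limits_rep[OF u]]]]
      limits_add[OF limits_scale_const[OF limits_mode[OF limits_rep[OF a] limits_rep[OF u]]]
        limits_mode[OF limits_L0[OF limits_rep[OF a]] limits_rep[OF u]]]],
      use eventually_rep_carr[OF a] eventually_rep_carr[OF u] in eventually_elim)
    (rule alg.L0_commutator)

lemma grading_restricted_W: "grading_restricted W"
  unfolding grading_restricted_def carr_W grade_W
proof (intro conjI ballI allI)
  show "vertex_algebra W" by (rule vertex_algebra_W)
  show "csubspace (dl_grade V f n)" "dl_grade V f n \<subseteq> G" for n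
    by (rule subspace_dl_grade, rule dl_grade_subset)
  show "\<exists>!x. homogeneous_decomposition W v x" if "v \<in> G" for v
    using limit_space.unique_decomposition[of v] that by simp
  show "\<exists>n0. \<forall>n<n0. dl_grade V f n = {0}" using dl_grade_negative by blast
  show "\<exists>B. finite B \<and> cspan B = dl_grade V f n" for n using onb finite_onb by blast
  show "L0 W (mode W v n u) - mode W v n (L0 W u)
       = of_int (- n - 1) *\<^sub>C mode W v n u + mode W (L0 W v) n u"
    if "v \<in> G" "u \<in> G" for v u and n :: int using that by (rule L0_commutator_W)
qed

lemma cft_type_W: "cft_type W"
  unfolding cft_type_def grade_W
proof (intro conjI allI impI)
  have vac: "dl_map f N (vac (V N)) = vac W" for N
    using dl_map_connecting[OF system, of 0 N "vac (V 0)"] alg.vac_carr[of 0] f_vac[of 0 N]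
    by (simp add: VA_limit_def)
  have "dl_map f N (c *\<^sub>C vac (V N)) = c *\<^sub>C vac W" for N c
    using clinear_on_scale[OF dl_map_linear[OF system] alg.vac_carr] vac by simp
  then show "dl_grade V f 0 = cspan {vac W}"
    by (auto simp: dl_grade_def alg.grade_zero complex_vector.span_singleton image_image)
qed (rule dl_grade_negative)

subsection \<open>The operator \<open>L(1)\<close> of the limit\<close>

text \<open>In an orthonormal basis of the space of weight \<open>p - 1\<close>, the coordinates of \<open>L(1)u\<close> are the inner
  products \<open>(L(1)u, e) = (u, L(-1)e)\<close>, which converge.\<close>

lemma L1_converges_homogeneous:
  assumes u: "u \<in> dl_grade V f p"
  shows "\<exists>a. limits (\<lambda>N. mode (V N) (\<omega> N) 2 (rep u N)) a"
proof -
  let ?E = "onb (p - 1)"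
  have uG: "u \<in> G" using u dl_grade_subset by blast
  have lim: "limits (\<lambda>N. \<Sum>e\<in>?E. ip N (rep u N) (translation (V N) (rep e N)) *\<^sub>C rep e N)
      (\<Sum>e\<in>?E. ip_inf u (translation W e) *\<^sub>C e)"
    by (intro limits_sum limits_scale limits_ip limits_translation limits_rep uG onb_G)
  have ev: "eventually (\<lambda>N. (\<Sum>e\<in>?E. ip N (rep u N) (translation (V N) (rep e N)) *\<^sub>C rep e N)
      = mode (V N) (\<omega> N) 2 (rep u N)) sequentially"
  proof -
    have "eventually (\<lambda>N. \<forall>e\<in>?E. rep e N \<in> carr (V N)) sequentially"
      by (intro eventually_ball_finite ballI eventually_rep_carr finite_onb onb_G)
    then show ?thesis
      using eventually_rep_grade[OF u] eventually_onb_expansion[of "p - 1"]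
    proof eventually_elim
      case (elim N)
      have "mode (V N) (\<omega> N) 2 (rep u N)
          = (\<Sum>e\<in>?E. ip N (mode (V N) (\<omega> N) 2 (rep u N)) (rep e N) *\<^sub>C rep e N)"
        using elim(3) alg.L1_grade[OF elim(2)] by blast
      also have "\<dots> = (\<Sum>e\<in>?E. ip N (rep u N) (translation (V N) (rep e N)) *\<^sub>C rep e N)"
        using elim(1) alg.grade_carr[OF elim(2)] by (intro sum.cong) (simp_all add: alg.L1_adjoint)
      finally show ?case by (rule sym)
    qed
  qed
  show ?thesis using seq_limit.cong[OF lim ev] by (rule exI)
qed

lemma L1_converges:
  assumes u: "u \<in> G"
  shows "\<exists>a. limits (\<lambda>N. mode (V N) (\<omega> N) 2 (rep u N)) a"
proof -
  have uW: "u \<in> carr W" using u by simp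
  let ?S = "{n. component W u n \<noteq> 0}" and ?c = "component W u"
  have "\<exists>a. limits (\<lambda>N. mode (V N) (\<omega> N) 2 (rep (?c n) N)) a" for n
    using limit_space.component_grade[OF uW, of n] by (intro L1_converges_homogeneous) simp
  then obtain a where a: "\<And>n. limits (\<lambda>N. mode (V N) (\<omega> N) 2 (rep (?c n) N)) (a n)" by metis
  have cG: "?c n \<in> G" for n using limit_space.component_carr[OF uW] by simp
  have lim: "limits (\<lambda>N. \<Sum>n\<in>?S. mode (V N) (\<omega> N) 2 (rep (?c n) N)) (\<Sum>n\<in>?S. a n)"
    by (intro limits_sum a)
  have "eventually (\<lambda>N. \<forall>n\<in>?S. rep (?c n) N \<in> carr (V N)) sequentially"
    using limit_space.component_finite[OF uW] by (intro eventually_ball_finite ballI eventually_rep_carr cG)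
  then have ev: "eventually (\<lambda>N. (\<Sum>n\<in>?S. mode (V N) (\<omega> N) 2 (rep (?c n) N))
      = mode (V N) (\<omega> N) 2 (rep u N)) sequentially"
    using eventually_rep_sum[of "\<lambda>_. 1" ?c ?S]
  proof eventually_elim
    case (elim N)
    have "rep u N = (\<Sum>n\<in>?S. rep (?c n) N)"
      using elim(2) limit_space.component_sum[OF uW limit_space.component_finite[OF uW]]
      by (simp add: scaleC_one)
    then show ?case
      using clinear_on_sum[OF alg.subspace_carr alg.L1_linear, of ?S "\<lambda>n. rep (?c n) N"] elim(1) by simp
  qed
  show ?thesis using seq_limit.cong[OF lim ev] by (rule exI)
qed

definition L1_inf :: "'a germ \<Rightarrow> 'a germ" where
  "L1_inf u = (SOME a. limits (\<lambda>N. mode (V N) (\<omega> N) 2 (rep u N)) a)"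

lemma limits_L1: "limits x a \<Longrightarrow> limits (\<lambda>N. mode (V N) (\<omega> N) 2 (x N)) (L1_inf a)"
  and L1_inf_linear: "clinear_on G L1_inf"
proof -
  have lin: "eventually (\<lambda>N. clinear_on (carr (V N)) (mode (V N) (\<omega> N) 2)) sequentially"
    by (simp add: alg.L1_linear)
  have base: "limits (\<lambda>N. mode (V N) (\<omega> N) 2 (rep u N)) (L1_inf u)" if "u \<in> G" for u
    unfolding L1_inf_def by (rule someI_ex[OF L1_converges[OF that]])
  show "limits x a \<Longrightarrow> limits (\<lambda>N. mode (V N) (\<omega> N) 2 (x N)) (L1_inf a)"
    by (rule limits_map[OF lin base])
  show "clinear_on G L1_inf" by (rule limits_map_linear[OF lin base])
qed

lemma L1_inf_G: "a \<in> G \<Longrightarrow> L1_inf a \<in> G"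
  by (rule limits_G[OF limits_L1[OF limits_rep]])

lemma limits_L1_power:
  "limits x a \<Longrightarrow> limits (\<lambda>N. (mode (V N) (\<omega> N) 2 ^^ j) (x N)) ((L1_inf ^^ j) a)"
  by (induction j) (auto intro: limits_L1)

lemma moebius_W: "moebius W L1_inf"
  unfolding moebius_def carr_W
proof (intro conjI ballI allI)
  show "L1_inf ` G \<subseteq> G" using L1_inf_G by blast
  show "clinear_on G L1_inf" by (rule L1_inf_linear)
next
  fix v assume v: "v \<in> G"
  note r = limits_rep[OF v] and ev = eventually_rep_carr[OF v]
  show "L1_inf (translation W v) - translation W (L1_inf v) = 2 *\<^sub>C L0 W v"
    by (rule limits_unique[OF limits_diff[OF limits_L1[OF limits_translation[OF r]]
            limits_translation[OF limits_L1[OF r]]] limits_scale_const[OF limits_L0[OF r]]],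
        rule eventually_mono[OF ev])
      (use alg.moebius in \<open>simp add: moebius_def\<close>)
  show "L1_inf (L0 W v) - L0 W (L1_inf v) = L1_inf v"
    by (rule limits_unique[OF limits_diff[OF limits_L1[OF limits_L0[OF r]]
            limits_L0[OF limits_L1[OF r]]] limits_L1[OF r]],
        rule eventually_mono[OF ev])
      (use alg.moebius in \<open>simp add: moebius_def\<close>)
  show "L0 W (translation W v) - translation W (L0 W v) = translation W v"
    by (rule limits_unique[OF limits_diff[OF limits_L0[OF limits_translation[OF r]]
            limits_translation[OF limits_L0[OF r]]] limits_translation[OF r]],
        rule eventually_mono[OF ev])
      (use alg.moebius in \<open>simp add: moebius_def\<close>)
next
  have m: "translation (V N) (vac (V N)) = 0" "L0 (V N) (vac (V N)) = 0"
    "mode (V N) (\<omega> N) 2 (vac (V N)) = 0" for N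
    using alg.moebius[of N] by (simp_all add: moebius_def)
  show "translation W (vac W) = 0"
    by (rule limits_unique[OF limits_translation[OF limits_vac] limits_zero]) (simp add: m)
  show "L0 W (vac W) = 0"
    by (rule limits_unique[OF limits_L0[OF limits_vac] limits_zero]) (simp add: m)
  show "L1_inf (vac W) = 0"
    by (rule limits_unique[OF limits_L1[OF limits_vac] limits_zero]) (simp add: m)
next
  fix a v n assume a: "a \<in> G" and v: "v \<in> G"
  note ra = limits_rep[OF a] and rv = limits_rep[OF v]
  note rav = limits_mode[OF ra rv]
  have m: "eventually (\<lambda>N. translation (V N) (mode (V N) (rep a N) n (rep v N))
          - mode (V N) (rep a N) n (translation (V N) (rep v N))
        = of_int (- n) *\<^sub>C mode (V N) (rep a N) (n - 1) (rep v N)) sequentially"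
    "eventually (\<lambda>N. mode (V N) (\<omega> N) 2 (mode (V N) (rep a N) n (rep v N))
          - mode (V N) (rep a N) n (mode (V N) (\<omega> N) 2 (rep v N))
        = of_int (- n - 2) *\<^sub>C mode (V N) (rep a N) (n + 1) (rep v N)
          + 2 *\<^sub>C mode (V N) (L0 (V N) (rep a N)) (n + 1) (rep v N)
          + mode (V N) (mode (V N) (\<omega> N) 2 (rep a N)) n (rep v N)) sequentially"
    using eventually_rep_carr[OF a] eventually_rep_carr[OF v]
    by (eventually_elim, use alg.moebius in \<open>unfold moebius_def\<close>, blast)+
  show "translation W (mode W a n v) - mode W a n (translation W v) = of_int (- n) *\<^sub>C mode W a (n - 1) v"
    using m(1) by (rule limits_unique[OF limits_diff[OF limits_translation[OF rav]
          limits_mode[OF ra limits_translation[OF rv]]] limits_scale_const[OF rav]])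
  show "L0 W (mode W a n v) - mode W a n (L0 W v)
          = of_int (- n - 1) *\<^sub>C mode W a n v + mode W (L0 W a) n v"
    using a v by (rule L0_commutator_W)
  show "L1_inf (mode W a n v) - mode W a n (L1_inf v)
          = of_int (- n - 2) *\<^sub>C mode W a (n + 1) v + 2 *\<^sub>C mode W (L0 W a) (n + 1) v
            + mode W (L1_inf a) n v"
    using m(2) by (rule limits_unique[OF limits_diff[OF limits_L1[OF rav]
          limits_mode[OF ra limits_L1[OF rv]]]
          limits_add[OF limits_add[OF limits_scale_const[OF rav]
              limits_scale_const[OF limits_mode[OF limits_L0[OF ra] rv]]]
            limits_mode[OF limits_L1[OF ra] rv]]])
qed

subsection \<open>Unitarity of the limit\<close>

lemma automorphism_W: "antilinear_involutive_automorphism W L1_inf theta_inf"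
  unfolding antilinear_involutive_automorphism_def carr_W grade_W
proof (intro conjI ballI allI)
  show "theta_inf ` G \<subseteq> G" using theta_inf_carr by blast
  have 0: "theta_inf 0 = 0"
    using theta_inf_lincomb[OF form.S_zero form.S_zero, of "-1"] by (simp add: scaleC_one)
  show "antilinear_on G theta_inf"
    unfolding antilinear_on_def
    using theta_inf_lincomb[of _ _ 1] theta_inf_lincomb[OF form.S_zero] 0 by (simp add: scaleC_one)
  show "theta_inf (vac W) = vac W"
    by (rule limits_unique[OF limits_theta[OF limits_vac] limits_vac]) (simp add: theta_vac)
  show "theta_inf ` dl_grade V f n \<subseteq> dl_grade V f n" for n using theta_inf_grade by blast
next
  fix v assume v: "v \<in> G"
  show "theta_inf (theta_inf v) = v"
    by (rule limits_unique[OF limits_theta[OF limits_theta[OF limits_rep[OF v]]] limits_rep[OF v]],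
        rule eventually_mono[OF eventually_rep_carr[OF v]]) (rule theta_theta)
  show "theta_inf (L1_inf v) = L1_inf (theta_inf v)"
    by (rule limits_unique[OF limits_theta[OF limits_L1[OF limits_rep[OF v]]]
          limits_L1[OF limits_theta[OF limits_rep[OF v]]]],
        rule eventually_mono[OF eventually_rep_carr[OF v]]) (rule theta_L1)
next
  fix a n b assume a: "a \<in> G" and b: "b \<in> G"
  show "theta_inf (mode W a n b) = mode W (theta_inf a) n (theta_inf b)"
    by (rule limits_unique[OF limits_theta[OF limits_mode[OF limits_rep[OF a] limits_rep[OF b]]]
          limits_mode[OF limits_theta[OF limits_rep[OF a]] limits_theta[OF limits_rep[OF b]]]],
        use eventually_rep_carr[OF a] eventually_rep_carr[OF b] in eventually_elim) (rule theta_mode)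
qed

text \<open>For large \<open>N\<close> all components of \<open>a\<close> have weights \<open>h\<close> between \<open>0\<close> and \<open>p\<close>, and \<open>L(1)\<^sup>j\<close> kills them
  for \<open>j > p\<close>; so the sum over \<open>h\<close> and \<open>j\<close> runs over a finite set independent of \<open>N\<close>.\<close>

lemma invariant_form_W: "invariant_form W L1_inf theta_inf ip_inf"
  unfolding invariant_form_def carr_W
proof (intro ballI allI)
  fix a u v m assume a: "a \<in> G" and u: "u \<in> G" and v: "v \<in> G"
  obtain p where p: "p \<ge> 0" "eventually (\<lambda>N. rep a N \<in> carr (V N) \<and>
      (\<forall>n. n < 0 \<or> n > p \<longrightarrow> component (V N) (rep a N) n = 0)) sequentially"
    using weights_bounded[OF a] by blast
  let ?I = "{0..p} \<times> {..nat p}"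
  let ?x = "\<lambda>N h j. (mode (V N) (\<omega> N) 2 ^^ j) (component (V N) (rep a N) h)"
  let ?y = "\<lambda>h j. (L1_inf ^^ j) (component W a h)"
  let ?X = "\<lambda>N (h, j). ((-1) powi h / fact j) *\<^sub>C mode (V N) (?x N h j) (2 * h - int j - m - 2) (rep u N)"
  let ?Y = "\<lambda>(h, j). ((-1) powi h / fact j) *\<^sub>C mode W (?y h j) (2 * h - int j - m - 2) u"
  have lim: "limits (\<lambda>N. ?x N h j) (?y h j)" for h j
    by (intro limits_L1_power limits_component limits_rep a)
  have zero: "eventually (\<lambda>N. \<forall>h j. (h, j) \<notin> ?I \<longrightarrow> ?x N h j = 0) sequentially"
    using p(2)
  proof eventually_elim
    case (elim N)
    show ?case
    proof (intro allI impI)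
      fix h j assume hj: "(h, j) \<notin> ?I"
      show "?x N h j = 0"
      proof (cases "h < 0 \<or> h > p")
        case True
        then show ?thesis using elim alg.L1_power_zero by metis
      next
        case False
        then have "h - int j < 0" using hj p(1) by (auto simp: not_le)
        then show ?thesis
          using alg.L1_power_grade[OF alg.component_grade[OF conjunct1[OF elim], of h], of j]
            alg.grade_negative[of "h - int j" N] by simp
      qed
    qed
  qed
  have zeroW: "?y h j = 0" if "(h, j) \<notin> ?I" for h j
    by (rule limits_unique[OF lim limits_zero], rule eventually_mono[OF zero]) (use that in blast)
  have sumW: "Sum_any ?Y = (\<Sum>i\<in>?I. ?Y i)"
  proof (rule Sum_any.expand_superset)
    show "{i. ?Y i \<noteq> 0} \<subseteq> ?I"
    proof (rule subsetI, rule ccontr)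
      fix i assume i: "i \<in> {i. ?Y i \<noteq> 0}" "i \<notin> ?I"
      obtain h j where hj: "i = (h, j)" by (cases i)
      then have "?y h j = 0" using zeroW i(2) by blast
      then show False using i(1) hj mode_W_zero_left[OF u] by simp
    qed
  qed simp
  have "limits (\<lambda>N. \<Sum>i\<in>?I. ?X N i) (\<Sum>i\<in>?I. ?Y i)"
  proof (rule limits_sum)
    fix i :: "int \<times> nat"
    obtain h j where i: "i = (h, j)" by (cases i)
    show "limits (\<lambda>N. ?X N i) (?Y i)"
      unfolding i prod.case by (intro limits_scale_const limits_mode lim limits_rep u)
  qed
  then have l1: "(\<lambda>N. ip N (\<Sum>i\<in>?I. ?X N i) (rep v N)) \<longlonglongrightarrow> ip_inf (\<Sum>i\<in>?I. ?Y i) v"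
    by (rule limits_ip[OF _ limits_rep[OF v]])
  have l2: "(\<lambda>N. ip N (rep u N) (mode (V N) (\<theta> N (rep a N)) m (rep v N)))
      \<longlonglongrightarrow> ip_inf u (mode W (theta_inf a) m v)"
    by (intro limits_ip limits_mode limits_theta limits_rep a u v)
  have "eventually (\<lambda>N. ip N (\<Sum>i\<in>?I. ?X N i) (rep v N)
      = ip N (rep u N) (mode (V N) (\<theta> N (rep a N)) m (rep v N))) sequentially"
    using zero eventually_rep_carr[OF a] eventually_rep_carr[OF u] eventually_rep_carr[OF v]
  proof eventually_elim
    case (elim N)
    have "Sum_any (?X N) = (\<Sum>i\<in>?I. ?X N i)"
    proof (rule Sum_any.expand_superset)
      show "{i. ?X N i \<noteq> 0} \<subseteq> ?I"
      proof (rule subsetI, rule ccontr)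
        fix i assume i: "i \<in> {i. ?X N i \<noteq> 0}" "i \<notin> ?I"
        obtain h j where hj: "i = (h, j)" by (cases i)
        then have "?x N h j = 0" using elim(1) i(2) by blast
        then show False using i(1) hj alg.mode_zero_left[OF elim(3)] by simp
      qed
    qed simp
    moreover have "ip N (Sum_any (?X N)) (rep v N)
        = ip N (rep u N) (mode (V N) (\<theta> N (rep a N)) m (rep v N))"
      using alg.invariant[of N] elim(2-4) unfolding invariant_form_def by blast
    ultimately show ?case by simp
  qed
  then have "(\<lambda>N. ip N (\<Sum>i\<in>?I. ?X N i) (rep v N)) \<longlonglongrightarrow> ip_inf u (mode W (theta_inf a) m v)"
    using l2 by (simp add: tendsto_cong)
  then show "ip_inf (Sum_any ?Y) v = ip_inf u (mode W (theta_inf a) m v)"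
    unfolding sumW by (rule LIMSEQ_unique[OF l1])
qed

lemma unitary_moebius_W: "unitary_moebius W"
  unfolding unitary_moebius_def unitary_structure_def
  using moebius_W automorphism_W invariant_form_W form.pdh by auto

end

section \<open>Uniqueness of the limit\<close>

text \<open>Vectors of the two direct limits have representatives in the same spaces \<open>V N\<close>, where they can be
  compared.\<close>

locale system_pair =
  A: convergent_unitary_system V \<omega> \<theta> ip f \<Phi> + B: convergent_unitary_system V \<omega> \<theta> ip f' \<Phi>'
  for V :: "nat \<Rightarrow> 'a::complex_vector graded_va" and \<omega> \<theta> ip f \<Phi> f' \<Phi>'
begin

text \<open>The numbers are the matrix coefficients of the unitary maps \<open>f'\<^sub>N \<circ> f\<^sub>N\<^sup>-\<^sup>1\<close> between weight spaces,
  up to finitely many \<open>N\<close>.\<close>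

definition pairings_converge :: "nat filter \<Rightarrow> bool" where
  "pairings_converge F \<longleftrightarrow>
     (\<forall>n. \<forall>a\<in>A.onb n. \<forall>e\<in>B.onb n. \<exists>l. ((\<lambda>N. ip N (rep_germ a N) (rep_germ e N)) \<longlongrightarrow> l) F)"

lemma eventually_pairing_bounded:
  assumes a: "a \<in> A.onb n" and e: "e \<in> B.onb n"
  shows "eventually (\<lambda>N. cmod (ip N (rep_germ a N) (rep_germ e N)) \<le> 1) sequentially"
proof -
  have "A.ip_inf a a = 1" "B.ip_inf e e = 1"
    using A.onb(1)[of n] B.onb(1)[of n] a e by (simp_all add: A.form.orthonormal_def B.form.orthonormal_def)
  then have "eventually (\<lambda>N. ip N (rep_germ a N) (rep_germ a N) = 1) sequentially"
    "eventually (\<lambda>N. ip N (rep_germ e N) (rep_germ e N) = 1) sequentially"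
    using A.eventually_ip[OF A.onb_G[OF a] A.onb_G[OF a]] B.eventually_ip[OF B.onb_G[OF e] B.onb_G[OF e]]
    by simp_all
  then show ?thesis
    using A.eventually_rep_carr[OF A.onb_G[OF a]] B.eventually_rep_carr[OF B.onb_G[OF e]]
    by eventually_elim (rule A.alg.norm_ip_le_one)
qed

text \<open>There are countably many matrix coefficients, and each sequence of them is bounded.\<close>

lemma pairings_converge_exists: "\<exists>F. F \<le> sequentially \<and> F \<noteq> bot \<and> pairings_converge F"
proof -
  let ?I = "\<Union>n. A.onb n \<times> B.onb n"
  define h where "h p N = ip N (rep_germ (fst p) N) (rep_germ (snd p) N)" for p N
  have "countable ?I"
    using A.finite_onb B.finite_onb by (intro countable_UN) (auto intro: countable_finite)
  show ?thesis
  proof (cases "?I = {}")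
    case True
    then have "pairings_converge sequentially" unfolding pairings_converge_def by blast
    then show ?thesis using sequentially_bot by blast
  next
    case False
    define en where "en = from_nat_into ?I"
    have en: "en k \<in> ?I" for k unfolding en_def using False by (rule from_nat_into)
    have bound: "\<exists>K. \<forall>N\<ge>K. cmod (h (en k) N) \<le> 1" for k
    proof -
      obtain n where "fst (en k) \<in> A.onb n" "snd (en k) \<in> B.onb n" using en[of k] by auto
      then show ?thesis
        using eventually_pairing_bounded unfolding h_def eventually_sequentially by blast
    qed
    (* real parts at even, imaginary parts at odd indices *)
    define g where "g i N = (if even i then Re (h (en (i div 2)) N) else Im (h (en (i div 2)) N))" for i N
    have "Bseq (g i)" for i
    proof -
      obtain K where K: "\<forall>N\<ge>K. cmod (h (en (i div 2)) N) \<le> 1" using bound by blast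
      have "norm (g i N) \<le> 1" if "N \<ge> K" for N
        using K[rule_format, OF that] abs_Re_le_cmod[of "h (en (i div 2)) N"]
          abs_Im_le_cmod[of "h (en (i div 2)) N"] by (simp add: g_def)
      then show ?thesis by (intro BfunI[where K = 1] eventually_sequentiallyI)
    qed
    then obtain r where r: "strict_mono r" "\<And>i. convergent (\<lambda>k. g i (r k))"
      using diagonal_subsequence[of g] by blast
    let ?F = "filtermap r sequentially"
    have "\<exists>l. (h (en k) \<longlongrightarrow> l) ?F" for k
    proof -
      obtain x where "(\<lambda>j. g (2 * k) (r j)) \<longlonglongrightarrow> x" using r(2) unfolding convergent_def by blast
      moreover obtain y where "(\<lambda>j. g (2 * k + 1) (r j)) \<longlonglongrightarrow> y"
        using r(2) unfolding convergent_def by blast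
      ultimately have "(\<lambda>j. Complex (g (2 * k) (r j)) (g (2 * k + 1) (r j))) \<longlonglongrightarrow> Complex x y"
        by (rule tendsto_Complex)
      then have "(\<lambda>j. h (en k) (r j)) \<longlonglongrightarrow> Complex x y" by (simp add: g_def)
      then show ?thesis by (auto simp: filterlim_filtermap)
    qed
    then have conv: "\<exists>l. (h p \<longlongrightarrow> l) ?F" if "p \<in> ?I" for p
      using from_nat_into_surj[OF \<open>countable ?I\<close> that] unfolding en_def by metis
    have "pairings_converge ?F"
      unfolding pairings_converge_def
    proof (intro allI ballI)
      fix n a e assume "a \<in> A.onb n" "e \<in> B.onb n"
      then have "(a, e) \<in> ?I" by blast
      from conv[OF this] show "\<exists>l. ((\<lambda>N. ip N (rep_germ a N) (rep_germ e N)) \<longlongrightarrow> l) ?F"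
        unfolding h_def by simp
    qed
    moreover have "?F \<le> sequentially"
      using filterlim_subseq[OF r(1)] by (simp add: filterlim_def)
    moreover have "?F \<noteq> bot" by (simp add: filtermap_bot_iff)
    ultimately show ?thesis by blast
  qed
qed

text \<open>Expand the vectors of an orthonormal basis for the first system in one for the second; the
  coefficients are the pairings. A general \<open>a\<close> is a fixed combination of such basis vectors.\<close>

lemma transfer_homogeneous:
  assumes F: "F \<le> sequentially" "F \<noteq> bot" and conv: "pairings_converge F"
    and a: "a \<in> dl_grade V f n"
  shows "\<exists>b\<in>dl_grade V f' n. seq_limit V f' F (rep_germ a) b"
proof -
  have evF: "eventually P sequentially \<Longrightarrow> eventually P F" for P using F(1) by (rule filter_leD)
  have onb: "\<exists>b\<in>dl_grade V f' n. seq_limit V f' F (rep_germ e) b" if e: "e \<in> A.onb n" for e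
  proof -
    obtain l where l: "\<And>e'. e' \<in> B.onb n \<Longrightarrow> ((\<lambda>N. ip N (rep_germ e N) (rep_germ e' N)) \<longlongrightarrow> l e') F"
      using conv e unfolding pairings_converge_def by metis
    have lim: "seq_limit V f' F (\<lambda>N. \<Sum>e'\<in>B.onb n. ip N (rep_germ e N) (rep_germ e' N) *\<^sub>C rep_germ e' N)
        (\<Sum>e'\<in>B.onb n. l e' *\<^sub>C e')"
      by (intro B.tends_sum B.tends_scale F l seq_limit.germ B.onb_G)
    have "eventually (\<lambda>N. (\<Sum>e'\<in>B.onb n. ip N (rep_germ e N) (rep_germ e' N) *\<^sub>C rep_germ e' N)
        = rep_germ e N) F"
      using evF[OF B.eventually_onb_expansion[of n]] evF[OF A.eventually_rep_grade[OF A.onb_grade[OF e]]]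
      by eventually_elim (rule sym, blast)
    with lim have "seq_limit V f' F (rep_germ e) (\<Sum>e'\<in>B.onb n. l e' *\<^sub>C e')" by (rule seq_limit.cong)
    moreover have "(\<Sum>e'\<in>B.onb n. l e' *\<^sub>C e') \<in> dl_grade V f' n"
      by (intro complex_vector.subspace_sum[OF B.subspace_dl_grade]
          complex_vector.subspace_scale[OF B.subspace_dl_grade] B.onb_grade)
    ultimately show ?thesis by blast
  qed
  then obtain g where g: "\<And>e. e \<in> A.onb n \<Longrightarrow> g e \<in> dl_grade V f' n"
    "\<And>e. e \<in> A.onb n \<Longrightarrow> seq_limit V f' F (rep_germ e) (g e)" by metis
  let ?c = "A.ip_inf a"
  have a_eq: "a = (\<Sum>e\<in>A.onb n. ?c e *\<^sub>C e)"
    using A.form.orthonormal_expansion[OF A.onb(1)] A.onb(2) a by blast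
  have lim: "seq_limit V f' F (\<lambda>N. \<Sum>e\<in>A.onb n. ?c e *\<^sub>C rep_germ e N) (\<Sum>e\<in>A.onb n. ?c e *\<^sub>C g e)"
    by (intro B.tends_sum B.tends_scale_const F g)
  have "eventually (\<lambda>N. (\<Sum>e\<in>A.onb n. ?c e *\<^sub>C rep_germ e N) = rep_germ a N) F"
    using evF[OF eventually_rep_sum[of ?c "\<lambda>e. e" "A.onb n"]] unfolding a_eq[symmetric]
    by eventually_elim (rule sym)
  with lim have "seq_limit V f' F (rep_germ a) (\<Sum>e\<in>A.onb n. ?c e *\<^sub>C g e)" by (rule seq_limit.cong)
  moreover have "(\<Sum>e\<in>A.onb n. ?c e *\<^sub>C g e) \<in> dl_grade V f' n"
    by (intro complex_vector.subspace_sum[OF B.subspace_dl_grade]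
        complex_vector.subspace_scale[OF B.subspace_dl_grade] g)
  ultimately show ?thesis by blast
qed

text \<open>The map sends \<open>a\<close> to the limit, with respect to the second system, of the sequence that represents
  \<open>a\<close> in the first.\<close>

lemma transfer_map:
  assumes F: "F \<le> sequentially" "F \<noteq> bot" and conv: "pairings_converge F"
  obtains \<phi> where "clinear_on (dl_carr V f) \<phi>"
    "\<And>x a. seq_limit V f F x a \<Longrightarrow> seq_limit V f' F x (\<phi> a)"
    "\<And>n a. a \<in> dl_grade V f n \<Longrightarrow> \<phi> a \<in> dl_grade V f' n"
proof -
  have evF: "eventually P sequentially \<Longrightarrow> eventually P F" for P using F(1) by (rule filter_leD)
  have ex: "\<exists>b. seq_limit V f' F (rep_germ a) b" if a: "a \<in> dl_carr V f" for a
  proof -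
    have aW: "a \<in> carr A.W" using a by simp
    let ?S = "{n. component A.W a n \<noteq> 0}" and ?c = "component A.W a"
    have "\<exists>b. seq_limit V f' F (rep_germ (?c n)) b" for n
      using transfer_homogeneous[OF F conv] A.limit_space.component_grade[OF aW, of n] by auto
    then obtain b where b: "\<And>n. seq_limit V f' F (rep_germ (?c n)) (b n)" by metis
    have lim: "seq_limit V f' F (\<lambda>N. \<Sum>n\<in>?S. 1 *\<^sub>C rep_germ (?c n) N) (\<Sum>n\<in>?S. 1 *\<^sub>C b n)"
      by (intro B.tends_sum B.tends_scale_const F b)
    have sum: "(\<Sum>n\<in>?S. 1 *\<^sub>C ?c n) = a"
      using A.limit_space.component_sum[OF aW A.limit_space.component_finite[OF aW]] by (simp add: scaleC_one)
    have "eventually (\<lambda>N. (\<Sum>n\<in>?S. 1 *\<^sub>C rep_germ (?c n) N) = rep_germ a N) F"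
      using evF[OF eventually_rep_sum[of "\<lambda>_. 1" ?c ?S]] unfolding sum
      by eventually_elim (rule sym)
    from seq_limit.cong[OF lim this] show ?thesis by (rule exI)
  qed
  define \<phi> where "\<phi> a = (SOME b. seq_limit V f' F (rep_germ a) b)" for a
  have \<phi>: "seq_limit V f' F (rep_germ a) (\<phi> a)" if "a \<in> dl_carr V f" for a
    unfolding \<phi>_def by (rule someI_ex[OF ex[OF that]])
  have lin: "\<phi> (a + c *\<^sub>C b) = \<phi> a + c *\<^sub>C \<phi> b" if ab: "a \<in> dl_carr V f" "b \<in> dl_carr V f" for a b c
  proof (rule B.tends_unique[OF F])
    show "seq_limit V f' F (rep_germ (a + c *\<^sub>C b)) (\<phi> (a + c *\<^sub>C b))"
      using ab by (intro \<phi> A.form.S_add A.form.S_scale)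
    show "seq_limit V f' F (\<lambda>N. rep_germ a N + c *\<^sub>C rep_germ b N) (\<phi> a + c *\<^sub>C \<phi> b)"
      using ab by (intro seq_limit.lincomb \<phi> tendsto_const)
    show "eventually (\<lambda>N. rep_germ (a + c *\<^sub>C b) N = rep_germ a N + c *\<^sub>C rep_germ b N) F"
      by (rule evF[OF eventually_rep_lincomb])
  qed
  have zero: "\<phi> 0 = 0"
    using lin[OF A.form.S_zero A.form.S_zero, of "-1"] by (simp add: scaleC_one)
  have "clinear_on (dl_carr V f) \<phi>"
    unfolding clinear_on_def using lin[of _ _ 1] lin[OF A.form.S_zero] zero by (simp add: scaleC_one)
  moreover have "seq_limit V f' F x (\<phi> a)" if "seq_limit V f F x a" for x a
    using that
  proof (induction rule: seq_limit.induct)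
    case (germ a)
    then show ?case by (rule \<phi>)
  next
    case (lincomb x a y b c l)
    then show ?case
      using seq_limit.lincomb[OF lincomb.IH lincomb.hyps(3)] lin[of a b l]
        A.tends_G[OF F lincomb.hyps(1)] A.tends_G[OF F lincomb.hyps(2)] by simp
  next
    case (cong x a y)
    show ?case using cong.IH cong.hyps(2) by (rule seq_limit.cong)
  qed
  moreover have "\<phi> a \<in> dl_grade V f' n" if a: "a \<in> dl_grade V f n" for a n
  proof -
    obtain b where b: "b \<in> dl_grade V f' n" "seq_limit V f' F (rep_germ a) b"
      using transfer_homogeneous[OF F conv a] by blast
    have "a \<in> dl_carr V f" using a A.dl_grade_subset by blast
    from B.tends_unique[OF F \<phi>[OF this] b(2)] have "\<phi> a = b" by simp
    then show ?thesis using b(1) by simp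
  qed
  ultimately show ?thesis using that by blast
qed

text \<open>The maps \<open>\<phi>\<close> and \<open>\<psi>\<close> obtained in the two directions both preserve limits of sequences, so they
  are inverse to each other. Products are preserved because \<open>a\<^sub>n b\<close> and \<open>(\<phi> a)\<^sub>n (\<phi> b)\<close> are limits of
  the same sequence with respect to the two systems.\<close>

lemma limits_isomorphic: "isomorphic A.W B.W"
proof -
  interpret swap: system_pair V \<omega> \<theta> ip f' \<Phi>' f \<Phi> ..
  obtain F where F: "F \<le> sequentially" "F \<noteq> bot" and conv: "pairings_converge F"
    using pairings_converge_exists by blast
  have conv': "swap.pairings_converge F"
    unfolding swap.pairings_converge_def
  proof (intro allI ballI)
    fix n e a assume e: "e \<in> B.onb n" and a: "a \<in> A.onb n"
    obtain l where l: "((\<lambda>N. ip N (rep_germ a N) (rep_germ e N)) \<longlongrightarrow> l) F"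
      using conv a e unfolding pairings_converge_def by blast
    have "eventually (\<lambda>N. cnj (ip N (rep_germ a N) (rep_germ e N)) = ip N (rep_germ e N) (rep_germ a N)) sequentially"
      using A.eventually_rep_carr[OF A.onb_G[OF a]] B.eventually_rep_carr[OF B.onb_G[OF e]]
      by eventually_elim (rule A.alg.ip_cnj[symmetric])
    from Lim_transform_eventually[OF tendsto_cnj[OF l] filter_leD[OF F(1) this]]
    show "\<exists>l. ((\<lambda>N. ip N (rep_germ e N) (rep_germ a N)) \<longlongrightarrow> l) F" by (rule exI)
  qed
  obtain \<phi> where \<phi>: "clinear_on (dl_carr V f) \<phi>"
    "\<And>x a. seq_limit V f F x a \<Longrightarrow> seq_limit V f' F x (\<phi> a)"
    "\<And>n a. a \<in> dl_grade V f n \<Longrightarrow> \<phi> a \<in> dl_grade V f' n"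
    using transfer_map[OF F conv] by blast
  obtain \<psi> where \<psi>: "clinear_on (dl_carr V f') \<psi>"
    "\<And>x a. seq_limit V f' F x a \<Longrightarrow> seq_limit V f F x (\<psi> a)"
    "\<And>n a. a \<in> dl_grade V f' n \<Longrightarrow> \<psi> a \<in> dl_grade V f n"
    using swap.transfer_map[OF F conv'] by blast
  have \<psi>\<phi>: "\<psi> (\<phi> a) = a" if "a \<in> dl_carr V f" for a
    using A.tends_unique[OF F \<psi>(2)[OF \<phi>(2)[OF seq_limit.germ[OF that]]] seq_limit.germ[OF that]] by simp
  have \<phi>\<psi>: "\<phi> (\<psi> b) = b" if "b \<in> dl_carr V f'" for b
    using B.tends_unique[OF F \<phi>(2)[OF \<psi>(2)[OF seq_limit.germ[OF that]]] seq_limit.germ[OF that]] by simp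
  have \<phi>G: "\<phi> a \<in> dl_carr V f'" if "a \<in> dl_carr V f" for a
    by (rule B.tends_G[OF F \<phi>(2)[OF seq_limit.germ[OF that]]])
  have \<psi>G: "\<psi> b \<in> dl_carr V f" if "b \<in> dl_carr V f'" for b
    by (rule A.tends_G[OF F \<psi>(2)[OF seq_limit.germ[OF that]]])
  show ?thesis
    unfolding isomorphic_def A.carr_W B.carr_W A.grade_W B.grade_W
  proof (intro exI[of _ \<phi>] conjI ballI allI)
    show "bij_betw \<phi> (dl_carr V f) (dl_carr V f')"
      using \<phi>G \<psi>G by (intro bij_betw_byWitness[of _ \<psi>]) (auto simp: \<psi>\<phi> \<phi>\<psi>)
    show "clinear_on (dl_carr V f) \<phi>" by (rule \<phi>(1))
    have "eventually (\<lambda>N. rep_germ (vac A.W) N = rep_germ (vac B.W) N) F"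
      using filter_leD[OF F(1) A.eventually_rep_vac] filter_leD[OF F(1) B.eventually_rep_vac]
      by eventually_elim simp
    then show "\<phi> (vac A.W) = vac B.W"
      by (rule B.tends_unique[OF F \<phi>(2)[OF seq_limit.germ[OF A.vac_W]] seq_limit.germ[OF B.vac_W]])
  next
    fix a n b assume a: "a \<in> dl_carr V f" and b: "b \<in> dl_carr V f"
    show "\<phi> (mode A.W a n b) = mode B.W (\<phi> a) n (\<phi> b)"
      by (rule B.tends_unique[OF F \<phi>(2)[OF A.tends_mode_rep[OF F a b]]
            B.tends_mode[OF F \<phi>(2)[OF seq_limit.germ[OF a]] \<phi>(2)[OF seq_limit.germ[OF b]]]]) simp
  next
    fix n
    show "\<phi> ` dl_grade V f n = dl_grade V f' n"
    proof
      show "\<phi> ` dl_grade V f n \<subseteq> dl_grade V f' n" using \<phi>(3) by blast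
      show "dl_grade V f' n \<subseteq> \<phi> ` dl_grade V f n"
      proof
        fix b assume b: "b \<in> dl_grade V f' n"
        then have "b = \<phi> (\<psi> b)" using \<phi>\<psi> B.dl_grade_subset by (metis subsetD)
        then show "b \<in> \<phi> ` dl_grade V f n" using \<psi>(3)[OF b] by blast
      qed
    qed
  qed
qed

end

theorem proposition6p6:
  fixes V :: "nat \<Rightarrow> 'a::complex_vector graded_va"
    and \<omega> :: "nat \<Rightarrow> 'a"
    and \<theta> :: "nat \<Rightarrow> 'a \<Rightarrow> 'a"
    and ip :: "nat \<Rightarrow> 'a \<Rightarrow> 'a \<Rightarrow> complex"
  assumes "\<And>N. unitary_voa (V N) (\<omega> N) (\<theta> N) (ip N)"
    and "\<And>N. cft_type (V N)"
  shows "(\<forall>f \<Phi>.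
            grading_restricted_direct_system V f \<and>
            compatible_with_unitary_structure V \<theta> ip f \<and>
            homogeneous_basis V f \<Phi> \<and>
            struct_const_converge V f \<Phi> \<longrightarrow>
            (\<exists>W. is_VA_limit V f \<Phi> W \<and>
               grading_restricted W \<and> unitary_moebius W \<and> cft_type W)) \<and>
         (\<forall>f \<Phi> f' \<Phi>' W W'.
            grading_restricted_direct_system V f \<and>
            compatible_with_unitary_structure V \<theta> ip f \<and>
            homogeneous_basis V f \<Phi> \<and>
            struct_const_converge V f \<Phi> \<and>
            is_VA_limit V f \<Phi> W \<and> factorizes W \<and>
            grading_restricted_direct_system V f' \<and>
            compatible_with_unitary_structure V \<theta> ip f' \<and>
            homogeneous_basis V f' \<Phi>' \<and>
            struct_const_converge V f' \<Phi>' \<and>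
            is_VA_limit V f' \<Phi>' W' \<and> factorizes W' \<longrightarrow>
            isomorphic W W')"
proof (intro conjI allI impI; elim conjE)
  fix f \<Phi>
  assume *: "grading_restricted_direct_system V f" "compatible_with_unitary_structure V \<theta> ip f"
    "homogeneous_basis V f \<Phi>" "struct_const_converge V f \<Phi>"
  interpret convergent_unitary_system V \<omega> \<theta> ip f \<Phi>
    using assms * by unfold_locales
  show "\<exists>W. is_VA_limit V f \<Phi> W \<and> grading_restricted W \<and> unitary_moebius W \<and> cft_type W"
    using *(4) grading_restricted_W unitary_moebius_W cft_type_W by (auto simp: is_VA_limit_def)
next
  fix f \<Phi> f' \<Phi>' W W'
  assume f: "grading_restricted_direct_system V f" "compatible_with_unitary_structure V \<theta> ip f"
      "homogeneous_basis V f \<Phi>" "struct_const_converge V f \<Phi>"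
    and f': "grading_restricted_direct_system V f'" "compatible_with_unitary_structure V \<theta> ip f'"
      "homogeneous_basis V f' \<Phi>'" "struct_const_converge V f' \<Phi>'"
    and W: "is_VA_limit V f \<Phi> W" "is_VA_limit V f' \<Phi>' W'"
  interpret system_pair V \<omega> \<theta> ip f \<Phi> f' \<Phi>'
    using assms f f' by unfold_locales
  show "isomorphic W W'"
    using limits_isomorphic W by (simp add: is_VA_limit_def)
qed

end
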